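(* Let $\kappa$ be an uncountable cardinal. Then there exist $2^\kappa$ many weakly compact convex subsets of the Hilbert space $\ell_2(\kappa)$, each of weight $\kappa$ in the weak topology, which are pairwise non-homeomorphic when endowed with the weak topology.
   Context: $\ell_2(\kappa)$ is the Hilbert space of square-summable real families indexed by $\kappa$. The weight of a topological space is the least cardinality of a base of its topology. All topological notions for these sets (compactness, weight, homeomorphism) refer to the weak topology of $\ell_2(\kappa)$. *)

theory Defs
  imports "HOL-Analysis.Analysis"
begin

unbundle cardinal_syntax
no_notation Set_Algebras.elt_set_eq (infix "=o" 50)

text \<open>
  The index set of the Hilbert space is the universe of the type \<open>'k\<close>, so that the cardinal
  \<open>\<kappa>\<close> is \<open>|UNIV :: 'k set|\<close>.
\<close>

typedef 'k ell2 = "{f :: 'k \<Rightarrow> real. (\<lambda>i. (f i)\<^sup>2) summable_on UNIV}"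
  morphisms ell2_nth Abs_ell2
  by (rule exI[of _ "\<lambda>_. 0"]) simp

setup_lifting type_definition_ell2

lemma summable_on_mult_of_squares:
  fixes f g :: "'k \<Rightarrow> real"
  assumes "(\<lambda>i. (f i)\<^sup>2) summable_on A" and "(\<lambda>i. (g i)\<^sup>2) summable_on A"
  shows "(\<lambda>i. f i * g i) summable_on A"
proof -
  have "(\<lambda>i. norm (f i * g i)) summable_on A"
    by (rule abs_summable_product)
      (use assms in \<open>simp_all add: power2_eq_square flip: summable_on_iff_abs_summable_on_real\<close>)
  then show ?thesis
    by (rule abs_summable_summable)
qed

lemma summable_on_square_add:
  fixes f g :: "'k \<Rightarrow> real"
  assumes "(\<lambda>i. (f i)\<^sup>2) summable_on A" and "(\<lambda>i. (g i)\<^sup>2) summable_on A"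
  shows "(\<lambda>i. (f i + g i)\<^sup>2) summable_on A"
proof -
  have "(\<lambda>i. ((f i)\<^sup>2 + (g i)\<^sup>2) + 2 * (f i * g i)) summable_on A"
    by (intro summable_on_add summable_on_cmult_right summable_on_mult_of_squares assms)
  then show ?thesis
    by (simp add: power2_sum mult.assoc)
qed

instantiation ell2 :: (type) real_vector
begin

lift_definition zero_ell2 :: "'a ell2" is "\<lambda>_. 0"
  by simp

lift_definition plus_ell2 :: "'a ell2 \<Rightarrow> 'a ell2 \<Rightarrow> 'a ell2" is "\<lambda>f g i. f i + g i"
  by (simp add: summable_on_square_add)

lift_definition uminus_ell2 :: "'a ell2 \<Rightarrow> 'a ell2" is "\<lambda>f i. - f i"
  by simp

lift_definition minus_ell2 :: "'a ell2 \<Rightarrow> 'a ell2 \<Rightarrow> 'a ell2" is "\<lambda>f g i. f i - g i"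
  subgoal for f g
    using summable_on_square_add[of f UNIV "\<lambda>i. - g i"] by simp
  done

lift_definition scaleR_ell2 :: "real \<Rightarrow> 'a ell2 \<Rightarrow> 'a ell2" is "\<lambda>c f i. c * f i"
  by (simp add: power_mult_distrib summable_on_cmult_right)

instance
  by standard (transfer; simp add: fun_eq_iff algebra_simps)+

end

instantiation ell2 :: (type) real_inner
begin

lift_definition inner_ell2 :: "'a ell2 \<Rightarrow> 'a ell2 \<Rightarrow> real"
  is "\<lambda>f g. \<Sum>\<^sub>\<infinity>i. f i * g i" .

definition norm_ell2 :: "'a ell2 \<Rightarrow> real"
  where "norm_ell2 x = sqrt (x \<bullet> x)"

definition dist_ell2 :: "'a ell2 \<Rightarrow> 'a ell2 \<Rightarrow> real"
  where "dist_ell2 x y = norm (x - y)"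

definition sgn_ell2 :: "'a ell2 \<Rightarrow> 'a ell2"
  where "sgn_ell2 x = inverse (norm x) *\<^sub>R x"

definition uniformity_ell2 :: "('a ell2 \<times> 'a ell2) filter"
  where "uniformity_ell2 = (INF e\<in>{0<..}. principal {(x, y). dist x y < e})"

definition open_ell2 :: "'a ell2 set \<Rightarrow> bool"
  where "open_ell2 U \<longleftrightarrow> (\<forall>x\<in>U. \<forall>\<^sub>F (x', y) in uniformity. x' = x \<longrightarrow> y \<in> U)"

instance
proof
  fix x y z :: "'a ell2" and r :: real
  show "dist x y = norm (x - y)"
    by (rule dist_ell2_def)
  show "sgn x = x /\<^sub>R norm x"
    by (rule sgn_ell2_def)
  show "(uniformity :: ('a ell2 \<times> 'a ell2) filter) = (INF e\<in>{0<..}. principal {(x, y). dist x y < e})"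
    by (rule uniformity_ell2_def)
  show "open U = (\<forall>x\<in>U. \<forall>\<^sub>F (x', y) in uniformity. x' = x \<longrightarrow> y \<in> U)" for U :: "'a ell2 set"
    by (rule open_ell2_def)
  show "x \<bullet> y = y \<bullet> x"
    by transfer (simp add: mult.commute)
  show "(x + y) \<bullet> z = x \<bullet> z + y \<bullet> z"
    by transfer (simp add: distrib_right infsum_add summable_on_mult_of_squares)
  show "(r *\<^sub>R x) \<bullet> y = r * (x \<bullet> y)"
    by transfer (simp add: mult.assoc infsum_cmult_right')
  show "0 \<le> x \<bullet> x"
    by transfer (simp add: infsum_nonneg)
  show "x \<bullet> x = 0 \<longleftrightarrow> x = 0"
  proof
    assume "x \<bullet> x = 0"
    then have sum: "(\<Sum>\<^sub>\<infinity>i. ell2_nth x i * ell2_nth x i) = 0"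
      by transfer
    have "ell2_nth x i * ell2_nth x i = 0" for i
      by (rule nonneg_infsum_le_0D[of "\<lambda>i. ell2_nth x i * ell2_nth x i" UNIV])
        (use ell2_nth[of x] sum in \<open>simp_all add: power2_eq_square\<close>)
    then have "ell2_nth x = ell2_nth 0"
      by (simp add: fun_eq_iff zero_ell2.rep_eq)
    then show "x = 0"
      by (simp add: ell2_nth_inject)
  qed (transfer, simp)
  show "norm x = sqrt (x \<bullet> x)"
    by (rule norm_ell2_def)
qed

end

lemma norm_ell2_square: "(norm x)\<^sup>2 = (\<Sum>\<^sub>\<infinity>i. (ell2_nth x i)\<^sup>2)"
  unfolding power2_norm_eq_inner by transfer (simp add: power2_eq_square)

lemma summable_ell2_nth: "(\<lambda>i. (ell2_nth x i)\<^sup>2) summable_on A"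
  using ell2_nth[of x] summable_on_subset_banach[of _ UNIV A] by blast

lemma sum_ell2_nth_le: "finite F \<Longrightarrow> (\<Sum>i\<in>F. (ell2_nth x i)\<^sup>2) \<le> (norm x)\<^sup>2"
  unfolding norm_ell2_square by (rule finite_sum_le_infsum) (auto intro: summable_ell2_nth)

lemma abs_ell2_nth_le: "\<bar>ell2_nth x i\<bar> \<le> norm x"
  using sum_ell2_nth_le[of "{i}" x] by (simp add: abs_le_square_iff[symmetric])

lemma ell2_nth_diff: "ell2_nth (x - y) i = ell2_nth x i - ell2_nth y i"
  by transfer simp

instance ell2 :: (type) banach
proof
  fix X :: "nat \<Rightarrow> 'a ell2"
  assume X: "Cauchy X"
  define f where "f i = lim (\<lambda>n. ell2_nth (X n) i)" for i
  have lim: "(\<lambda>n. ell2_nth (X n) i) \<longlonglongrightarrow> f i" for i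
  proof -
    have "Cauchy (\<lambda>n. ell2_nth (X n) i)"
    proof (rule CauchyI)
      fix e :: real
      assume "0 < e"
      then obtain M where "\<forall>m\<ge>M. \<forall>n\<ge>M. norm (X m - X n) < e"
        using CauchyD[OF X] by blast
      then show "\<exists>M. \<forall>m\<ge>M. \<forall>n\<ge>M. norm (ell2_nth (X m) i - ell2_nth (X n) i) < e"
        using abs_ell2_nth_le[of "X _ - X _" i]
        by (metis ell2_nth_diff le_less_trans real_norm_def)
    qed
    then show ?thesis
      unfolding f_def by (simp add: Cauchy_convergent convergent_LIMSEQ_iff[symmetric])
  qed
  have bound: "(\<Sum>i\<in>F. (f i - ell2_nth (X n) i)\<^sup>2) \<le> e\<^sup>2"
    if "finite F" and "0 \<le> e" and "\<forall>m\<ge>n. norm (X m - X n) \<le> e" for F n e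
  proof (rule LIMSEQ_le_const2)
    show "(\<lambda>m. \<Sum>i\<in>F. (ell2_nth (X m) i - ell2_nth (X n) i)\<^sup>2)
        \<longlonglongrightarrow> (\<Sum>i\<in>F. (f i - ell2_nth (X n) i)\<^sup>2)"
      by (intro tendsto_intros lim)
    have "(\<Sum>i\<in>F. (ell2_nth (X m) i - ell2_nth (X n) i)\<^sup>2) \<le> e\<^sup>2" if "n \<le> m" for m
    proof -
      have "(\<Sum>i\<in>F. (ell2_nth (X m - X n) i)\<^sup>2) \<le> (norm (X m - X n))\<^sup>2"
        using \<open>finite F\<close> by (rule sum_ell2_nth_le)
      also have "\<dots> \<le> e\<^sup>2"
        using that \<open>\<forall>m\<ge>n. norm (X m - X n) \<le> e\<close> by (intro power_mono) auto
      finally show ?thesis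
        by (simp add: ell2_nth_diff)
    qed
    then show "\<exists>N. \<forall>m\<ge>N. (\<Sum>i\<in>F. (ell2_nth (X m) i - ell2_nth (X n) i)\<^sup>2) \<le> e\<^sup>2"
      by blast
  qed
  have diff: "(\<lambda>i. (f i - ell2_nth (X n) i)\<^sup>2) summable_on UNIV"
    if "0 \<le> e" and "\<forall>m\<ge>n. norm (X m - X n) \<le> e" for n e
    by (rule nonneg_bounded_partial_sums_imp_summable_on[where C = "e\<^sup>2"])
      (use bound[OF _ that] in \<open>auto intro!: eventually_finite_subsets_at_top_weakI\<close>)
  have "f \<in> {f. (\<lambda>i. (f i)\<^sup>2) summable_on UNIV}"
  proof -
    obtain N where "\<forall>m\<ge>N. \<forall>n\<ge>N. norm (X m - X n) < 1"
      using CauchyD[OF X, of 1] by auto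
    then have "(\<lambda>i. (f i - ell2_nth (X N) i)\<^sup>2) summable_on UNIV"
      by (intro diff[of 1]) (auto intro: less_imp_le)
    from summable_on_square_add[OF this summable_ell2_nth[of "X N"]] show ?thesis
      by simp
  qed
  then have f: "ell2_nth (Abs_ell2 f) = f"
    by (rule Abs_ell2_inverse)
  have "X \<longlonglongrightarrow> Abs_ell2 f"
  proof (rule LIMSEQ_I)
    fix r :: real
    assume "0 < r"
    then obtain N where N: "\<forall>m\<ge>N. \<forall>n\<ge>N. norm (X m - X n) < r / 2"
      using CauchyD[OF X, of "r / 2"] by auto
    have "norm (X n - Abs_ell2 f) < r" if "N \<le> n" for n
    proof -
      have n: "\<forall>m\<ge>n. norm (X m - X n) \<le> r / 2"
        using N that by (meson less_imp_le order_trans)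
      have "(norm (Abs_ell2 f - X n))\<^sup>2 = (\<Sum>\<^sub>\<infinity>i. (f i - ell2_nth (X n) i)\<^sup>2)"
        by (simp add: norm_ell2_square ell2_nth_diff f)
      also have "\<dots> \<le> (r / 2)\<^sup>2"
        using \<open>0 < r\<close> by (intro infsum_le_finite_sums diff[OF _ n] bound[OF _ _ n]) auto
      finally have "norm (Abs_ell2 f - X n) \<le> r / 2"
        by (rule power2_le_imp_le) (use \<open>0 < r\<close> in simp)
      then show ?thesis
        using \<open>0 < r\<close> by (simp add: norm_minus_commute)
    qed
    then show "\<exists>N. \<forall>n\<ge>N. norm (X n - Abs_ell2 f) < r"
      by blast
  qed
  then show "convergent X"
    by (rule convergentI)
qed

definition weak_topology :: "'a::real_normed_vector topology"
  where "weak_topology =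
    topology_generated_by {f -` U | (f :: 'a \<Rightarrow> real) U. bounded_linear f \<and> open U}"

definition base_of :: "'a topology \<Rightarrow> 'a set set \<Rightarrow> bool"
  where "base_of X \<B> \<longleftrightarrow> (\<forall>V\<in>\<B>. openin X V) \<and>
    (\<forall>U x. openin X U \<and> x \<in> U \<longrightarrow> (\<exists>V\<in>\<B>. x \<in> V \<and> V \<subseteq> U))"

text \<open>
  Cardinals are well-orders compared up to isomorphism, and a base of a topology and the
  cardinal \<open>r\<close> may live on different types; hence the weight is given as a relation
  ``the least cardinality of a base of \<open>X\<close> is \<open>r\<close>'' and not as a value.
\<close>

definition has_weight :: "'a topology \<Rightarrow> 'b rel \<Rightarrow> bool"
  where "has_weight X r \<longleftrightarrow>
    (\<exists>\<B>. base_of X \<B> \<and> |\<B>| =o r) \<and> (\<forall>\<B>. base_of X \<B> \<longrightarrow> r \<le>o |\<B>| )"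

end

theory Submission
  imports Defs
begin

text \<open>
  Every digraph \<open>E\<close> on a vertex set of size \<open>\<kappa>\<close> yields a convex body, and enough of \<open>E\<close> can be
  read off the topology of that body to tell \<open>2 ^ \<kappa>\<close> suitable digraphs apart.

  A point of the body is a family of nonnegative reals arranged in rows, called blocks. The sum of a
  block is bounded by its capacity: \<open>1\<close> for the block \<open>Root\<close>, whose entries are weights of the
  vertices; the weight of \<open>v\<close> for the block \<open>Node v\<close> of a vertex with an outgoing edge; and for an
  edge from \<open>v\<close> to \<open>u\<close> the smaller of the \<open>i\<close>-th entry of \<open>Node v\<close> and the weight of \<open>u\<close> for the
  block \<open>Link v i u\<close>. A minimum of coordinates is concave and continuous, so the body is convex and
  closed under pointwise limits, and its points have square sums at most \<open>3\<close>. On bounded subsets of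
  the Hilbert space the weak topology is the pointwise one, so the body is weakly compact.

  A block is slack at \<open>p\<close> if its sum is below its capacity. Its slack can be put on any of uncountably
  many unused entries, which gives an uncountable family that converges to \<open>p\<close>; two slack blocks give
  two independent such families. Neighbourhoods of \<open>p\<close> only see finitely many entries, so conversely a
  generic member of a family converging to \<open>p\<close> agrees with \<open>p\<close> on the support of \<open>p\<close> and uses up
  slack elsewhere. From this the following notions turn out to be topological. First, exactly one block
  is slack at \<open>p\<close>: \<open>p\<close> is the limit of a nontrivial uncountable family, but two independent families of
  separated points would each need more than half of the only slack there is (\<open>simple_points_iff\<close>).
  Second, two such points have the same slack block: they are joined by a path that is the limit of
  uncountably many paths that differ from it at all times, and the slack block is locally constant along
  any such path (\<open>joined_class_eq\<close>). The classes of this relation stand for the blocks.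

  The edges are seen by consuming slack, for digraphs whose edges lead from sources to sinks. Putting the slack of \<open>Node v\<close> on a new entry \<open>k\<close> at a point
  where \<open>u\<close> has positive weight opens the block \<open>Link v k u\<close> exactly if there is an edge from \<open>v\<close> to
  \<open>u\<close>. Hence \<open>Link\<close> blocks are those whose class is not approached from other classes, and the classes
  of \<open>Node v\<close> and \<open>Link a i u\<close> are jointly approachable without approaching further classes if and only
  if there is no edge from \<open>v\<close> to \<open>u\<close> (\<open>compatible_iff\<close>). A homeomorphism of two bodies therefore
  carries the sources of one digraph to those of the other, and in-neighbourhoods to in-neighbourhoods
  (\<open>homeomorphic_networks\<close>). It remains to code a set \<open>S \<subseteq> \<kappa>\<close> by a family of in-neighbourhoods that
  determines \<open>S\<close> up to bijection: initial segments of a well-order with doubled elements, which are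
  rigid and never singletons, together with one singleton for each element of \<open>S\<close> (\<open>in_neighbourhoods_determine\<close>).
\<close>

section \<open>Convex bodies coded by digraphs\<close>

datatype 'v block = Root | Node 'v | Link 'v 'v 'v

text \<open>
  Vertices without outgoing edge get capacity \<open>0\<close>: consuming the slack of their blocks could open no
  further block, so these blocks would be topologically of the same kind as \<open>Link\<close> blocks.
\<close>

fun cap :: "('v \<Rightarrow> 'v \<Rightarrow> bool) \<Rightarrow> 'v block \<Rightarrow> ('v block \<times> 'v \<Rightarrow> real) \<Rightarrow> real" where
  "cap E Root z = 1"
| "cap E (Node v) z = (if \<exists>u. E v u then z (Root, v) else 0)"
| "cap E (Link v i u) z = (if E v u then min (z (Node v, i)) (z (Root, u)) else 0)"

text \<open>
  Bounding finite partial sums instead of the infinite sum makes it visible that the conditions are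
  preserved by pointwise limits.
\<close>

definition body :: "('v \<Rightarrow> 'v \<Rightarrow> bool) \<Rightarrow> ('v block \<times> 'v \<Rightarrow> real) set" where
  "body E = {z. (\<forall>c. 0 \<le> z c) \<and> (\<forall>b F. finite F \<longrightarrow> (\<Sum>i\<in>F. z (b, i)) \<le> cap E b z)}"

definition mass :: "'v block \<Rightarrow> ('v block \<times> 'v \<Rightarrow> real) \<Rightarrow> real" where
  "mass b z = (\<Sum>\<^sub>\<infinity>i. z (b, i))"

definition slack :: "('v \<Rightarrow> 'v \<Rightarrow> bool) \<Rightarrow> 'v block \<Rightarrow> ('v block \<times> 'v \<Rightarrow> real) \<Rightarrow> real" where
  "slack E b z = cap E b z - mass b z"

definition slacks :: "('v \<Rightarrow> 'v \<Rightarrow> bool) \<Rightarrow> ('v block \<times> 'v \<Rightarrow> real) \<Rightarrow> 'v block set" where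
  "slacks E z = {b. 0 < slack E b z}"

lemma body_nonneg: "z \<in> body E \<Longrightarrow> 0 \<le> z c"
  unfolding body_def by blast

lemma body_sum_le: "z \<in> body E \<Longrightarrow> finite F \<Longrightarrow> (\<Sum>i\<in>F. z (b, i)) \<le> cap E b z"
  by (simp add: body_def)

lemma body_summable: "z \<in> body E \<Longrightarrow> (\<lambda>i. z (b, i)) summable_on A"
  by (rule nonneg_bounded_partial_sums_imp_summable_on[where C = "cap E b z"])
    (auto simp: body_nonneg intro!: eventually_finite_subsets_at_top_weakI body_sum_le)

lemma mass_le_cap: "z \<in> body E \<Longrightarrow> mass b z \<le> cap E b z"
  unfolding mass_def by (rule infsum_le_finite_sums) (auto simp: body_summable body_sum_le)

lemma slack_nonneg: "z \<in> body E \<Longrightarrow> 0 \<le> slack E b z"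
  by (simp add: slack_def mass_le_cap)

lemma sum_le_mass: "z \<in> body E \<Longrightarrow> finite F \<Longrightarrow> (\<Sum>i\<in>F. z (b, i)) \<le> mass b z"
  unfolding mass_def by (rule finite_sum_le_infsum) (auto simp: body_summable body_nonneg)

lemma coord_le_mass: "z \<in> body E \<Longrightarrow> z (b, i) \<le> mass b z"
  using sum_le_mass[of z E "{i}" b] by simp

lemma mass_nonneg: "z \<in> body E \<Longrightarrow> 0 \<le> mass b z"
  unfolding mass_def by (rule infsum_nonneg) (simp add: body_nonneg)

lemma bodyI:
  assumes nn: "\<And>c. 0 \<le> z c" and "\<And>b. (\<lambda>i. z (b, i)) summable_on UNIV"
    and le: "\<And>b. mass b z \<le> cap E b z"
  shows "z \<in> body E"
proof -
  have "(\<Sum>i\<in>F. z (b, i)) \<le> cap E b z" if "finite F" for b F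
  proof -
    have "(\<Sum>i\<in>F. z (b, i)) \<le> mass b z"
      unfolding mass_def by (rule finite_sum_le_infsum) (use assms that in auto)
    then show ?thesis using le[of b] by simp
  qed
  then show ?thesis using nn by (simp add: body_def)
qed

lemma cap_mono: "(\<And>c. z c \<le> z' c) \<Longrightarrow> cap E b z \<le> cap E b z'"
  by (cases b) (auto simp: min_le_iff_disj)

lemma coord_le_cap: "z \<in> body E \<Longrightarrow> z (b, i) \<le> cap E b z"
  using coord_le_mass mass_le_cap by (rule order_trans)

lemma body_Root_le_1: "z \<in> body E \<Longrightarrow> z (Root, i) \<le> 1"
  using coord_le_cap[of z E Root i] by simp

lemma cap_le_1:
  assumes "z \<in> body E"
  shows "cap E b z \<le> 1"
proof (cases b)
  case (Node v)
  then show ?thesis using body_Root_le_1[OF assms] by simp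
next
  case (Link v i u)
  then show ?thesis using body_Root_le_1[OF assms, of u] by (auto simp: min_def)
qed simp

lemma body_le_1: "z \<in> body E \<Longrightarrow> z c \<le> 1"
  using coord_le_cap[of z E "fst c" "snd c"] cap_le_1[of z E "fst c"] by simp

text \<open>
  Consuming slack: each block in \<open>L\<close> puts all its slack on its entry \<open>k\<close>. The capacities are those
  before the move, so entries of \<open>L\<close> may raise the capacity of other blocks, which regain slack.
\<close>

definition fill ::
  "('v \<Rightarrow> 'v \<Rightarrow> bool) \<Rightarrow> 'v block set \<Rightarrow> 'v \<Rightarrow> ('v block \<times> 'v \<Rightarrow> real) \<Rightarrow> 'v block \<times> 'v \<Rightarrow> real" where
  "fill E L k z = (\<lambda>(b, i). z (b, i) + (if i = k \<and> b \<in> L then slack E b z else 0))"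

lemma fill_apply: "fill E L k z (b, i) = z (b, i) + (if i = k \<and> b \<in> L then slack E b z else 0)"
  by (simp add: fill_def)

lemma fill_other: "i \<noteq> k \<or> b \<notin> L \<Longrightarrow> fill E L k z (b, i) = z (b, i)"
  by (auto simp: fill_apply)

lemma single_has_sum: "((\<lambda>i. if i = k then s else 0) has_sum (s::real)) UNIV"
  using has_sum_finite_neutralI[of "{k}" UNIV "\<lambda>i. if i = k then s else 0"] by auto

lemma mass_fill:
  assumes "z \<in> body E"
  shows "(\<lambda>i. fill E L k z (b, i)) summable_on UNIV"
    and "mass b (fill E L k z) = mass b z + (if b \<in> L then slack E b z else 0)"
proof -
  have s: "((\<lambda>i. if i = k then (if b \<in> L then slack E b z else 0) else 0)
      has_sum (if b \<in> L then slack E b z else 0)) UNIV"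
    by (rule single_has_sum)
  have "((\<lambda>i. z (b, i)) has_sum mass b z) UNIV"
    unfolding mass_def by (rule has_sum_infsum) (rule body_summable[OF assms])
  from has_sum_add[OF this s]
  have h: "((\<lambda>i. fill E L k z (b, i)) has_sum (mass b z + (if b \<in> L then slack E b z else 0))) UNIV"
    by (rule has_sum_cong[THEN iffD1, rotated]) (auto simp: fill_apply)
  then show "(\<lambda>i. fill E L k z (b, i)) summable_on UNIV"
    by (rule has_sum_imp_summable)
  show "mass b (fill E L k z) = mass b z + (if b \<in> L then slack E b z else 0)"
    unfolding mass_def[of b "fill E L k z"] using h by (rule infsumI)
qed

lemma fill_ge: "z \<in> body E \<Longrightarrow> z c \<le> fill E L k z c"
  by (cases c) (simp add: fill_apply slack_nonneg)

lemma fill_body: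
  assumes "z \<in> body E"
  shows "fill E L k z \<in> body E"
proof (rule bodyI)
  show "0 \<le> fill E L k z c" for c
    using fill_ge[OF assms, of c L k] body_nonneg[OF assms, of c] by simp
  show "(\<lambda>i. fill E L k z (b, i)) summable_on UNIV" for b
    by (rule mass_fill[OF assms])
  fix b
  have "mass b (fill E L k z) \<le> cap E b z"
    using mass_le_cap[OF assms, of b] by (simp add: mass_fill[OF assms] slack_def)
  also have "\<dots> \<le> cap E b (fill E L k z)"
    by (rule cap_mono) (rule fill_ge[OF assms])
  finally show "mass b (fill E L k z) \<le> cap E b (fill E L k z)" .
qed

lemma slack_fill:
  "z \<in> body E \<Longrightarrow> slack E b (fill E L k z) =
    cap E b (fill E L k z) - cap E b z + (if b \<in> L then 0 else slack E b z)"
  by (simp add: slack_def mass_fill)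

text \<open>
  The squares in a block add up to at most the square of its capacity. The squared capacities of the
  \<open>Node\<close> blocks are bounded by the weights; that of \<open>Link v j u\<close> is at most the product of its two
  cap entries, and these products sum to at most \<open>1\<close>. This is where a minimum of two entries is
  better than a single one, which would be repeated for every \<open>u\<close>.
\<close>

lemma body_square_sum_le:
  assumes z: "z \<in> body E" and F: "finite F"
  shows "(\<Sum>c\<in>F. (z c)\<^sup>2) \<le> 3"
proof -
  define I where "I = snd ` F"
  \<comment> \<open>All vertices that occur in \<open>F\<close>, so that the sum over \<open>F\<close> can be enlarged to one over full blocks.\<close>
  define V where "V = snd ` F \<union> (\<Union>(b, i)\<in>F. case b of Root \<Rightarrow> {} | Node v \<Rightarrow> {v} | Link v j u \<Rightarrow> {v, j, u})"
  have V: "finite V" unfolding V_def using F by (auto split: block.splits)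
  define B where "B = {Root} \<union> Node ` V \<union> (\<lambda>(v, j, u). Link v j u) ` (V \<times> V \<times> V)"
  have B: "finite B" using V by (simp add: B_def)
  have sub: "F \<subseteq> B \<times> V"
  proof
    fix c assume c: "c \<in> F"
    obtain b i where bi: "c = (b, i)" by force
    have "i \<in> V" using c bi by (force simp: V_def)
    moreover have "b \<in> B"
    proof (cases b)
      case (Node v)
      then have "v \<in> V" using c bi by (force simp: V_def)
      then show ?thesis using Node by (simp add: B_def)
    next
      case (Link v j u)
      then have "v \<in> V" "j \<in> V" "u \<in> V" using c bi by (force simp: V_def)+
      then show ?thesis using Link by (force simp: B_def)
    qed (simp add: B_def)
    ultimately show "c \<in> B \<times> V" using bi by simp
  qed
  have nn: "0 \<le> z c" for c by (rule body_nonneg[OF z])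
  have root: "(\<Sum>v\<in>V. z (Root, v)) \<le> 1"
    using body_sum_le[OF z V, of Root] by simp
  have sq: "x\<^sup>2 \<le> x" if "0 \<le> x" "x \<le> 1" for x :: real
    using that by (simp add: power2_eq_square mult_left_le)
  have capnn: "0 \<le> cap E b z" for b
    using mass_le_cap[OF z, of b] mass_nonneg[OF z, of b] by simp
  have "(\<Sum>c\<in>F. (z c)\<^sup>2) \<le> (\<Sum>c\<in>B \<times> V. (z c)\<^sup>2)"
    using B V sub by (intro sum_mono2) auto
  also have "\<dots> = (\<Sum>b\<in>B. \<Sum>i\<in>V. (z (b, i))\<^sup>2)"
    by (simp add: sum.cartesian_product)
  also have "\<dots> \<le> (\<Sum>b\<in>B. (cap E b z)\<^sup>2)"
  proof (rule sum_mono)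
    fix b
    have "(\<Sum>i\<in>V. (z (b, i))\<^sup>2) \<le> (\<Sum>i\<in>V. z (b, i) * cap E b z)"
      unfolding power2_eq_square
      by (intro sum_mono mult_left_mono coord_le_cap[OF z] nn)
    also have "\<dots> = (\<Sum>i\<in>V. z (b, i)) * cap E b z"
      by (simp add: sum_distrib_right)
    also have "\<dots> \<le> cap E b z * cap E b z"
      by (intro mult_right_mono body_sum_le[OF z V] capnn)
    finally show "(\<Sum>i\<in>V. (z (b, i))\<^sup>2) \<le> (cap E b z)\<^sup>2"
      by (simp add: power2_eq_square)
  qed
  also have "\<dots> = 1 + (\<Sum>v\<in>V. (cap E (Node v) z)\<^sup>2) + (\<Sum>(v, j, u)\<in>V \<times> V \<times> V. (cap E (Link v j u) z)\<^sup>2)"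
  proof -
    have 1: "sum g B = sum g ({Root} \<union> Node ` V) + sum g ((\<lambda>(v, j, u). Link v j u) ` (V \<times> V \<times> V))"
      for g :: "'a block \<Rightarrow> real"
      unfolding B_def by (rule sum.union_disjoint) (use V in auto)
    have 2: "sum g ({Root} \<union> Node ` V) = g Root + (\<Sum>v\<in>V. g (Node v))"
      for g :: "'a block \<Rightarrow> real"
      using V by (subst sum.union_disjoint) (auto simp: sum.reindex inj_on_def)
    have 3: "sum g ((\<lambda>(v, j, u). Link v j u) ` (V \<times> V \<times> V)) = (\<Sum>(v, j, u)\<in>V \<times> V \<times> V. g (Link v j u))"
      for g :: "'a block \<Rightarrow> real"
      by (subst sum.reindex) (auto simp: inj_on_def intro!: sum.cong)
    show ?thesis by (simp only: 1 2 3) simp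
  qed
  also have "\<dots> \<le> 1 + 1 + 1"
  proof (intro add_mono)
    have "(\<Sum>v\<in>V. (cap E (Node v) z)\<^sup>2) \<le> (\<Sum>v\<in>V. z (Root, v))"
      using nn body_Root_le_1[OF z] by (intro sum_mono) (auto intro: sq)
    then show "(\<Sum>v\<in>V. (cap E (Node v) z)\<^sup>2) \<le> 1" using root by simp
    have "(cap E (Link v j u) z)\<^sup>2 \<le> z (Node v, j) * z (Root, u)" for v j u
      using nn[of "(Node v, j)"] nn[of "(Root, u)"]
      by (auto simp: power2_eq_square intro!: mult_mono)
    then have "(\<Sum>(v, j, u)\<in>V \<times> V \<times> V. (cap E (Link v j u) z)\<^sup>2)
        \<le> (\<Sum>(v, j, u)\<in>V \<times> V \<times> V. z (Node v, j) * z (Root, u))"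
      by (intro sum_mono) auto
    also have "\<dots> = (\<Sum>v\<in>V. \<Sum>j\<in>V. \<Sum>u\<in>V. z (Node v, j) * z (Root, u))"
      by (simp add: sum.cartesian_product)
    also have "\<dots> = (\<Sum>v\<in>V. \<Sum>j\<in>V. z (Node v, j)) * (\<Sum>u\<in>V. z (Root, u))"
      by (simp only: sum_distrib_right) (simp only: sum_distrib_left)
    also have "\<dots> \<le> (\<Sum>v\<in>V. z (Root, v)) * 1"
    proof (rule mult_mono[OF sum_mono root])
      fix v
      have "(\<Sum>j\<in>V. z (Node v, j)) \<le> cap E (Node v) z"
        by (rule body_sum_le[OF z V])
      also have "\<dots> \<le> z (Root, v)" using nn by simp
      finally show "(\<Sum>j\<in>V. z (Node v, j)) \<le> z (Root, v)" .
    qed (simp_all add: sum_nonneg nn)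
    also have "\<dots> \<le> 1" using root by simp
    finally show "(\<Sum>(v, j, u)\<in>V \<times> V \<times> V. (cap E (Link v j u) z)\<^sup>2) \<le> 1" .
  qed simp
  finally show ?thesis by simp
qed

lemma body_square_summable: "z \<in> body E \<Longrightarrow> (\<lambda>c. (z c)\<^sup>2) summable_on A"
  by (rule nonneg_bounded_partial_sums_imp_summable_on[where C = 3])
    (auto intro!: eventually_finite_subsets_at_top_weakI body_square_sum_le)

lemma countable_support: "z \<in> body E \<Longrightarrow> countable {c. z c \<noteq> 0}"
  using summable_countable_real[OF body_square_summable[of z E UNIV]] by simp

lemma countable_row:
  assumes "z \<in> body E"
  shows "countable {i. z (b, i) \<noteq> 0}"
proof (rule countable_subset)
  show "{i. z (b, i) \<noteq> 0} \<subseteq> snd ` {x. z x \<noteq> 0}" by force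
  show "countable (snd ` {x. z x \<noteq> 0})" using countable_support[OF assms] by simp
qed

text \<open>
  The relation of a point \<open>p\<close> to a generic member \<open>q\<close> of an uncountable family that converges to \<open>p\<close>.
\<close>

definition extends ::
  "('v \<Rightarrow> 'v \<Rightarrow> bool) \<Rightarrow> ('v block \<times> 'v \<Rightarrow> real) \<Rightarrow> ('v block \<times> 'v \<Rightarrow> real) \<Rightarrow> bool" where
  "extends E p q \<longleftrightarrow> p \<in> body E \<and> q \<in> body E \<and> (\<forall>c. p c \<noteq> 0 \<longrightarrow> q c = p c)"

lemma extendsD:
  assumes "extends E p q"
  shows "p \<in> body E" "q \<in> body E" "p c \<noteq> 0 \<Longrightarrow> q c = p c" "p c \<le> q c"
proof -
  show q: "p \<in> body E" "q \<in> body E" "p c \<noteq> 0 \<Longrightarrow> q c = p c"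
    using assms unfolding extends_def by blast+
  show "p c \<le> q c"
    using q(3) body_nonneg[OF q(2), of c] by (cases "p c = 0") auto
qed

lemma extends_mass_new:
  assumes e: "extends E p q" and F: "finite F" "\<And>i. i \<in> F \<Longrightarrow> p (b, i) = 0"
  shows "mass b p + (\<Sum>i\<in>F. q (b, i)) \<le> mass b q"
proof -
  have s: "((\<lambda>i. if i \<in> F then q (b, i) else 0) has_sum (\<Sum>i\<in>F. q (b, i))) UNIV"
    using has_sum_finite_neutralI[of F UNIV "\<lambda>i. if i \<in> F then q (b, i) else 0"] F by auto
  have h: "((\<lambda>i. p (b, i)) has_sum mass b p) UNIV"
    unfolding mass_def by (rule has_sum_infsum) (rule body_summable[OF extendsD(1)[OF e]])
  have hq: "((\<lambda>i. q (b, i)) has_sum mass b q) UNIV"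
    unfolding mass_def by (rule has_sum_infsum) (rule body_summable[OF extendsD(2)[OF e]])
  show ?thesis
    by (rule has_sum_mono[OF has_sum_add[OF h s] hq]) (use F(2) in \<open>auto simp: extendsD(4)[OF e]\<close>)
qed

lemma cap_extends: "extends E p q \<Longrightarrow> 0 < cap E b p \<Longrightarrow> cap E b q = cap E b p"
  by (cases b) (auto simp: extends_def split: if_splits)

text \<open>
  A new entry in a block with positive capacity needs slack in that block, because the entries that
  bound the block have not changed.
\<close>

lemma new_coord:
  assumes e: "extends E p q" and new: "p (b, i) = 0" "0 < q (b, i)"
  shows "b \<in> slacks E p \<or> cap E b p = 0"
proof (rule disjCI)
  assume "cap E b p \<noteq> 0"
  then have "0 < cap E b p"
    using mass_le_cap[OF extendsD(1)[OF e], of b] mass_nonneg[OF extendsD(1)[OF e], of b] by linarith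
  then have "cap E b q = cap E b p" by (rule cap_extends[OF e])
  moreover have "mass b p + q (b, i) \<le> mass b q"
    using extends_mass_new[OF e, of "{i}" b] new by simp
  ultimately show "b \<in> slacks E p"
    using new mass_le_cap[OF extendsD(2)[OF e], of b] by (simp add: slacks_def slack_def)
qed

lemma new_Root:
  assumes e: "extends E p q" and new: "p (Root, i) = 0" "0 < q (Root, i)"
  shows "Root \<in> slacks E p"
  using new_coord[OF assms] by simp

lemma new_Node:
  assumes e: "extends E p q" and new: "p (Node v, i) = 0" "0 < q (Node v, i)"
  shows "Node v \<in> slacks E p \<or> Root \<in> slacks E p \<and> p (Root, v) = 0 \<and> 0 < q (Root, v)"
proof -
  have "0 < cap E (Node v) q"
    using new(2) coord_le_cap[OF extendsD(2)[OF e], of "Node v" i] by linarith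
  then have q: "0 < q (Root, v)" "\<exists>u. E v u" by (auto split: if_splits)
  from new_coord[OF assms] q show ?thesis using new_Root[OF e, of v] by auto
qed

text \<open>
  If the block of a new entry had capacity \<open>0\<close> at \<open>p\<close>, then one of the entries bounding it is new as
  well; following the bounds towards \<open>Root\<close> ends at a block that is slack at \<open>p\<close>.
\<close>

lemma new_slack:
  assumes e: "extends E p q" and ne: "p \<noteq> q"
  obtains b i where "b \<in> slacks E p" "p (b, i) = 0" "0 < q (b, i)"
proof -
  note q = extendsD(2)[OF e] and found = that
  obtain c where "p c \<noteq> q c" using ne by blast
  then have c: "p c = 0" "0 < q c"
    using extendsD(3)[OF e, of c] body_nonneg[OF q, of c] by (metis less_eq_real_def)+
  obtain b i where bi: "c = (b, i)" by force
  have node: thesis if "p (Node v, j) = 0" "0 < q (Node v, j)" for v j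
    using new_Node[OF e that] new_Root[OF e, of v] found that by blast
  show thesis
  proof (cases b)
    case Root
    then show ?thesis using found[of b i] new_Root[OF e, of i] c bi by blast
  next
    case (Node v)
    then show ?thesis using node c bi by blast
  next
    case (Link v j u)
    show ?thesis
    proof (cases "b \<in> slacks E p")
      case False
      then have "cap E b p = 0" using new_coord[OF e, of b i] c bi by auto
      moreover have "0 < cap E b q"
        using c(2) bi coord_le_cap[OF q, of b i] by simp
      ultimately have "p (Node v, j) = 0 \<and> 0 < q (Node v, j) \<or> p (Root, u) = 0 \<and> 0 < q (Root, u)"
        using Link body_nonneg[OF extendsD(1)[OF e], of "(Node v, j)"]
          body_nonneg[OF extendsD(1)[OF e], of "(Root, u)"] by (auto split: if_splits simp: min_def)
      then show ?thesis using node new_Root[OF e, of u] found by blast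
    qed (use c bi found in blast)
  qed
qed

lemma slack_old:
  assumes e: "extends E p q" and "b \<in> slacks E q" "cap E b q \<le> cap E b p"
  shows "b \<in> slacks E p"
proof -
  have "mass b p \<le> mass b q" using extends_mass_new[OF e, of "{}" b] by simp
  then show ?thesis using assms(2,3) by (simp add: slacks_def slack_def)
qed

section \<open>Topological invariants from uncountable convergent families\<close>

text \<open>
  Convergence of the family along the filter of cofinite subsets of the uncountable index set: together
  with its limit it is a continuous image of the one-point compactification of a discrete space.
\<close>

definition tends :: "'a topology \<Rightarrow> 'i set \<Rightarrow> ('i \<Rightarrow> 'a) \<Rightarrow> 'a \<Rightarrow> bool" where
  "tends X I u p \<longleftrightarrow> uncountable I \<and> p \<in> topspace X \<and> u ` I \<subseteq> topspace X \<and>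
    (\<forall>W. openin X W \<and> p \<in> W \<longrightarrow> finite {i \<in> I. u i \<notin> W})"

text \<open>
  The set \<open>N\<close> provides the indices, since a formula cannot quantify over index types.
\<close>

definition accumulation :: "'i set \<Rightarrow> 'a topology \<Rightarrow> 'a \<Rightarrow> bool" where
  "accumulation N X p \<longleftrightarrow> (\<exists>I u. I \<subseteq> N \<and> tends X I u p \<and> (\<forall>i\<in>I. u i \<noteq> p))"

definition separated :: "'a topology \<Rightarrow> 'i set \<Rightarrow> ('i \<Rightarrow> 'a) \<Rightarrow> bool" where
  "separated X I u \<longleftrightarrow> (\<exists>U. (\<forall>i\<in>I. openin X (U i) \<and> u i \<in> U i) \<and> disjoint_family_on U I)"

text \<open>
  A grid \<open>z\<close> with two iterated limits: the rows converge to the points \<open>u i\<close>, the columns to the points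
  \<open>v j\<close>, and both edges converge to \<open>p\<close>. Separation forces \<open>u\<close> and \<open>v\<close> to be spread out.
\<close>

definition branching :: "'i set \<Rightarrow> 'a topology \<Rightarrow> 'a \<Rightarrow> bool" where
  "branching N X p \<longleftrightarrow> (\<exists>I u v z. I \<subseteq> N \<and> tends X I u p \<and> tends X I v p \<and>
    (\<forall>i\<in>I. tends X I (z i) (u i)) \<and> (\<forall>j\<in>I. tends X I (\<lambda>i. z i j) (v j)) \<and>
    separated X I u \<and> separated X I v)"

definition simple_points :: "'i set \<Rightarrow> 'a topology \<Rightarrow> 'a set" where
  "simple_points N X = {p. accumulation N X p \<and> \<not> branching N X p}"

text \<open>
  The path \<open>g\<close> can be pushed off itself at all times simultaneously, in uncountably many ways that
  converge to \<open>g\<close>. Continuity of the pushed paths prevents \<open>g\<close> from jumping between different slack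
  blocks, although slack itself is only semicontinuous.
\<close>

definition joined :: "'i set \<Rightarrow> 'a topology \<Rightarrow> 'a \<Rightarrow> 'a \<Rightarrow> bool" where
  "joined N X p q \<longleftrightarrow> (\<exists>g I G. I \<subseteq> N \<and> pathin X g \<and> g 0 = p \<and> g 1 = q \<and>
    g ` {0..1} \<subseteq> simple_points N X \<and> (\<forall>i\<in>I. pathin X (G i)) \<and>
    (\<forall>t\<in>{0..1}. tends X I (\<lambda>i. G i t) (g t) \<and> (\<forall>i\<in>I. G i t \<noteq> g t)))"

definition joined_class :: "'i set \<Rightarrow> 'a topology \<Rightarrow> 'a \<Rightarrow> 'a set" where
  "joined_class N X p = {q \<in> simple_points N X. joined N X p q}"

definition limits :: "'i set \<Rightarrow> 'a topology \<Rightarrow> 'a set \<Rightarrow> 'a set" where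
  "limits N X Y = {z. \<exists>I u. I \<subseteq> N \<and> tends X I u z \<and> u ` I \<subseteq> Y}"

definition terminal :: "'i set \<Rightarrow> 'a topology \<Rightarrow> 'a \<Rightarrow> bool" where
  "terminal N X p \<longleftrightarrow> p \<in> simple_points N X \<and>
    joined_class N X p \<inter> limits N X (simple_points N X - joined_class N X p) = {}"

definition nodal :: "'i set \<Rightarrow> 'a topology \<Rightarrow> 'a \<Rightarrow> bool" where
  "nodal N X p \<longleftrightarrow> p \<in> simple_points N X \<and> \<not> terminal N X p \<and>
    \<not> joined_class N X p \<subseteq> limits N X (simple_points N X - joined_class N X p)"

definition compatible :: "'i set \<Rightarrow> 'a topology \<Rightarrow> 'a \<Rightarrow> 'a \<Rightarrow> bool" where
  "compatible N X p q \<longleftrightarrow> limits N X (joined_class N X p) \<inter> limits N X (joined_class N X q) -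
    limits N X (simple_points N X - joined_class N X p - joined_class N X q) \<noteq> {}"

lemma tends_topspace: "tends X I u p \<Longrightarrow> p \<in> topspace X" "tends X I u p \<Longrightarrow> i \<in> I \<Longrightarrow> u i \<in> topspace X"
  by (auto simp: tends_def)

lemma tends_image:
  assumes f: "continuous_map X Y f" and t: "tends X I u p"
  shows "tends Y I (\<lambda>i. f (u i)) (f p)"
  unfolding tends_def
proof (intro conjI allI impI)
  show "uncountable I" "f p \<in> topspace Y" "(\<lambda>i. f (u i)) ` I \<subseteq> topspace Y"
    using t f unfolding tends_def continuous_map_def by auto
  fix W assume W: "openin Y W \<and> f p \<in> W"
  let ?V = "{x \<in> topspace X. f x \<in> W}"
  have "openin X ?V" "p \<in> ?V"
    using W f t by (auto simp: continuous_map_def tends_def)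
  then have "finite {i \<in> I. u i \<notin> ?V}" using t unfolding tends_def by blast
  then show "finite {i \<in> I. f (u i) \<notin> W}"
    by (rule rev_finite_subset) auto
qed

lemma simple_topspace: "simple_points N X \<subseteq> topspace X"
  by (auto simp: simple_points_def accumulation_def dest: tends_topspace)

context
  fixes X :: "'a topology" and Y :: "'b topology" and f g
  assumes hom: "homeomorphic_maps X Y f g"
begin

lemma homeomorphic_facts:
  "continuous_map X Y f" "continuous_map Y X g"
  "x \<in> topspace X \<Longrightarrow> g (f x) = x" "y \<in> topspace Y \<Longrightarrow> f (g y) = y"
  "x \<in> topspace X \<Longrightarrow> f x \<in> topspace Y" "y \<in> topspace Y \<Longrightarrow> g y \<in> topspace X"
  using hom by (auto simp: homeomorphic_maps_def continuous_map_def)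

lemma accumulation_image:
  assumes "accumulation N X p" shows "accumulation N Y (f p)"
proof -
  obtain I u where *: "I \<subseteq> N" "tends X I u p" "\<forall>i\<in>I. u i \<noteq> p"
    using assms unfolding accumulation_def by blast
  have "\<forall>i\<in>I. f (u i) \<noteq> f p"
    using * tends_topspace[OF *(2)] homeomorphic_facts(3) by metis
  then show ?thesis
    unfolding accumulation_def using * tends_image[OF homeomorphic_facts(1) *(2)] by blast
qed

lemma separated_image:
  assumes "separated X I u" "u ` I \<subseteq> topspace X" shows "separated Y I (\<lambda>i. f (u i))"
proof -
  obtain U where U: "\<And>i. i \<in> I \<Longrightarrow> openin X (U i)" "\<And>i. i \<in> I \<Longrightarrow> u i \<in> U i" "disjoint_family_on U I"
    using assms unfolding separated_def by blast
  let ?V = "\<lambda>i. {y \<in> topspace Y. g y \<in> U i}"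
  have "openin Y (?V i)" if "i \<in> I" for i
    using homeomorphic_facts(2) U(1)[OF that] by (auto simp: continuous_map_def)
  moreover have "f (u i) \<in> ?V i" if "i \<in> I" for i
    using U(2)[OF that] homeomorphic_facts assms(2) that by auto
  moreover have "disjoint_family_on ?V I"
    using U(3) by (auto simp: disjoint_family_on_def)
  ultimately show ?thesis unfolding separated_def by (intro exI[of _ ?V]) auto
qed

lemma branching_image:
  assumes "branching N X p" shows "branching N Y (f p)"
proof -
  obtain I u v z where *: "I \<subseteq> N" "tends X I u p" "tends X I v p"
    "\<And>i. i\<in>I \<Longrightarrow> tends X I (z i) (u i)" "\<And>j. j\<in>I \<Longrightarrow> tends X I (\<lambda>i. z i j) (v j)"
    "separated X I u" "separated X I v"
    using assms unfolding branching_def by blast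
  note t = tends_image[OF homeomorphic_facts(1)]
  have s: "separated Y I (\<lambda>i. f (u i))" "separated Y I (\<lambda>i. f (v i))"
    using * by (auto intro!: separated_image dest: tends_topspace)
  show ?thesis
    unfolding branching_def
    by (rule exI[of _ I], rule exI[of _ "\<lambda>i. f (u i)"], rule exI[of _ "\<lambda>i. f (v i)"],
        rule exI[of _ "\<lambda>i j. f (z i j)"])
      (use *(1) t[OF *(2)] t[OF *(3)] t[OF *(4)] t[OF *(5)] s in auto)
qed

end

lemma homeomorphic_maps_swap: "homeomorphic_maps X Y f g \<Longrightarrow> homeomorphic_maps Y X g f"
  using homeomorphic_maps_sym by blast

lemma simple_image_iff:
  assumes hom: "homeomorphic_maps X Y f g" and p: "p \<in> topspace X"
  shows "f p \<in> simple_points N Y \<longleftrightarrow> p \<in> simple_points N X"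
proof -
  note s = homeomorphic_maps_swap[OF hom] and gf = homeomorphic_facts(3)[OF hom p]
  show ?thesis
    unfolding simple_points_def mem_Collect_eq
    using accumulation_image[OF hom, of N p] accumulation_image[OF s, of N "f p"]
      branching_image[OF hom, of N p] branching_image[OF s, of N "f p"] unfolding gf by blast
qed

lemma joined_image:
  assumes hom: "homeomorphic_maps X Y f g" and j: "joined N X p q"
  shows "joined N Y (f p) (f q)"
proof -
  obtain c I G where raw: "I \<subseteq> N \<and> pathin X c \<and> c 0 = p \<and> c 1 = q \<and>
    c ` {0..1} \<subseteq> simple_points N X \<and> (\<forall>i\<in>I. pathin X (G i)) \<and>
    (\<forall>t\<in>{0..1}. tends X I (\<lambda>i. G i t) (c t) \<and> (\<forall>i\<in>I. G i t \<noteq> c t))"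
    using j unfolding joined_def by (elim exE)
  then have *: "I \<subseteq> N" "pathin X c" "c 0 = p" "c 1 = q"
    "c ` {0..1} \<subseteq> simple_points N X" "\<And>i. i\<in>I \<Longrightarrow> pathin X (G i)"
    "\<And>t. t\<in>{0..1} \<Longrightarrow> tends X I (\<lambda>i. G i t) (c t)" "\<And>t i. t\<in>{0..1} \<Longrightarrow> i\<in>I \<Longrightarrow> G i t \<noteq> c t"
    by simp_all
  note f = homeomorphic_facts(1)[OF hom]
  have p1: "pathin Y (\<lambda>t. f (h t))" if "pathin X h" for h
    using continuous_map_compose[of _ X h Y f] that f by (simp add: pathin_def comp_def)
  have ne: "f (G i t) \<noteq> f (c t)" if "t \<in> {0..1}" "i \<in> I" for t i
    using *(8)[OF that] homeomorphic_facts(3)[OF hom, OF tends_topspace(1)[OF *(7)[OF that(1)]]]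
      homeomorphic_facts(3)[OF hom, OF tends_topspace(2)[OF *(7)[OF that(1)] that(2)]] by metis
  have im: "(\<lambda>t. f (c t)) ` {0..1} \<subseteq> simple_points N Y"
  proof clarify
    fix t :: real assume "t \<in> {0..1}"
    then have c: "c t \<in> simple_points N X" using *(5) by blast
    then have "c t \<in> topspace X" using simple_topspace by (rule subsetD[rotated])
    then show "f (c t) \<in> simple_points N Y"
      using c simple_image_iff[OF hom] by metis
  qed
  show ?thesis
    unfolding joined_def
    apply (rule exI[of _ "\<lambda>t. f (c t)"], rule exI[of _ I], rule exI[of _ "\<lambda>i t. f (G i t)"])
    using *(1,3,4) im p1[OF *(2)] p1[OF *(6)] ne tends_image[OF f *(7)] by simp
qed

lemma joined_image_iff:
  assumes hom: "homeomorphic_maps X Y f g" and p: "p \<in> topspace X" "q \<in> topspace X"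
  shows "joined N Y (f p) (f q) \<longleftrightarrow> joined N X p q"
  using joined_image[OF hom] joined_image[OF homeomorphic_maps_swap[OF hom], of N "f p" "f q"]
  by (auto simp: homeomorphic_facts(3)[OF hom] p)

lemma image_simple:
  assumes hom: "homeomorphic_maps X Y f g"
  shows "f ` simple_points N X = simple_points N Y"
proof
  show "f ` simple_points N X \<subseteq> simple_points N Y"
  proof clarify
    fix x assume x: "x \<in> simple_points N X"
    then have "x \<in> topspace X" using simple_topspace by (rule subsetD[rotated])
    then show "f x \<in> simple_points N Y" using x simple_image_iff[OF hom] by metis
  qed
  show "simple_points N Y \<subseteq> f ` simple_points N X"
  proof
    fix y assume y: "y \<in> simple_points N Y"
    then have "y \<in> topspace Y" using simple_topspace by (rule subsetD[rotated])
    then have "f (g y) = y" "g y \<in> topspace X" using homeomorphic_facts[OF hom] by auto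
    then show "y \<in> f ` simple_points N X" using simple_image_iff[OF hom, of "g y" N] y by (metis image_eqI)
  qed
qed

lemma image_joined_class:
  assumes hom: "homeomorphic_maps X Y f g" and p: "p \<in> topspace X"
  shows "f ` joined_class N X p = joined_class N Y (f p)"
proof -
  have "joined_class N Y (f p) = {q \<in> f ` simple_points N X. joined N Y (f p) q}"
    by (simp add: joined_class_def image_simple[OF hom])
  also have "\<dots> = f ` {q \<in> simple_points N X. joined N Y (f p) (f q)}"
    by blast
  also have "{q \<in> simple_points N X. joined N Y (f p) (f q)} = joined_class N X p"
    unfolding joined_class_def
    by (intro Collect_cong conj_cong refl joined_image_iff[OF hom p] subsetD[OF simple_topspace])
  finally show ?thesis by simp
qed

lemma image_limits:
  assumes hom: "homeomorphic_maps X Y f g"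
  shows "f ` limits N X A = limits N Y (f ` (A \<inter> topspace X))"
proof
  show "f ` limits N X A \<subseteq> limits N Y (f ` (A \<inter> topspace X))"
  proof clarify
    fix z assume "z \<in> limits N X A"
    then obtain I u where *: "I \<subseteq> N" "tends X I u z" "u ` I \<subseteq> A" unfolding limits_def by blast
    have "(\<lambda>i. f (u i)) ` I \<subseteq> f ` (A \<inter> topspace X)"
      using *(3) tends_topspace(2)[OF *(2)] by blast
    then show "f z \<in> limits N Y (f ` (A \<inter> topspace X))"
      unfolding limits_def mem_Collect_eq
      by (intro exI[of _ I] exI[of _ "\<lambda>i. f (u i)"] conjI *(1) tends_image[OF homeomorphic_facts(1)[OF hom] *(2)])
  qed
  show "limits N Y (f ` (A \<inter> topspace X)) \<subseteq> f ` limits N X A"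
  proof
    fix z assume "z \<in> limits N Y (f ` (A \<inter> topspace X))"
    then obtain I u where *: "I \<subseteq> N" "tends Y I u z" "u ` I \<subseteq> f ` (A \<inter> topspace X)"
      unfolding limits_def by blast
    have "(\<lambda>i. g (u i)) ` I \<subseteq> A"
    proof clarify
      fix i assume "i \<in> I"
      then obtain a where "a \<in> A" "a \<in> topspace X" "u i = f a" using *(3) by blast
      then show "g (u i) \<in> A" by (simp add: homeomorphic_facts(3)[OF hom])
    qed
    then have "g z \<in> limits N X A"
      unfolding limits_def mem_Collect_eq
      by (intro exI[of _ I] exI[of _ "\<lambda>i. g (u i)"] conjI *(1) tends_image[OF homeomorphic_facts(2)[OF hom] *(2)])
    moreover have "f (g z) = z" by (rule homeomorphic_facts(4)[OF hom tends_topspace(1)[OF *(2)]])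
    ultimately show "z \<in> f ` limits N X A" by (metis image_eqI)
  qed
qed

lemma limits_topspace: "limits N X A \<subseteq> topspace X"
  by (auto simp: limits_def dest: tends_topspace)

context
  fixes X :: "'a topology" and Y :: "'b topology" and f g and N :: "'i set"
  assumes hom: "homeomorphic_maps X Y f g"
begin

private lemma inj: "inj_on f (topspace X)"
  using homeomorphic_facts(3)[OF hom] by (rule inj_on_inverseI)

private lemma image_limits': "A \<subseteq> topspace X \<Longrightarrow> f ` limits N X A = limits N Y (f ` A)"
  using image_limits[OF hom, of N A] by (simp add: Int_absorb2)

private lemma class_topspace: "joined_class N X p \<subseteq> topspace X"
  unfolding joined_class_def using simple_topspace[of N X] by blast

private lemma image_rest:
  assumes "p \<in> topspace X"
  shows "f ` limits N X (simple_points N X - joined_class N X p) =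
    limits N Y (simple_points N Y - joined_class N Y (f p))"
proof -
  have 1: "f ` (simple_points N X - joined_class N X p) =
      f ` simple_points N X - f ` joined_class N X p"
    by (rule inj_on_image_set_diff[OF inj _ class_topspace]) (use simple_topspace[of N X] in blast)
  have 2: "simple_points N X - joined_class N X p \<subseteq> topspace X"
    using simple_topspace[of N X] by blast
  show ?thesis
    by (simp only: image_limits'[OF 2] 1 image_simple[OF hom] image_joined_class[OF hom assms])
qed

lemma terminal_image_iff:
  assumes p: "p \<in> topspace X"
  shows "terminal N Y (f p) \<longleftrightarrow> terminal N X p"
proof -
  let ?J = "joined_class N X p" and ?R = "limits N X (simple_points N X - joined_class N X p)"
  have "joined_class N Y (f p) \<inter> limits N Y (simple_points N Y - joined_class N Y (f p)) = f ` ?J \<inter> f ` ?R"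
    by (simp only: image_rest[OF p] image_joined_class[OF hom p])
  also have "\<dots> = f ` (?J \<inter> ?R)"
    by (rule inj_on_image_Int[OF inj class_topspace limits_topspace, symmetric])
  finally show ?thesis
    by (simp add: terminal_def simple_image_iff[OF hom p])
qed

lemma nodal_image_iff:
  assumes p: "p \<in> topspace X"
  shows "nodal N Y (f p) \<longleftrightarrow> nodal N X p"
proof -
  let ?J = "joined_class N X p" and ?R = "limits N X (simple_points N X - joined_class N X p)"
  have "joined_class N Y (f p) \<subseteq> limits N Y (simple_points N Y - joined_class N Y (f p)) \<longleftrightarrow> f ` ?J \<subseteq> f ` ?R"
    by (simp only: image_rest[OF p] image_joined_class[OF hom p])
  also have "\<dots> \<longleftrightarrow> ?J \<subseteq> ?R"
    by (rule inj_on_image_subset_iff[OF inj class_topspace limits_topspace])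
  finally show ?thesis
    by (simp add: nodal_def simple_image_iff[OF hom p] terminal_image_iff[OF p])
qed

lemma compatible_image_iff:
  assumes p: "p \<in> topspace X" and q: "q \<in> topspace X"
  shows "compatible N Y (f p) (f q) \<longleftrightarrow> compatible N X p q"
proof -
  have "f ` (limits N X (joined_class N X p) \<inter> limits N X (joined_class N X q) -
      limits N X (simple_points N X - joined_class N X p - joined_class N X q)) =
    limits N Y (joined_class N Y (f p)) \<inter> limits N Y (joined_class N Y (f q)) -
      limits N Y (simple_points N Y - joined_class N Y (f p) - joined_class N Y (f q))"
    (is "f ` (?A \<inter> ?B - ?C) = _")
  proof -
    have "f ` (?A \<inter> ?B - ?C) = f ` ?A \<inter> f ` ?B - f ` ?C"
    proof -
      have "f ` (?A \<inter> ?B - ?C) = f ` (?A \<inter> ?B) - f ` ?C"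
        by (rule inj_on_image_set_diff[OF inj _ limits_topspace]) (use limits_topspace[of N X] in blast)
      moreover have "f ` (?A \<inter> ?B) = f ` ?A \<inter> f ` ?B"
        by (rule inj_on_image_Int[OF inj limits_topspace limits_topspace])
      ultimately show ?thesis by (simp only:)
    qed
    moreover have "f ` ?A = limits N Y (joined_class N Y (f p))"
      by (simp only: image_limits'[OF class_topspace] image_joined_class[OF hom p])
    moreover have "f ` ?B = limits N Y (joined_class N Y (f q))"
      by (simp only: image_limits'[OF class_topspace] image_joined_class[OF hom q])
    moreover have "f ` ?C = limits N Y (simple_points N Y - joined_class N Y (f p) - joined_class N Y (f q))"
    proof -
      have 1: "f ` (simple_points N X - joined_class N X p) =
          f ` simple_points N X - f ` joined_class N X p"
        by (rule inj_on_image_set_diff[OF inj _ class_topspace]) (use simple_topspace[of N X] in blast)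
      have 2: "f ` (simple_points N X - joined_class N X p - joined_class N X q) =
          f ` (simple_points N X - joined_class N X p) - f ` joined_class N X q"
        by (rule inj_on_image_set_diff[OF inj _ class_topspace]) (use simple_topspace[of N X] in blast)
      have 3: "simple_points N X - joined_class N X p - joined_class N X q \<subseteq> topspace X"
        using simple_topspace[of N X] by blast
      show ?thesis
        by (simp only: image_limits'[OF 3] 2 1 image_simple[OF hom] image_joined_class[OF hom p]
            image_joined_class[OF hom q])
    qed
    ultimately show ?thesis by (simp only:)
  qed
  then show ?thesis unfolding compatible_def by (metis image_is_empty)
qed

end

section \<open>Slack blocks and the topology of a body\<close>

abbreviation body_topology :: "('v \<Rightarrow> 'v \<Rightarrow> bool) \<Rightarrow> ('v block \<times> 'v \<Rightarrow> real) topology" where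
  "body_topology E \<equiv> top_of_set (body E)"

lemma openin_body_nbhd:
  assumes W: "openin (body_topology E) W" and p: "p \<in> W"
  obtains G e where "finite G" "0 < e" "\<And>q. q \<in> body E \<Longrightarrow> (\<And>c. c \<in> G \<Longrightarrow> \<bar>q c - p c\<bar> < e) \<Longrightarrow> q \<in> W"
proof -
  obtain T where T: "open T" "W = body E \<inter> T"
    using W by (metis openin_open)
  have *: "openin (product_topology (\<lambda>_. euclidean) UNIV) T"
    using T(1) by (simp add: open_fun_def)
  have pT: "p \<in> T" using T p by blast
  then obtain X where X: "p \<in> Pi\<^sub>E UNIV X" "\<And>i. open (X i)" "finite {i. X i \<noteq> UNIV}" "Pi\<^sub>E UNIV X \<subseteq> T"
    using product_topology_open_contains_basis[OF * pT] by (auto simp flip: open_openin)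
  let ?G = "{i. X i \<noteq> UNIV}"
  have "\<exists>e>0. \<forall>y. \<bar>y - p i\<bar> < e \<longrightarrow> y \<in> X i" for i
  proof -
    have "p i \<in> X i" using X(1) by (rule PiE_mem) simp
    then show ?thesis using X(2)[of i] unfolding open_dist dist_real_def by blast
  qed
  then obtain d where d: "\<And>i. 0 < d i" "\<And>i y. \<bar>y - p i\<bar> < d i \<Longrightarrow> y \<in> X i" by metis
  define e where "e = Min (insert 1 (d ` ?G))"
  have e: "0 < e" "\<And>i. i \<in> ?G \<Longrightarrow> e \<le> d i"
    using X(3) d(1) by (auto simp: e_def)
  show thesis
  proof (rule that[OF X(3) e(1)])
    fix q assume q: "q \<in> body E" "\<And>c. c \<in> ?G \<Longrightarrow> \<bar>q c - p c\<bar> < e"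
    have "q c \<in> X c" for c
    proof (cases "c \<in> ?G")
      case True
      then show ?thesis using q(2) e(2) d(2) by (meson less_le_trans)
    qed auto
    then have "q \<in> T" using X(4) by (auto simp: PiE_iff)
    then show "q \<in> W" using q(1) T(2) by blast
  qed
qed

lemma openin_body_Collect_less:
  assumes "continuous_on (body E) f"
  shows "openin (body_topology E) {q \<in> body E. a < (f q :: real)}"
proof -
  have "openin (body_topology E) (body E \<inter> f -` {a<..})"
    using assms by (rule continuous_openin_preimage_gen) simp
  moreover have "body E \<inter> f -` {a<..} = {q \<in> body E. a < f q}" by auto
  ultimately show ?thesis by simp
qed

lemma continuous_on_coord: "continuous_on S (\<lambda>q. q c :: real)"
  by (rule continuous_on_product_then_coordinatewise) (rule continuous_on_id)

lemma tends_iff: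
  "tends (body_topology E) I u p \<longleftrightarrow> uncountable I \<and> p \<in> body E \<and> u ` I \<subseteq> body E \<and>
    (\<forall>c e. 0 < e \<longrightarrow> finite {i \<in> I. e \<le> \<bar>u i c - p c\<bar>})"
proof (intro iffI conjI allI impI)
  assume t: "tends (body_topology E) I u p"
  show "uncountable I" "p \<in> body E" "u ` I \<subseteq> body E" using t by (auto simp: tends_def)
  fix c and e :: real assume e: "0 < e"
  have "continuous_on (body E) (\<lambda>q. e - \<bar>q c - p c\<bar>)"
    by (intro continuous_intros continuous_on_coord)
  from openin_body_Collect_less[OF this, of 0]
  have "finite {i \<in> I. u i \<notin> {q \<in> body E. 0 < e - \<bar>q c - p c\<bar>}}"
    using t e unfolding tends_def by auto
  then show "finite {i \<in> I. e \<le> \<bar>u i c - p c\<bar>}"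
    by (rule rev_finite_subset) auto
next
  assume *: "uncountable I \<and> p \<in> body E \<and> u ` I \<subseteq> body E \<and>
    (\<forall>c e. 0 < e \<longrightarrow> finite {i \<in> I. e \<le> \<bar>u i c - p c\<bar>})"
  show "tends (body_topology E) I u p"
    unfolding tends_def
  proof (intro conjI allI impI)
    show "uncountable I" "p \<in> topspace (body_topology E)" "u ` I \<subseteq> topspace (body_topology E)"
      using * by auto
    fix W assume "openin (body_topology E) W \<and> p \<in> W"
    then obtain G e where G: "finite G" "0 < (e::real)"
      "\<And>q. q \<in> body E \<Longrightarrow> (\<And>c. c \<in> G \<Longrightarrow> \<bar>q c - p c\<bar> < e) \<Longrightarrow> q \<in> W"
      using openin_body_nbhd by metis
    have "{i \<in> I. u i \<notin> W} \<subseteq> (\<Union>c\<in>G. {i \<in> I. e \<le> \<bar>u i c - p c\<bar>})"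
    proof
      fix i assume i: "i \<in> {i \<in> I. u i \<notin> W}"
      then have "u i \<in> body E" using * by blast
      then have "\<not> (\<forall>c\<in>G. \<bar>u i c - p c\<bar> < e)" using G(3)[of "u i"] i by blast
      then show "i \<in> (\<Union>c\<in>G. {i \<in> I. e \<le> \<bar>u i c - p c\<bar>})" using i by (auto simp: not_less)
    qed
    moreover have "finite (\<Union>c\<in>G. {i \<in> I. e \<le> \<bar>u i c - p c\<bar>})"
      using G * by auto
    ultimately show "finite {i \<in> I. u i \<notin> W}" by (rule finite_subset)
  qed
qed

text \<open>
  The exceptions for each distance \<open>1 / n\<close> are finite in number, so all but countably many members agree
  exactly with the limit in any given coordinate. This is the reason for using uncountable families.
\<close>

lemma tends_coord:
  assumes "tends (body_topology E) I u p"
  shows "countable {i \<in> I. u i c \<noteq> p c}"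
proof -
  have "{i \<in> I. u i c \<noteq> p c} \<subseteq> (\<Union>n. {i \<in> I. inverse (real (Suc n)) \<le> \<bar>u i c - p c\<bar>})"
  proof
    fix i assume i: "i \<in> {i \<in> I. u i c \<noteq> p c}"
    then have "0 < \<bar>u i c - p c\<bar>" by simp
    then obtain n where "inverse (real (Suc n)) < \<bar>u i c - p c\<bar>" using reals_Archimedean by blast
    then show "i \<in> (\<Union>n. {i \<in> I. inverse (real (Suc n)) \<le> \<bar>u i c - p c\<bar>})"
      using i by (auto intro!: exI[of _ n])
  qed
  moreover have "finite {i \<in> I. inverse (real (Suc n)) \<le> \<bar>u i c - p c\<bar>}" for n
    using assms unfolding tends_iff by (metis inverse_positive_iff_positive of_nat_0_less_iff zero_less_Suc)
  ultimately show ?thesis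
    by (meson countable_UN countable_finite countable_subset countableI_type)
qed

lemma tends_coords:
  assumes t: "tends (body_topology E) I u p" and A: "countable A"
  shows "countable {i \<in> I. \<exists>c\<in>A. u i c \<noteq> p c}"
proof -
  have "{i \<in> I. \<exists>c\<in>A. u i c \<noteq> p c} = (\<Union>c\<in>A. {i \<in> I. u i c \<noteq> p c})" by blast
  then show ?thesis using A tends_coord[OF t] by simp
qed

lemma tends_body: "tends (body_topology E) I u p \<Longrightarrow> p \<in> body E"
  "tends (body_topology E) I u p \<Longrightarrow> i \<in> I \<Longrightarrow> u i \<in> body E"
  by (auto simp: tends_iff)

lemma tends_extends:
  assumes t: "tends (body_topology E) I u p"
  shows "countable {i \<in> I. \<not> extends E p (u i)}"
  using tends_coords[OF t countable_support[OF tends_body(1)[OF t]]]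
  by (rule countable_subset[rotated]) (use t in \<open>auto simp: extends_def tends_iff\<close>)

lemma tends_pick:
  assumes t: "tends (body_topology E) I u p" and A: "countable A" and B: "countable B"
  obtains i where "i \<in> I" "i \<notin> B" "extends E p (u i)" "\<And>c. c \<in> A \<Longrightarrow> u i c = p c"
proof -
  have "countable (B \<union> {i \<in> I. \<not> extends E p (u i)} \<union> {i \<in> I. \<exists>c\<in>A. u i c \<noteq> p c})"
    using B tends_extends[OF t] tends_coords[OF t A] by simp
  moreover have "uncountable I" using t by (simp add: tends_def)
  ultimately obtain i where "i \<in> I" "i \<notin> B \<union> {i \<in> I. \<not> extends E p (u i)} \<union> {i \<in> I. \<exists>c\<in>A. u i c \<noteq> p c}"
    by (meson countable_subset subsetI)
  then show thesis using that[of i] by auto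
qed

text \<open>
  In a family whose \<open>k\<close>-th member changes only entries with index \<open>k\<close>, every entry changes at most once.
\<close>

lemma tends_index:
  assumes "uncountable I" "z \<in> body E" "\<And>k. k \<in> I \<Longrightarrow> q k \<in> body E"
    and "\<And>k b i. k \<in> I \<Longrightarrow> i \<noteq> k \<Longrightarrow> q k (b, i) = z (b, i)"
  shows "tends (body_topology E) I q z"
  unfolding tends_iff
proof (intro conjI allI impI)
  fix c :: "'a block \<times> 'a" and e :: real assume e: "0 < e"
  have "{i \<in> I. e \<le> \<bar>q i c - z c\<bar>} \<subseteq> {snd c}"
  proof
    fix i assume i: "i \<in> {i \<in> I. e \<le> \<bar>q i c - z c\<bar>}"
    then have "q i c \<noteq> z c" using e by auto
    then show "i \<in> {snd c}" using assms(4)[of i "snd c" "fst c"] i by auto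
  qed
  then show "finite {i \<in> I. e \<le> \<bar>q i c - z c\<bar>}" by (rule finite_subset) simp
qed (use assms in auto)

lemma continuous_on_cap: "continuous_on S (cap E b)"
proof -
  have "continuous_on S (\<lambda>z. cap E b z)"
  proof (cases b)
    case (Node v)
    then show ?thesis
      by (cases "\<exists>u. E v u") (simp_all only: cap.simps if_True if_False continuous_on_coord continuous_on_const)
  next
    case (Link v i u)
    then show ?thesis by (cases "E v u") (simp_all add: continuous_on_coord continuous_on_min)
  qed simp
  then show ?thesis by simp
qed

lemma cap_of_slack_block:
  "extends E p q \<Longrightarrow> b \<in> slacks E p \<Longrightarrow> cap E b q = cap E b p"
  using cap_extends[of E p q b] mass_nonneg[of p E b] by (auto simp: slacks_def slack_def extends_def)

lemma fill_tends:
  assumes "uncountable I" "p \<in> body E"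
  shows "tends (body_topology E) I (\<lambda>k. fill E L k p) p"
  using assms by (intro tends_index fill_body fill_other) auto

lemma accumulation_iff:
  assumes V: "uncountable (UNIV :: 'v set)" and p: "p \<in> body E"
  shows "accumulation (UNIV :: 'v set) (body_topology (E :: 'v \<Rightarrow> 'v \<Rightarrow> bool)) p \<longleftrightarrow> slacks E p \<noteq> {}"
proof
  assume "accumulation (UNIV :: 'v set) (body_topology E) p"
  then obtain I u where t: "tends (body_topology E) (I :: 'v set) u p" and ne: "\<And>i. i \<in> I \<Longrightarrow> u i \<noteq> p"
    unfolding accumulation_def by blast
  obtain i where "i \<in> I" "extends E p (u i)"
    using tends_pick[OF t, of "{}" "{}"] by auto
  then show "slacks E p \<noteq> {}" using new_slack[of E p "u i"] ne by (metis empty_iff)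
next
  assume "slacks E p \<noteq> {}"
  then obtain b where b: "0 < slack E b p" by (auto simp: slacks_def)
  have "fill E {b} k p \<noteq> p" for k
    using b fill_apply[of E "{b}" k p b k] by auto
  then show "accumulation (UNIV :: 'v set) (body_topology E) p"
    unfolding accumulation_def using fill_tends[OF V p, of "{b}"] by blast
qed

lemma finite_part_of_mass:
  assumes p: "p \<in> body E"
    and e: "0 < e"
  shows "\<exists>G. finite G \<and> mass b p - e < (\<Sum>i\<in>G. p (b, i)) \<and> (\<forall>i\<in>G. p (b, i) \<noteq> 0)"
proof -
  have "((\<lambda>i. p (b, i)) has_sum mass b p) UNIV"
    unfolding mass_def by (rule has_sum_infsum) (rule body_summable[OF p])
  then have "\<forall>\<^sub>F F in finite_subsets_at_top UNIV. mass b p - e < (\<Sum>i\<in>F. p (b, i))"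
    unfolding has_sum_def by (rule order_tendstoD) (use e in simp)
  then obtain F where F: "finite F" "mass b p - e < (\<Sum>i\<in>F. p (b, i))"
    by (auto simp: eventually_finite_subsets_at_top)
  have "(\<Sum>i\<in>{i \<in> F. p (b, i) \<noteq> 0}. p (b, i)) = (\<Sum>i\<in>F. p (b, i))"
    by (rule sum.mono_neutral_left) (use F in auto)
  then show ?thesis
    using F by (intro exI[of _ "{i \<in> F. p (b, i) \<noteq> 0}"]) auto
qed

text \<open>
  Near \<open>p\<close> there is room for only one entry that is larger than half of the slack.
\<close>

lemma separated_fill:
  assumes p: "p \<in> body E" and b: "b \<in> slacks E p" and I: "\<And>i. i \<in> I \<Longrightarrow> p (b, i) = 0"
  shows "separated (body_topology E) I (\<lambda>i. fill E {b} i p)"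
proof -
  define s where "s = slack E b p"
  have s: "0 < s" using b by (simp add: slacks_def s_def)
  obtain G where G: "finite G" "mass b p - s / 9 < (\<Sum>i\<in>G. p (b, i))" "\<And>i. i \<in> G \<Longrightarrow> p (b, i) \<noteq> 0"
    using finite_part_of_mass[OF p, of "s / 9" b] s by auto
  \<comment> \<open>With \<open>2 s / 3\<close> at two new entries and errors below \<open>s / 9\<close> in capacity and old sum, the capacity is exceeded: \<open>4 / 3 - 1 / 9 > 1 + 1 / 9\<close>.\<close>
  define U where "U i = {q \<in> body E. 2 * s / 3 < q (b, i)} \<inter> {q \<in> body E. - cap E b p - s / 9 < - cap E b q}
      \<inter> {q \<in> body E. mass b p - s / 9 < (\<Sum>i\<in>G. q (b, i))}" for i
  have "openin (body_topology E) (U i)" for i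
    unfolding U_def
    by (intro openin_Int openin_body_Collect_less continuous_intros continuous_on_coord continuous_on_cap)
  moreover have "fill E {b} i p \<in> U i" if "i \<in> I" for i
  proof -
    have "cap E b (fill E {b} i p) = cap E b p"
      by (cases b) (auto simp: fill_def)
    moreover have "(\<Sum>j\<in>G. fill E {b} i p (b, j)) = (\<Sum>j\<in>G. p (b, j))"
      using G(3) I[OF that] by (intro sum.cong) (auto simp: fill_apply)
    ultimately show ?thesis
      using s G(2) I[OF that] by (auto simp: U_def fill_body[OF p] fill_apply simp flip: s_def)
  qed
  moreover have "disjoint_family_on U I"
    unfolding disjoint_family_on_def
  proof (intro ballI impI)
    fix i j assume ij: "i \<in> I" "j \<in> I" "i \<noteq> j"
    show "U i \<inter> U j = {}"
    proof (rule ccontr)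
      assume "U i \<inter> U j \<noteq> {}"
      then obtain q where q: "q \<in> U i" "q \<in> U j" by blast
      have "i \<notin> G" "j \<notin> G" using G(3) I ij by auto
      then have "q (b, i) + q (b, j) + (\<Sum>i\<in>G. q (b, i)) = (\<Sum>i\<in>insert i (insert j G). q (b, i))"
        using G(1) ij by simp
      also have "\<dots> \<le> cap E b q"
        using q G(1) by (intro body_sum_le) (auto simp: U_def)
      finally have "q (b, i) + q (b, j) + (\<Sum>i\<in>G. q (b, i)) \<le> cap E b q" .
      moreover have "2 * s / 3 < q (b, i)" "2 * s / 3 < q (b, j)" "- cap E b p - s / 9 < - cap E b q"
        "mass b p - s / 9 < (\<Sum>i\<in>G. q (b, i))"
        using q by (auto simp: U_def)
      moreover have "cap E b p = mass b p + s" by (simp add: s_def slack_def)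
      ultimately show False using s by linarith
    qed
  qed
  ultimately show ?thesis unfolding separated_def by (intro exI[of _ U]) auto
qed

text \<open>
  The slacks of two different blocks can be consumed independently of each other, which yields the grid.
\<close>

lemma branchingI:
  fixes E :: "'v \<Rightarrow> 'v \<Rightarrow> bool"
  assumes V: "uncountable (UNIV :: 'v set)" and p: "p \<in> body E"
    and b: "b \<in> slacks E p" and b': "b' \<in> slacks E p" and ne: "b \<noteq> b'"
  shows "branching (UNIV :: 'v set) (body_topology E) p"
proof -
  let ?I = "{i. p (b, i) = 0 \<and> p (b', i) = 0}"
  let ?X = "body_topology E"
  have "countable ({i. p (b, i) \<noteq> 0} \<union> {i. p (b', i) \<noteq> 0})"
    by (intro countable_Un countable_row[OF p])
  then have "uncountable (UNIV - ({i. p (b, i) \<noteq> 0} \<union> {i. p (b', i) \<noteq> 0}))"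
    by (rule uncountable_minus_countable[OF V])
  then have I: "uncountable ?I" by (rule contrapos_nn) (erule countable_subset[rotated], auto)
  define z where "z i j = (\<lambda>(c, k). p (c, k) + (if k = i \<and> c = b then slack E b p else 0)
    + (if k = j \<and> c = b' then slack E b' p else 0))" for i j
  have u: "fill E {b} i p \<in> body E" for i by (rule fill_body[OF p])
  have z1: "z i j = (\<lambda>(c, k). fill E {b} i p (c, k) + (if k = j \<and> c = b' then slack E b' p else 0))" for i j
    by (auto simp: z_def fill_def fun_eq_iff)
  have z2: "z i j = (\<lambda>(c, k). fill E {b'} j p (c, k) + (if k = i \<and> c = b then slack E b p else 0))" for i j
    by (auto simp: z_def fill_def fun_eq_iff)
  have zb: "z i j \<in> body E" for i j
  proof (rule bodyI)
    have uz: "fill E {b} i p c \<le> z i j c" for c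
      using slack_nonneg[OF p] by (cases c) (auto simp: z1)
    have pz: "p c \<le> z i j c" for c
      using fill_ge[OF p, of c "{b}" i] uz[of c] by simp
    show "0 \<le> z i j c" for c using body_nonneg[OF p, of c] pz[of c] by simp
    fix c
    have s: "((\<lambda>k. if k = j then (if c = b' then slack E b' p else 0) else 0)
        has_sum (if c = b' then slack E b' p else 0)) UNIV"
      by (rule single_has_sum)
    have "((\<lambda>k. fill E {b} i p (c, k)) has_sum mass c (fill E {b} i p)) UNIV"
      unfolding mass_def by (rule has_sum_infsum) (rule body_summable[OF u])
    from has_sum_add[OF this s]
    have h: "((\<lambda>k. z i j (c, k)) has_sum (mass c (fill E {b} i p) + (if c = b' then slack E b' p else 0))) UNIV"
      by (rule has_sum_cong[THEN iffD1, rotated]) (auto simp: z1)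
    then show "(\<lambda>k. z i j (c, k)) summable_on UNIV" by (rule has_sum_imp_summable)
    have "mass c (z i j) = mass c (fill E {b} i p) + (if c = b' then slack E b' p else 0)"
      unfolding mass_def[of c "z i j"] using h by (rule infsumI)
    also have "\<dots> \<le> cap E c p"
      using mass_le_cap[OF p, of c] ne by (auto simp: mass_fill[OF p] slack_def)
    also have "\<dots> \<le> cap E c (z i j)" by (rule cap_mono) (rule pz)
    finally show "mass c (z i j) \<le> cap E c (z i j)" .
  qed
  show ?thesis
    unfolding branching_def
  proof (intro exI conjI ballI)
    show "tends ?X ?I (\<lambda>i. fill E {b} i p) p" "tends ?X ?I (\<lambda>i. fill E {b'} i p) p"
      by (rule fill_tends[OF I p])+
    show "tends ?X ?I (z i) (fill E {b} i p)" for i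
      by (rule tends_index[OF I u zb]) (auto simp: z1)
    show "tends ?X ?I (\<lambda>i. z i j) (fill E {b'} j p)" for j
      by (rule tends_index[OF I fill_body[OF p] zb]) (auto simp: z2)
    show "separated ?X ?I (\<lambda>i. fill E {b} i p)" by (rule separated_fill[OF p b]) auto
    show "separated ?X ?I (\<lambda>i. fill E {b'} i p)" by (rule separated_fill[OF p b']) auto
  qed auto
qed

section \<open>Points with a single slack block\<close>

lemma cap_new:
  assumes p: "p \<in> body E" "x \<in> body E" "y \<in> body E"
    and "cap E b p = 0" "0 < cap E b x" "0 < cap E b y"
  obtains c where "p c = 0" "0 < x c" "0 < y c"
proof (cases b)
  case (Node v)
  then show ?thesis using assms that[of "(Root, v)"] by (auto split: if_splits)
next
  case (Link v i u)
  then have "p (Node v, i) = 0 \<or> p (Root, u) = 0"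
    using assms(4,5) body_nonneg[OF p(1), of "(Node v, i)"] body_nonneg[OF p(1), of "(Root, u)"]
    by (auto simp: min_def split: if_splits)
  then show ?thesis using assms(5,6) Link that[of "(Node v, i)"] that[of "(Root, u)"]
    by (auto split: if_splits)
qed (use assms in simp)

text \<open>
  Two generic members of a family can be superposed if together they do not exceed the only slack. All
  other blocks either have no room at \<open>p\<close>, hence are unchanged, or have capacity \<open>0\<close> at \<open>p\<close>; a block of the
  latter kind is used by at most one of \<open>x\<close> and \<open>y\<close>, since these have no new entry in common.
\<close>

lemma merge_body:
  assumes x: "extends E p x" and y: "extends E p y" and s: "slacks E p = {b}"
    and dis: "\<And>c. p c = 0 \<Longrightarrow> x c = 0 \<or> y c = 0"
    and le: "mass b x + mass b y \<le> mass b p + cap E b p"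
  shows "(\<lambda>c. max (x c) (y c)) \<in> body E"
proof -
  define m where "m = (\<lambda>c. max (x c) (y c))"
  note B = extendsD(1)[OF x] extendsD(2)[OF x] extendsD(2)[OF y]
  have mx: "x c \<le> m c" and my: "y c \<le> m c" and mp: "p c \<le> m c" for c
    using extendsD(4)[OF x, of c] by (auto simp: m_def)
  have eq: "m c = x c + y c + - p c" for c
    using dis[of c] extendsD(3)[OF x, of c] extendsD(3)[OF y, of c]
      body_nonneg[OF B(2), of c] body_nonneg[OF B(3), of c] unfolding m_def
    by (cases "p c = 0") auto
  have h: "((\<lambda>i. z (c, i)) has_sum mass c z) UNIV" if "z \<in> body E" for c z
    unfolding mass_def by (rule has_sum_infsum) (rule body_summable[OF that])
  have hm: "((\<lambda>i. m (c, i)) has_sum (mass c x + mass c y + - mass c p)) UNIV" for c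
    unfolding eq by (intro has_sum_add has_sum_uminusI h B)
  have mass: "mass c m = mass c x + mass c y - mass c p" for c
    unfolding mass_def[of c m] using infsumI[OF hm[of c]] by simp
  have "m \<in> body E"
  proof (rule bodyI)
    show "0 \<le> m c" for c using mx[of c] body_nonneg[OF B(2), of c] by simp
    show "(\<lambda>i. m (c, i)) summable_on UNIV" for c using hm by (rule has_sum_imp_summable)
    fix c
    have capx: "cap E c x \<le> cap E c m" and capy: "cap E c y \<le> cap E c m" and capp: "cap E c p \<le> cap E c m"
      by (rule cap_mono, rule mx my mp)+
    note le_x = mass_le_cap[OF B(2), of c] and le_y = mass_le_cap[OF B(3), of c]
    show "mass c m \<le> cap E c m"
    proof (cases "c = b")
      case True
      then show ?thesis using mass[of c] le capp by simp
    next
      case False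
      have p0: "0 \<le> mass c p" "mass c p \<le> cap E c p" using mass_nonneg[OF B(1)] mass_le_cap[OF B(1)] by auto
      show ?thesis
      proof (cases "cap E c p = 0")
        case True
        have "cap E c x = 0 \<or> cap E c y = 0"
        proof (rule ccontr)
          assume "\<not> (cap E c x = 0 \<or> cap E c y = 0)"
          then have "0 < cap E c x" "0 < cap E c y"
            using le_x le_y mass_nonneg[OF B(2), of c] mass_nonneg[OF B(3), of c] by auto
          then obtain d where "p d = 0" "0 < x d" "0 < y d"
            using cap_new[OF B True] by blast
          then show False using dis[of d] by auto
        qed
        then show ?thesis
          using mass[of c] le_x le_y capx capy p0 True by auto
      next
        case cp: False
        have "x (c, i) = p (c, i)" for i
        proof (rule ccontr)
          assume ne: "x (c, i) \<noteq> p (c, i)"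
          then have "p (c, i) = 0" "0 < x (c, i)"
            using extendsD(3)[OF x, of "(c, i)"] body_nonneg[OF B(2), of "(c, i)"]
            by (metis less_eq_real_def)+
          then have "c \<in> slacks E p" using new_coord[OF x, of c i] cp by blast
          then show False using s False by blast
        qed
        then have "mass c x = mass c p" by (simp add: mass_def)
        then show ?thesis using mass[of c] le_y capy by simp
      qed
    qed
  qed
  then show ?thesis by (simp add: m_def)
qed

lemma tends_subset: "tends X I u p \<Longrightarrow> J \<subseteq> I \<Longrightarrow> uncountable J \<Longrightarrow> tends X J u p"
  unfolding tends_def by (auto intro: finite_subset[rotated])

text \<open>
  All but countably many members of a separated family use more than half of the slack. Otherwise two
  members that are generic relative to each other could be superposed, and the superposition would lie
  in both of their disjoint neighbourhoods.
\<close>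

lemma mass_of_separated:
  assumes t: "tends (body_topology E) I w p" and sep: "separated (body_topology E) I w"
    and s: "slacks E p = {b}"
  shows "countable {i \<in> I. 2 * mass b (w i) \<le> mass b p + cap E b p}"
proof (rule ccontr)
  let ?J = "{i \<in> I. 2 * mass b (w i) \<le> mass b p + cap E b p}"
  assume "uncountable ?J"
  then have "uncountable (?J - {i \<in> I. \<not> extends E p (w i)})"
    by (rule uncountable_minus_countable) (rule tends_extends[OF t])
  moreover define J where "J = ?J - {i \<in> I. \<not> extends E p (w i)}"
  ultimately have J: "uncountable J" by simp
  have Jd: "i \<in> I" "2 * mass b (w i) \<le> mass b p + cap E b p" "extends E p (w i)" if "i \<in> J" for i
    using that by (auto simp: J_def)
  have tJ: "tends (body_topology E) J w p"
    by (rule tends_subset[OF t _ J]) (auto simp: J_def)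
  obtain U where U: "\<And>i. i \<in> I \<Longrightarrow> openin (body_topology E) (U i)" "\<And>i. i \<in> I \<Longrightarrow> w i \<in> U i"
    "disjoint_family_on U I"
    using sep unfolding separated_def by blast
  have "\<exists>G e. finite G \<and> 0 < (e::real) \<and> (\<forall>q\<in>body E. (\<forall>c\<in>G. \<bar>q c - w i c\<bar> < e) \<longrightarrow> q \<in> U i)" if "i \<in> I" for i
    by (rule openin_body_nbhd[OF U(1)[OF that] U(2)[OF that]]) blast
  then obtain G e where G: "\<And>i. i \<in> I \<Longrightarrow> finite (G i)" and e: "\<And>i. i \<in> I \<Longrightarrow> 0 < (e i :: real)"
    and GU: "\<And>i q. i \<in> I \<Longrightarrow> q \<in> body E \<Longrightarrow> \<forall>c\<in>G i. \<bar>q c - w i c\<bar> < e i \<Longrightarrow> q \<in> U i"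
    by metis
  obtain I0 where I0: "countable I0" "infinite I0" "I0 \<subseteq> J"
    using infinite_countable_subset'[OF uncountable_infinite[OF J]] by metis
  \<comment> \<open>Choose \<open>j\<close> generic for infinitely many \<open>i\<close> at once; the finitely many entries relevant for \<open>U j\<close> then rule out only finitely many of these \<open>i\<close>.\<close>
  define A where "A = (\<Union>i\<in>I0. {c. w i c \<noteq> 0} \<union> G i)"
  have "countable ({c. w i c \<noteq> 0} \<union> G i)" if "i \<in> I0" for i
  proof -
    have "i \<in> J" using that I0(3) by (rule subsetD[rotated])
    then show ?thesis
      using countable_finite[OF G[OF Jd(1)]] countable_support[OF extendsD(2)[OF Jd(3)]] by simp
  qed
  then have "countable A" unfolding A_def by (rule countable_UN[OF I0(1)])
  from tends_pick[OF tJ this I0(1)]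
  obtain j where j: "j \<in> J" "j \<notin> I0" "\<And>c. c \<in> A \<Longrightarrow> w j c = p c"
    by blast
  have tJ': "finite {i \<in> J. d \<le> \<bar>w i c - p c\<bar>}" if "0 < d" for c d
    using tJ that unfolding tends_iff by blast
  have "finite (\<Union>c\<in>G j. {i \<in> J. e j \<le> \<bar>w i c - p c\<bar>})"
    by (intro finite_UN_I G[OF Jd(1)[OF j(1)]] tJ' e[OF Jd(1)[OF j(1)]])
  then obtain i where i: "i \<in> I0" "i \<notin> (\<Union>c\<in>G j. {i \<in> J. e j \<le> \<bar>w i c - p c\<bar>})"
    using I0(2) finite_subset[of I0] by blast
  have iJ: "i \<in> J" using i I0 by blast
  have near: "\<bar>w i c - p c\<bar> < e j" if "c \<in> G j" for c
    using i(2) that iJ by auto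
  define m where "m = (\<lambda>c. max (w i c) (w j c))"
  have m: "m \<in> body E"
    unfolding m_def
  proof (rule merge_body[OF Jd(3)[OF iJ] Jd(3)[OF j(1)] s])
    fix c assume "p c = 0"
    then show "w i c = 0 \<or> w j c = 0" using j(3)[of c] i(1) by (auto simp: A_def)
  qed (use Jd(2)[OF iJ] Jd(2)[OF j(1)] in simp)
  have ge: "p c \<le> w i c" "p c \<le> w j c" for c
    by (rule extendsD(4)[OF Jd(3)[OF iJ]], rule extendsD(4)[OF Jd(3)[OF j(1)]])
  have "m \<in> U i"
  proof (rule GU[OF Jd(1)[OF iJ] m], rule ballI)
    fix c assume "c \<in> G i"
    then have "w j c = p c" using j(3)[of c] i(1) unfolding A_def by blast
    then show "\<bar>m c - w i c\<bar> < e i" using ge(1)[of c] e[OF Jd(1)[OF iJ]] by (simp add: m_def)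
  qed
  moreover have "m \<in> U j"
  proof (rule GU[OF Jd(1)[OF j(1)] m], rule ballI)
    fix c assume "c \<in> G j"
    then show "\<bar>m c - w j c\<bar> < e j" using near[of c] ge[of c] by (auto simp: m_def max_def)
  qed
  moreover have "i \<noteq> j" using i j by blast
  ultimately show False
    using U(3) Jd(1)[OF iJ] Jd(1)[OF j(1)] unfolding disjoint_family_on_def by blast
qed

text \<open>
  A grid point \<open>z i j\<close> would have to contain, in the only slack block, what \<open>u i\<close> adds to \<open>p\<close> and almost
  all of what \<open>v j\<close> adds to \<open>p\<close>; each is more than half of the slack.
\<close>

lemma not_branching:
  assumes p: "p \<in> body E" and s: "slacks E p = {b}"
  shows "\<not> branching N (body_topology E) p"
proof
  assume "branching N (body_topology E) p"
  then obtain I u v z where raw: "I \<subseteq> N \<and> tends (body_topology E) I u p \<and> tends (body_topology E) I v p \<and>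
    (\<forall>i\<in>I. tends (body_topology E) I (z i) (u i)) \<and>
    (\<forall>j\<in>I. tends (body_topology E) I (\<lambda>i. z i j) (v j)) \<and>
    separated (body_topology E) I u \<and> separated (body_topology E) I v"
    unfolding branching_def by (elim exE)
  then have tu: "tends (body_topology E) I u p" and tv: "tends (body_topology E) I v p"
    and zu: "\<And>i. i\<in>I \<Longrightarrow> tends (body_topology E) I (z i) (u i)"
    and zv: "\<And>j. j\<in>I \<Longrightarrow> tends (body_topology E) I (\<lambda>i. z i j) (v j)"
    and su: "separated (body_topology E) I u" and sv: "separated (body_topology E) I v"
    by simp_all
  \<comment> \<open>Half of the slack is consumed when the sum of block \<open>b\<close> reaches \<open>h\<close>.\<close>
  define h where "h = (mass b p + cap E b p) / 2"
  have bs: "b \<in> slacks E p" using s by blast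
  let ?Bu = "{i \<in> I. 2 * mass b (u i) \<le> mass b p + cap E b p} \<union> {i \<in> I. \<not> extends E p (u i)}"
  let ?Bv = "{i \<in> I. 2 * mass b (v i) \<le> mass b p + cap E b p}"
  have "countable ?Bu" using mass_of_separated[OF tu su s] tends_extends[OF tu] by simp
  then have "uncountable (I - ?Bu)"
    using tu by (intro uncountable_minus_countable) (simp_all add: tends_def)
  from infinite_countable_subset'[OF uncountable_infinite[OF this]]
  obtain I0 where I0: "countable I0" "infinite I0" "I0 \<subseteq> I - ?Bu"
    by (elim exE conjE) (rule that)
  have I0d: "i \<in> I" "h < mass b (u i)" "extends E p (u i)" if "i \<in> I0" for i
    using that I0(3) by (auto simp: h_def)
  have csupp: "countable {c. u i c \<noteq> 0}" if "i \<in> I0" for i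
    using countable_support[OF extendsD(2)[OF I0d(3)[OF that]]] .
  have cz: "countable {j \<in> I. \<exists>c\<in>{c. u i c \<noteq> 0}. z i j c \<noteq> u i c}" if "i \<in> I0" for i
    by (rule tends_coords[OF zu[OF I0d(1)[OF that]] csupp[OF that]])
  have cA: "countable (\<Union>i\<in>I0. {c. u i c \<noteq> 0})" by (rule countable_UN[OF I0(1) csupp])
  have cB: "countable (?Bv \<union> (\<Union>i\<in>I0. {j \<in> I. \<exists>c\<in>{c. u i c \<noteq> 0}. z i j c \<noteq> u i c}))"
    by (intro countable_Un mass_of_separated[OF tv sv s] countable_UN[OF I0(1) cz])
  obtain j where j: "j \<in> I" "extends E p (v j)" "h < mass b (v j)"
    "\<And>i c. i \<in> I0 \<Longrightarrow> u i c \<noteq> 0 \<Longrightarrow> v j c = p c"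
    "\<And>i c. i \<in> I0 \<Longrightarrow> u i c \<noteq> 0 \<Longrightarrow> z i j c = u i c"
  proof -
    obtain j where *: "j \<in> I" "j \<notin> ?Bv \<union> (\<Union>i\<in>I0. {j \<in> I. \<exists>c\<in>{c. u i c \<noteq> 0}. z i j c \<noteq> u i c})"
      "extends E p (v j)" "\<And>c. c \<in> (\<Union>i\<in>I0. {c. u i c \<noteq> 0}) \<Longrightarrow> v j c = p c"
      using tends_pick[OF tv cA cB] by blast
    show thesis
    proof (rule that[OF *(1,3)])
      show "h < mass b (v j)" using *(1,2) by (auto simp: h_def)
      show "v j c = p c" if "i \<in> I0" "u i c \<noteq> 0" for i c using *(4)[of c] that by blast
      show "z i j c = u i c" if "i \<in> I0" "u i c \<noteq> 0" for i c using *(1,2) that by blast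
    qed
  qed
  obtain G' where G': "finite G'" "h < (\<Sum>l\<in>G'. v j (b, l))" "\<forall>l\<in>G'. v j (b, l) \<noteq> 0"
    using finite_part_of_mass[OF extendsD(2)[OF j(2)], of "mass b (v j) - h" b] j(3) by auto
  define G where "G = {l \<in> G'. p (b, l) = 0}"
  have G: "finite G" using G'(1) by (simp add: G_def)
  have "(\<Sum>l\<in>G'. v j (b, l)) = (\<Sum>l\<in>G. v j (b, l)) + (\<Sum>l\<in>G' - G. v j (b, l))"
    using G'(1) by (intro sum.subset_diff[of G G', THEN trans] add.commute) (auto simp: G_def)
  also have "(\<Sum>l\<in>G' - G. v j (b, l)) = (\<Sum>l\<in>G' - G. p (b, l))"
    by (rule sum.cong) (auto simp: G_def extendsD(3)[OF j(2)])
  also have "\<dots> \<le> mass b p" by (rule sum_le_mass[OF p]) (use G'(1) in simp)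
  finally have sG: "h - mass b p < (\<Sum>l\<in>G. v j (b, l))" using G'(2) by simp
  \<comment> \<open>The excess of \<open>v j\<close> over half of the slack, spread evenly over \<open>G\<close>; the denominator is never \<open>0\<close>.\<close>
  define d where "d = ((\<Sum>l\<in>G. v j (b, l)) - (h - mass b p)) / (real (card G) + 1)"
  have d: "0 < d" using sG by (simp add: d_def)
  have "finite (\<Union>l\<in>G. {i \<in> I. d \<le> \<bar>z i j (b, l) - v j (b, l)\<bar>})"
  proof (rule finite_UN_I[OF G])
    show "finite {i \<in> I. d \<le> \<bar>z i j (b, l) - v j (b, l)\<bar>}" for l
      using zv[OF j(1)] d unfolding tends_iff by blast
  qed
  then obtain i where i: "i \<in> I0" "i \<notin> (\<Union>l\<in>G. {i \<in> I. d \<le> \<bar>z i j (b, l) - v j (b, l)\<bar>})"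
    using I0(2) finite_subset[of I0] by blast
  have zb: "z i j \<in> body E" using tends_body(2)[OF zu[OF I0d(1)[OF i(1)]] j(1)] .
  have ext: "extends E (u i) (z i j)"
    using extendsD(2)[OF I0d(3)[OF i(1)]] zb j(5)[OF i(1)] unfolding extends_def by blast
  have ext': "extends E p (z i j)"
    using ext I0d(3)[OF i(1)] unfolding extends_def by metis
  have "(\<Sum>l\<in>G. v j (b, l)) - card G * d = (\<Sum>l\<in>G. v j (b, l) - d)"
    by (simp add: sum_subtractf)
  also have "\<dots> \<le> (\<Sum>l\<in>G. z i j (b, l))"
    using i(2) I0d(1)[OF i(1)] by (intro sum_mono) (auto simp: abs_if split: if_splits)
  finally have "(\<Sum>l\<in>G. v j (b, l)) - card G * d \<le> (\<Sum>l\<in>G. z i j (b, l))" .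
  moreover have "card G * d + d = (\<Sum>l\<in>G. v j (b, l)) - (h - mass b p)"
  proof -
    have "card G * d + d = (real (card G) + 1) * d" by (simp add: algebra_simps)
    also have "\<dots> = (\<Sum>l\<in>G. v j (b, l)) - (h - mass b p)" unfolding d_def by simp
    finally show ?thesis .
  qed
  ultimately have "h - mass b p < (\<Sum>l\<in>G. z i j (b, l))" using d by linarith
  moreover have "mass b (u i) + (\<Sum>l\<in>G. z i j (b, l)) \<le> mass b (z i j)"
  proof (rule extends_mass_new[OF ext G])
    fix l assume l: "l \<in> G"
    then have "p (b, l) = 0" "v j (b, l) \<noteq> 0" using G'(3) by (auto simp: G_def)
    then show "u i (b, l) = 0" using j(4)[OF i(1), of "(b, l)"] by auto
  qed
  moreover have "mass b (z i j) \<le> cap E b p"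
    using mass_le_cap[OF zb, of b] cap_of_slack_block[OF ext' bs] by simp
  ultimately show False using I0d(2)[OF i(1)] by (simp add: h_def field_simps)
qed

lemma simple_points_iff:
  fixes E :: "'v \<Rightarrow> 'v \<Rightarrow> bool"
  assumes V: "uncountable (UNIV :: 'v set)" and p: "p \<in> body E"
  shows "p \<in> simple_points (UNIV :: 'v set) (body_topology E) \<longleftrightarrow> (\<exists>b. slacks E p = {b})"
proof
  assume "p \<in> simple_points (UNIV :: 'v set) (body_topology E)"
  then have "slacks E p \<noteq> {}" "\<not> branching (UNIV :: 'v set) (body_topology E) p"
    using accumulation_iff[OF V p] by (auto simp: simple_points_def)
  then show "\<exists>b. slacks E p = {b}"
    using branchingI[OF V p] by blast
next
  assume "\<exists>b. slacks E p = {b}"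
  then show "p \<in> simple_points (UNIV :: 'v set) (body_topology E)"
    using not_branching[OF p] accumulation_iff[OF V p] unfolding simple_points_def by blast
qed

section \<open>Paths of points with a single slack block\<close>

lemma zero_of_zero_on_rationals:
  assumes h: "continuous_on {0..1} (h :: real \<Rightarrow> real)" and z: "\<And>t. t \<in> \<rat> \<Longrightarrow> t \<in> {0..1} \<Longrightarrow> h t = 0"
    and t: "t \<in> {0..1}"
  shows "h t = 0"
proof (rule ccontr)
  assume "h t \<noteq> 0"
  then obtain d where d: "0 < d" "\<And>s. s \<in> {0..1} \<Longrightarrow> dist s t < d \<Longrightarrow> dist (h s) (h t) < \<bar>h t\<bar>"
    using h t unfolding continuous_on_iff by (metis zero_less_abs_iff)
  have "max 0 (t - d) < min 1 (t + d)" using d(1) t by auto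
  then obtain s where s: "s \<in> \<rat>" "max 0 (t - d) < s" "s < min 1 (t + d)"
    using Rats_dense_in_real by blast
  then have "dist (h s) (h t) < \<bar>h t\<bar>" by (intro d(2)) (auto simp: dist_real_def)
  moreover have "h s = 0" using s by (intro z) auto
  ultimately show False by (simp add: dist_real_def)
qed

lemma pathin_body:
  "pathin (body_topology E) g \<longleftrightarrow> (\<forall>t\<in>{0..1}. g t \<in> body E) \<and> (\<forall>c. continuous_on {0..1} (\<lambda>t. g t c))"
proof -
  have "continuous_on {0..1} g \<longleftrightarrow> (\<forall>c. continuous_on {0..1} (\<lambda>t. g t c))"
    by (intro iffI allI continuous_on_coordinatewise_then_product)
      (erule continuous_on_product_then_coordinatewise, erule spec)
  then show ?thesis
    unfolding pathin_def continuous_map_in_subtopology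
    by (simp only: continuous_map_iff_continuous topspace_euclidean_subtopology Pi_iff) blast
qed

lemma cap_cong_pos:
  assumes "x \<in> body E" "0 < cap E b x" "\<And>c. x c \<noteq> 0 \<Longrightarrow> y c = z c"
  shows "cap E b y = cap E b z"
  using assms(2,3) by (cases b) (auto split: if_splits)

text \<open>
  Along the path only countably many entries are ever used, since the supports at rational times already
  contain all of them. A generic pushed path agrees with the path on these entries at all times, so it has
  at each time a new entry in the slack block. That entry stays positive for a while by continuity, and
  the block stays slack as long as it does.
\<close>

lemma joined_imp_slacks:
  fixes E :: "'v \<Rightarrow> 'v \<Rightarrow> bool"
  assumes V: "uncountable (UNIV :: 'v set)" and j: "joined (UNIV :: 'v set) (body_topology E) p q"
  shows "slacks E p = slacks E q"
proof -
  obtain g I G where raw: "I \<subseteq> (UNIV :: 'v set) \<and> pathin (body_topology E) g \<and> g 0 = p \<and> g 1 = q \<and>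
    g ` {0..1} \<subseteq> simple_points (UNIV :: 'v set) (body_topology E) \<and> (\<forall>i\<in>I. pathin (body_topology E) (G i)) \<and>
    (\<forall>t\<in>{0..1}. tends (body_topology E) I (\<lambda>i. G i t) (g t) \<and> (\<forall>i\<in>I. G i t \<noteq> g t))"
    using j unfolding joined_def by (elim exE)
  then have g: "pathin (body_topology E) g" "g 0 = p" "g 1 = q"
    "g ` {0..1} \<subseteq> simple_points (UNIV :: 'v set) (body_topology E)"
    and G: "\<And>i. i\<in>I \<Longrightarrow> pathin (body_topology E) (G i)"
    "\<And>t. t\<in>{0..1} \<Longrightarrow> tends (body_topology E) I (\<lambda>i. G i t) (g t)"
    "\<And>t i. t\<in>{0..1} \<Longrightarrow> i\<in>I \<Longrightarrow> G i t \<noteq> g t"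
    by simp_all
  have gb: "g t \<in> body E" if "t \<in> {0..1}" for t using g(1) that by (simp add: pathin_body)
  have gc: "continuous_on {0..1} (\<lambda>t. g t c)" for c using g(1) unfolding pathin_body by blast
  have single: "\<exists>b. slacks E (g t) = {b}" if "t \<in> {0..1}" for t
    using g(4) that simple_points_iff[OF V gb[OF that]] by blast
  define D where "D = \<rat> \<inter> {0..1::real}"
  have D: "countable D" "D \<subseteq> {0..1}" by (auto simp: D_def countable_rat)
  define A where "A = (\<Union>t\<in>D. {c. g t c \<noteq> 0})"
  have A: "countable A"
    unfolding A_def using D by (intro countable_UN countable_support[of _ E] gb) auto
  have supp: "g t c = 0" if "t \<in> {0..1}" "c \<notin> A" for t c
    by (rule zero_of_zero_on_rationals[OF gc _ that(1)]) (use that(2) in \<open>auto simp: A_def D_def\<close>)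
  have "countable (\<Union>t\<in>D. {i \<in> I. \<exists>c\<in>A. G i t c \<noteq> g t c})"
    using D by (intro countable_UN tends_coords[OF G(2) A]) auto
  moreover have "uncountable I" using G(2)[of 0] by (simp add: tends_def)
  ultimately obtain i where i: "i \<in> I" "i \<notin> (\<Union>t\<in>D. {i \<in> I. \<exists>c\<in>A. G i t c \<noteq> g t c})"
    by (meson countable_subset subsetI)
  have Gb: "G i t \<in> body E" if "t \<in> {0..1}" for t using G(1)[OF i(1)] that by (simp add: pathin_body)
  have Gc: "continuous_on {0..1} (\<lambda>t. G i t c)" for c using G(1)[OF i(1)] unfolding pathin_body by blast
  have agree: "G i t c = g t c" if "t \<in> {0..1}" "c \<in> A" for t c
  proof -
    have "G i t c - g t c = 0"
    proof (rule zero_of_zero_on_rationals[OF _ _ that(1)])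
      show "continuous_on {0..1} (\<lambda>t. G i t c - g t c)" by (intro continuous_intros Gc gc)
      show "G i t c - g t c = 0" if "t \<in> \<rat>" "t \<in> {0..1}" for t
        using i \<open>c \<in> A\<close> that by (auto simp: D_def)
    qed
    then show ?thesis by simp
  qed
  have ext: "extends E (g t) (G i t)" if "t \<in> {0..1}" for t
    unfolding extends_def
  proof (intro conjI allI impI gb[OF that] Gb[OF that])
    fix c assume "g t c \<noteq> 0"
    then have "c \<in> A" using supp[OF that] by blast
    then show "G i t c = g t c" by (rule agree[OF that])
  qed
  have "slacks E (g 0) = slacks E (g 1)"
  proof (rule connected_local_const[of "{0..1::real}" _ _ "\<lambda>t. slacks E (g t)"])
    show "\<forall>t\<in>{0..1}. \<forall>\<^sub>F s in at t within {0..1}. slacks E (g t) = slacks E (g s)"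
    proof
      fix t :: real assume t: "t \<in> {0..1}"
      obtain b l where b: "b \<in> slacks E (g t)" "g t (b, l) = 0" "0 < G i t (b, l)"
        using new_slack[OF ext[OF t]] G(3)[OF t i(1)] by metis
      have sgt: "slacks E (g t) = {b}" using single[OF t] b(1) by auto
      have nA: "(b, l) \<notin> A" using agree[OF t, of "(b, l)"] b by auto
      have "((\<lambda>s. G i s (b, l)) \<longlongrightarrow> G i t (b, l)) (at t within {0..1})"
        using Gc[of "(b, l)"] t by (simp add: continuous_on_def)
      from order_tendstoD(1)[OF this b(3)]
      have "\<forall>\<^sub>F s in at t within {0..1}. 0 < G i s (b, l) \<and> s \<in> {0..1}"
        by (simp add: eventually_conj eventually_at_filter eventually_mono)
      then show "\<forall>\<^sub>F s in at t within {0..1}. slacks E (g t) = slacks E (g s)"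
      proof (rule eventually_mono)
        fix s assume s: "0 < G i s (b, l) \<and> s \<in> {0..1}"
        then have s01: "s \<in> {0..1}" by blast
        \<comment> \<open>The entries that bound block \<open>b\<close> lie in \<open>A\<close>, as they are positive at time \<open>t\<close>; so the two paths agree there at all times.\<close>
        have capt: "0 < cap E b (g t)"
          using b(1) mass_nonneg[OF gb[OF t], of b] by (simp add: slacks_def slack_def)
        have "cap E b (G i s) = cap E b (g s)"
        proof (rule cap_cong_pos[OF gb[OF t] capt])
          fix c assume "g t c \<noteq> 0"
          then have "c \<in> A" using supp[OF t] by blast
          then show "G i s c = g s c" by (rule agree[OF s01])
        qed
        then have "cap E b (g s) \<noteq> 0"
          using s coord_le_cap[OF Gb[OF s01], of b l] by simp
        then have "b \<in> slacks E (g s)"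
          using new_coord[OF ext[OF s01], of b l] s supp[OF s01 nA] by blast
        then show "slacks E (g t) = slacks E (g s)"
          using single[OF s01] sgt by auto
      qed
    qed
  qed auto
  then show ?thesis using g(2,3) by simp
qed

definition segment_point :: "('c \<Rightarrow> real) \<Rightarrow> ('c \<Rightarrow> real) \<Rightarrow> real \<Rightarrow> 'c \<Rightarrow> real" where
  "segment_point p q t = (\<lambda>c. (1 - t) * p c + t * (q c :: real))"

lemma segment_mass:
  assumes p: "p \<in> body E" and q: "q \<in> body E"
  shows "((\<lambda>i. segment_point p q t (b, i)) has_sum ((1 - t) * mass b p + t * mass b q)) UNIV"
proof -
  have h: "((\<lambda>i. z (b, i)) has_sum mass b z) UNIV" if "z \<in> body E" for z
    unfolding mass_def by (rule has_sum_infsum) (rule body_summable[OF that])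
  show ?thesis
    unfolding segment_point_def by (intro has_sum_add has_sum_cmult_right h p q)
qed

lemma mass_segment:
  "p \<in> body E \<Longrightarrow> q \<in> body E \<Longrightarrow> mass b (segment_point p q t) = (1 - t) * mass b p + t * mass b q"
  unfolding mass_def[of b "segment_point p q t"] by (rule infsumI) (rule segment_mass)

lemma cap_segment:
  assumes t: "0 \<le> t" "t \<le> 1"
  shows "(1 - t) * cap E b p + t * cap E b q \<le> cap E b (segment_point p q t)"
proof (cases b)
  case (Link v i u)
  have "(1 - t) * min a a' + t * min c c' \<le> min ((1 - t) * a + t * c) ((1 - t) * a' + t * c')" for a a' c c' :: real
    using t by (intro min.boundedI add_mono mult_left_mono) auto
  then show ?thesis using Link by (simp add: segment_point_def)
qed (auto simp: segment_point_def)

lemma segment_body: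
  assumes p: "p \<in> body E" and q: "q \<in> body E" and t: "0 \<le> t" "t \<le> 1"
  shows "segment_point p q t \<in> body E"
proof (rule bodyI)
  show "0 \<le> segment_point p q t c" for c
    using t body_nonneg[OF p] body_nonneg[OF q] by (simp add: segment_point_def)
  show "(\<lambda>i. segment_point p q t (b, i)) summable_on UNIV" for b
    using segment_mass[OF p q] by (rule has_sum_imp_summable)
  fix b
  have "mass b (segment_point p q t) \<le> (1 - t) * cap E b p + t * cap E b q"
    unfolding mass_segment[OF p q] using t mass_le_cap[OF p] mass_le_cap[OF q]
    by (intro add_mono mult_left_mono) auto
  then show "mass b (segment_point p q t) \<le> cap E b (segment_point p q t)"
    using cap_segment[OF t, of E b p q] by simp
qed

lemma slack_segment_ge:
  assumes p: "p \<in> body E" and q: "q \<in> body E" and t: "0 \<le> t" "t \<le> 1"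
  shows "(1 - t) * slack E b p + t * slack E b q \<le> slack E b (segment_point p q t)"
  using cap_segment[OF t, of E b p q] unfolding slack_def mass_segment[OF p q]
  by (simp add: algebra_simps)

lemma slack_segment_eq:
  assumes p: "p \<in> body E" and q: "q \<in> body E" and b: "\<And>v i u. b \<noteq> Link v i u"
  shows "slack E b (segment_point p q t) = (1 - t) * slack E b p + t * slack E b q"
  using b unfolding slack_def mass_segment[OF p q]
  by (cases b) (auto simp: segment_point_def algebra_simps)

lemma continuous_slack_segment:
  assumes p: "p \<in> body E" and q: "q \<in> body E"
  shows "continuous_on S (\<lambda>t. slack E b (segment_point p q t))"
proof -
  have s: "continuous_on S (segment_point p q)"
    unfolding segment_point_def
    by (intro continuous_on_coordinatewise_then_product continuous_intros)
  have "continuous_on S (\<lambda>t. cap E b (segment_point p q t))"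
    using continuous_on_compose2[OF continuous_on_cap[of UNIV] s] by simp
  then show ?thesis
    unfolding slack_def mass_segment[OF p q] by (intro continuous_intros)
qed

lemma slack_zero: "p \<in> body E \<Longrightarrow> b \<notin> slacks E p \<Longrightarrow> slack E b p = 0"
  using slack_nonneg[of p E b] by (simp add: slacks_def)

lemma cap_fill_Links:
  assumes "L \<subseteq> {c. \<exists>v i u. c = Link v i u}"
  shows "cap E b (fill E L k z) = cap E b z"
  using assms by (cases b) (auto simp: fill_apply)

text \<open>
  On the straight segment the slack of \<open>Root\<close> and of \<open>Node\<close> blocks is affine, hence stays \<open>0\<close> outside \<open>b\<close>.
  Only \<open>Link\<close> blocks can gain slack, because a minimum is merely concave, and nothing depends on their
  entries. Filling them turns the segment into the required path, and filling \<open>b\<close> pushes it off itself.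
\<close>

lemma joinedI:
  fixes E :: "'v \<Rightarrow> 'v \<Rightarrow> bool"
  assumes V: "uncountable (UNIV :: 'v set)" and p: "p \<in> body E" and q: "q \<in> body E"
    and sp: "slacks E p = {b}" and sq: "slacks E q = {b}"
  shows "joined (UNIV :: 'v set) (body_topology E) p q"
proof -
  define L where "L = {c. \<exists>v i u. c = Link v i u} - {b}"
  have L: "L \<subseteq> {c. \<exists>v i u. c = Link v i u}" by (auto simp: L_def)
  let ?s = "segment_point p q"
  \<comment> \<open>Any fixed entry serves for the filling; a fixed one makes it continuous in \<open>t\<close>.\<close>
  define g where "g t = fill E L undefined (?s t)" for t
  have sb: "?s t \<in> body E" if "t \<in> {0..1}" for t using segment_body[OF p q] that by simp
  have gb: "g t \<in> body E" if "t \<in> {0..1}" for t unfolding g_def by (rule fill_body[OF sb[OF that]])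
  have slg: "slack E c (g t) = (if c \<in> L then 0 else slack E c (?s t))" if "t \<in> {0..1}" for c t
    unfolding g_def slack_fill[OF sb[OF that]] cap_fill_Links[OF L] by simp
  have gs: "slacks E (g t) = {b}" if t: "t \<in> {0..1}" for t
  proof -
    have pos: "0 < slack E b p" "0 < slack E b q" using sp sq by (auto simp: slacks_def)
    have "0 < (1 - t) * slack E b p + t * slack E b q"
    proof (cases "t = 0")
      case False
      then show ?thesis using t pos by (intro add_nonneg_pos mult_nonneg_nonneg) auto
    qed (use pos in simp)
    also have "\<dots> \<le> slack E b (?s t)" using slack_segment_ge[OF p q] t by auto
    finally have "0 < slack E b (g t)" by (simp add: slg[OF t] L_def)
    moreover have "slack E c (g t) = 0" if c: "c \<noteq> b" for c
    proof (cases "c \<in> L")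
      case False
      then have "\<And>v i u. c \<noteq> Link v i u" using c by (auto simp: L_def)
      moreover have "slack E c p = 0" "slack E c q = 0"
        using slack_zero[OF p, of c] slack_zero[OF q, of c] sp sq c by auto
      ultimately show ?thesis using False by (simp add: slg[OF t] slack_segment_eq[OF p q])
    qed (simp add: slg[OF t])
    ultimately show ?thesis by (auto simp: slacks_def) (metis less_irrefl)
  qed
  have fill0: "fill E L undefined z = z" if "z \<in> body E" "slacks E z = {b}" for z
    using slack_zero[OF that(1)] that(2) by (auto simp: fill_def fun_eq_iff L_def)
  have g0: "g 0 = p" using fill0[OF p sp] by (simp add: g_def segment_point_def)
  have g1: "g 1 = q" using fill0[OF q sq] by (simp add: g_def segment_point_def)
  have sc: "continuous_on {0..1} (\<lambda>t. ?s t c)" for c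
    unfolding segment_point_def by (intro continuous_intros)
  have gc: "continuous_on {0..1} (\<lambda>t. g t c)" for c
  proof -
    obtain d i where c: "c = (d, i)" by force
    show ?thesis unfolding c g_def fill_apply
      using continuous_on_add[OF sc[of "(d, i)"] continuous_slack_segment[OF p q, of _ d]] sc[of "(d, i)"]
      by (cases "i = undefined"; cases "d \<in> L") simp_all
  qed
  define G where "G i t = fill E {b} i (g t)" for i t
  have slb: "slack E b (g t) = slack E b (?s t)" if "t \<in> {0..1}" for t
    using slg[OF that, of b] by (simp add: L_def)
  have Gc: "continuous_on {0..1} (\<lambda>t. G i t c)" for i c
  proof -
    obtain d l where c: "c = (d, l)" by force
    have "continuous_on {0..1} (\<lambda>t. slack E b (g t))"
      using continuous_slack_segment[OF p q] by (rule continuous_on_cong[THEN iffD2, rotated 2]) (auto simp: slb)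
    then show ?thesis unfolding c G_def fill_apply
      by (cases "l = i \<and> d \<in> {b}") (auto intro!: continuous_intros gc)
  qed
  show ?thesis
    unfolding joined_def
  proof (intro exI conjI ballI)
    show "pathin (body_topology E) g" using gb gc by (simp add: pathin_body)
    show "g 0 = p" "g 1 = q" by fact+
    show "g ` {0..1} \<subseteq> simple_points (UNIV :: 'v set) (body_topology E)"
    proof clarify
      fix t :: real assume t: "t \<in> {0..1}"
      then show "g t \<in> simple_points (UNIV :: 'v set) (body_topology E)"
        using simple_points_iff[OF V gb[OF t]] gs[OF t] by blast
    qed
    show "pathin (body_topology E) (G i)" for i
      using Gc fill_body[OF gb] by (simp add: pathin_body G_def)
    show "tends (body_topology E) UNIV (\<lambda>i. G i t) (g t)" if "t \<in> {0..1}" for t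
      unfolding G_def by (rule fill_tends[OF V gb[OF that]])
    show "G i t \<noteq> g t" if t: "t \<in> {0..1}" for i t
    proof
      assume "G i t = g t"
      then have "G i t (b, i) = g t (b, i)" by simp
      then have "slack E b (g t) = 0" by (simp add: G_def fill_apply)
      then show False using gs[OF t] by (auto simp: slacks_def)
    qed
  qed auto
qed

lemma joined_class_eq:
  fixes E :: "'v \<Rightarrow> 'v \<Rightarrow> bool"
  assumes V: "uncountable (UNIV :: 'v set)" and p: "p \<in> body E" and s: "slacks E p = {b}"
  shows "joined_class (UNIV :: 'v set) (body_topology E) p = {q \<in> body E. slacks E q = {b}}"
proof -
  have "q \<in> body E" if "q \<in> simple_points (UNIV :: 'v set) (body_topology E)" for q
    using that simple_topspace[of "UNIV :: 'v set" "body_topology E"] by auto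
  then show ?thesis
    unfolding joined_class_def
    using simple_points_iff[OF V] joinedI[OF V p _ s] joined_imp_slacks[OF V, of E p] s by blast
qed

section \<open>Recovering the edges of the digraph\<close>

definition cell :: "('v \<Rightarrow> 'v \<Rightarrow> bool) \<Rightarrow> 'v block \<Rightarrow> ('v block \<times> 'v \<Rightarrow> real) set" where
  "cell E b = {q \<in> body E. slacks E q = {b}}"

text \<open>
  Consuming all slack except that of \<open>b\<close>. The order matters: filling \<open>Root\<close> raises capacities of \<open>Node\<close>
  blocks, and filling these raises capacities of \<open>Link\<close> blocks.
\<close>

definition saturate :: "('v \<Rightarrow> 'v \<Rightarrow> bool) \<Rightarrow> 'v block \<Rightarrow> 'v \<Rightarrow> ('v block \<times> 'v \<Rightarrow> real) \<Rightarrow> 'v block \<times> 'v \<Rightarrow> real" where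
  "saturate E b k z = fill E ({c. \<exists>v i u. c = Link v i u} - {b}) k
    (fill E (range Node - {b}) k (fill E {Root} k z))"

lemma saturate_body: "z \<in> body E \<Longrightarrow> saturate E b k z \<in> body E"
  by (simp add: saturate_def fill_body)

lemma saturate_other: "i \<noteq> k \<Longrightarrow> saturate E b k z (c, i) = z (c, i)"
  by (simp add: saturate_def fill_other)

lemma cap_fill_Node: "cap E (Node v) (fill E (range Node - {b}) k z) = cap E (Node v) z"
  by (auto simp: fill_apply)

context
  fixes E :: "'v \<Rightarrow> 'v \<Rightarrow> bool" and b :: "'v block" and k :: 'v and z
  assumes z: "z \<in> body E" and b: "b \<noteq> Root"
begin

private lemma z1: "fill E {Root} k z \<in> body E" by (rule fill_body[OF z])

private lemma z2: "fill E (range Node - {b}) k (fill E {Root} k z) \<in> body E" by (rule fill_body[OF z1])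

private lemma cap_links:
  "cap E c (fill E ({c. \<exists>v i u. c = Link v i u} - {b}) k y) = cap E c y"
  by (rule cap_fill_Links) blast

lemma slacks_saturate: "slacks E (saturate E b k z) \<subseteq> {b}"
proof
  fix c assume "c \<in> slacks E (saturate E b k z)"
  then have c: "slack E c (saturate E b k z) \<noteq> 0" by (simp add: slacks_def)
  show "c \<in> {b}"
  proof (rule ccontr)
    assume ne: "c \<notin> {b}"
    have "slack E c (saturate E b k z) = 0"
    proof (cases c)
      case Root
      then show ?thesis
        by (simp add: saturate_def slack_fill z1 z2 z image_iff)
    next
      case (Node v)
      then show ?thesis
        using ne cap_fill_Node[of E v b k "fill E {Root} k z"]
        by (simp add: saturate_def slack_fill z1 z2 z image_iff cap_links del: cap.simps)
    next
      case (Link v i u)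
      then show ?thesis
        using ne by (simp add: saturate_def slack_fill z1 z2 z cap_links del: cap.simps)
    qed
    then show False using c by simp
  qed
qed

lemma mass_saturate: "mass b (saturate E b k z) = mass b z"
  using b by (simp add: saturate_def mass_fill z1 z2 z)

lemma saturate_Root: "saturate E b k z (Root, v) = z (Root, v) + (if v = k then slack E Root z else 0)"
  by (simp add: saturate_def fill_apply image_iff)

lemma saturate_Node:
  assumes "b \<noteq> Node v"
  shows "z (Node v, k) + slack E (Node v) z \<le> saturate E b k z (Node v, k)"
proof -
  have "saturate E b k z (Node v, k) = z (Node v, k) + slack E (Node v) (fill E {Root} k z)"
    using assms by (simp add: saturate_def fill_apply)
  moreover have "slack E (Node v) z \<le> slack E (Node v) (fill E {Root} k z)"
    using cap_mono[of z "fill E {Root} k z" E "Node v"] fill_ge[OF z] by (simp add: slack_fill[OF z] del: cap.simps)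
  ultimately show ?thesis by simp
qed

end

lemma uncountable_zero:
  fixes z :: "'v block \<times> 'v \<Rightarrow> real"
  assumes z: "z \<in> body E" and I: "uncountable I"
  shows "uncountable {k \<in> I. z (b, k) = 0}"
proof -
  have "uncountable (I - {k. z (b, k) \<noteq> 0})"
    by (rule uncountable_minus_countable[OF I countable_row[OF z]])
  moreover have "I - {k. z (b, k) \<noteq> 0} = {k \<in> I. z (b, k) = 0}" by blast
  ultimately show ?thesis by simp
qed

lemma limits_saturate:
  fixes z :: "'v block \<times> 'v \<Rightarrow> real"
  assumes "z \<in> body E" "uncountable I" "\<And>k. k \<in> I \<Longrightarrow> saturate E (b k) k z \<in> Y"
  shows "z \<in> limits (UNIV :: 'v set) (body_topology E) Y"
proof -
  have "tends (body_topology E) I (\<lambda>k. saturate E (b k) k z) z"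
    using assms(1,2) by (intro tends_index saturate_body saturate_other) auto
  then show ?thesis using assms(3) unfolding limits_def by blast
qed

lemma limits_pick:
  fixes N :: "'i set"
  assumes "z \<in> limits N (body_topology E) Y" "countable A"
  obtains q where "q \<in> Y" "extends E z q" "\<And>c. c \<in> A \<Longrightarrow> q c = z c"
proof -
  obtain I :: "'i set" and u where u: "tends (body_topology E) I u z" "u ` I \<subseteq> Y"
    using assms(1) unfolding limits_def by blast
  show thesis
  proof (rule tends_pick[OF u(1) assms(2) countable_empty])
    fix i assume "i \<in> I" "extends E z (u i)" "\<And>c. c \<in> A \<Longrightarrow> u i c = z c"
    then show thesis using that[of "u i"] u(2) by blast
  qed
qed

lemma limits_mono: "Y \<subseteq> Z \<Longrightarrow> limits N X Y \<subseteq> limits N X Z"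
  unfolding limits_def by blast

lemma limits_cell_Node:
  assumes "z \<in> limits N (body_topology E) (cell E (Node v))"
  shows "Node v \<in> slacks E z"
proof -
  obtain q where q: "q \<in> cell E (Node v)" "extends E z q" "\<And>c. c \<in> {(Root, v)} \<Longrightarrow> q c = z c"
    by (rule limits_pick[OF assms, of "{(Root, v)}"]) auto
  show ?thesis
    by (rule slack_old[OF q(2)]) (use q(1,3) in \<open>auto simp: cell_def\<close>)
qed

lemma cell_Link_pos:
  assumes "q \<in> cell E (Link a i u)"
  shows "E a u" "0 < q (Root, u)" "0 < q (Node a, i)"
proof -
  have "Link a i u \<in> slacks E q" using assms by (simp add: cell_def)
  then have "0 < cap E (Link a i u) q"
    using assms mass_nonneg[of q E "Link a i u"] by (simp add: slacks_def slack_def cell_def)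
  then show "E a u" "0 < q (Root, u)" "0 < q (Node a, i)" by (auto split: if_splits)
qed

lemma limits_cell_Link:
  assumes "z \<in> limits N (body_topology E) (cell E (Link a i u))"
  shows "0 < z (Root, u)"
proof -
  obtain q where q: "q \<in> cell E (Link a i u)" "\<And>c. c \<in> {(Root, u)} \<Longrightarrow> q c = z c"
    by (rule limits_pick[OF assms, of "{(Root, u)}"]) auto
  then show ?thesis using cell_Link_pos(2)[OF q(1)] by simp
qed

text \<open>
  Saturation puts the slack of \<open>Node a\<close> on the entry \<open>k\<close> and thereby opens the block \<open>Link a k u\<close>, which is
  the one left unfilled. As \<open>k\<close> varies, uncountably many different classes approach \<open>z\<close>.
\<close>

lemma limits_of_edge:
  fixes E :: "'v \<Rightarrow> 'v \<Rightarrow> bool"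
  assumes V: "uncountable (UNIV :: 'v set)" and z: "z \<in> body E"
    and a: "Node a \<in> slacks E z" and u: "0 < z (Root, u)" and E: "E a u"
  shows "z \<in> limits (UNIV :: 'v set) (body_topology E) (\<Union>k\<in>-{i}. cell E (Link a k u))"
proof (rule limits_saturate[OF z])
  show "uncountable ({k \<in> UNIV. z (Node a, k) = 0} - {i})"
    by (intro uncountable_minus_countable uncountable_zero[OF z V]) simp
  fix k assume k: "k \<in> {k \<in> UNIV. z (Node a, k) = 0} - {i}"
  let ?q = "saturate E (Link a k u) k z"
  have "0 < ?q (Node a, k)"
    using saturate_Node[OF z, of "Link a k u" a k] a body_nonneg[OF z, of "(Node a, k)"]
    by (simp add: slacks_def)
  moreover have "0 < ?q (Root, u)"
    using saturate_Root[OF z, of "Link a k u" k u] u slack_nonneg[OF z, of Root] by auto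
  ultimately have "0 < cap E (Link a k u) ?q" using E by simp
  moreover have "mass (Link a k u) ?q = 0"
  proof -
    have "mass (Link a k u) ?q = mass (Link a k u) z"
      by (rule mass_saturate[OF z]) simp
    also have "\<dots> \<le> cap E (Link a k u) z" by (rule mass_le_cap[OF z])
    also have "\<dots> \<le> 0" using k E by (simp add: min_le_iff_disj)
    finally show ?thesis using mass_nonneg[OF saturate_body[OF z], of "Link a k u" "Link a k u" k] by simp
  qed
  ultimately have "Link a k u \<in> slacks E ?q" by (simp add: slacks_def slack_def)
  then have "slacks E ?q = {Link a k u}"
    using slacks_saturate[OF z, of "Link a k u" k] by auto
  then show "?q \<in> (\<Union>k\<in>-{i}. cell E (Link a k u))"
    using k saturate_body[OF z] by (auto simp: cell_def)
qed

text \<open>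
  Slack of \<open>Root\<close> can be turned into weight of a new source \<open>k\<close>, whose block \<open>Node k\<close> is left unfilled.
\<close>

lemma limits_of_Root:
  fixes E :: "'v \<Rightarrow> 'v \<Rightarrow> bool"
  assumes S: "uncountable {v. \<exists>u. E v u}" and z: "z \<in> body E" and r: "Root \<in> slacks E z"
  shows "z \<in> limits (UNIV :: 'v set) (body_topology E) (\<Union>k. cell E (Node k))"
proof (rule limits_saturate[OF z])
  show "uncountable {k \<in> {v. \<exists>u. E v u}. z (Root, k) = 0}"
    by (rule uncountable_zero[OF z S])
  fix k assume k: "k \<in> {k \<in> {v. \<exists>u. E v u}. z (Root, k) = 0}"
  let ?q = "saturate E (Node k) k z"
  have "0 < cap E (Node k) ?q"
    using k r saturate_Root[OF z, of "Node k" k k] by (auto simp: slacks_def)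
  moreover have "mass (Node k) ?q \<le> 0"
    using mass_saturate[OF z, of "Node k" k] mass_le_cap[OF z, of "Node k"] k by auto
  ultimately have "Node k \<in> slacks E ?q" by (simp add: slacks_def slack_def)
  then have "slacks E ?q = {Node k}"
    using slacks_saturate[OF z, of "Node k" k] by auto
  then show "?q \<in> (\<Union>k. cell E (Node k))"
    using saturate_body[OF z] by (auto simp: cell_def)
qed

text \<open>
  Points for explicit computations: the vertices in \<open>W\<close> share the weight evenly, and \<open>r a = Some i\<close> says
  that the block \<open>Node a\<close> is exhausted by its entry \<open>i\<close>.
\<close>

definition uniform_point :: "'v set \<Rightarrow> ('v \<Rightarrow> 'v option) \<Rightarrow> 'v block \<times> 'v \<Rightarrow> real" where
  "uniform_point W r = (\<lambda>(b, i). case b of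
      Root \<Rightarrow> if i \<in> W then 1 / card W else 0
    | Node a \<Rightarrow> if r a = Some i then 1 / card W else 0
    | Link a j u \<Rightarrow> 0)"

lemma uniform_point_simps:
  "uniform_point W r (Root, i) = (if i \<in> W then 1 / card W else 0)"
  "uniform_point W r (Node a, i) = (if r a = Some i then 1 / card W else 0)"
  "uniform_point W r (Link a j u, i) = 0"
  by (simp_all add: uniform_point_def)

context
  fixes E :: "'v \<Rightarrow> 'v \<Rightarrow> bool" and W :: "'v set" and r :: "'v \<Rightarrow> 'v option"
  assumes W: "finite W" "W \<noteq> {}" and r: "\<And>a. a \<in> dom r \<Longrightarrow> a \<in> W \<and> (\<exists>u. E a u)"
begin

private lemma card: "0 < 1 / real (card W)" using W by (simp add: card_gt_0_iff)

lemma uniform_point_has_sum: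
  "((\<lambda>i. uniform_point W r (Root, i)) has_sum 1) UNIV"
  "((\<lambda>i. uniform_point W r (Node a, i)) has_sum (if r a = None then 0 else 1 / card W)) UNIV"
  "((\<lambda>i. uniform_point W r (Link a j u, i)) has_sum 0) UNIV"
proof -
  show "((\<lambda>i. uniform_point W r (Root, i)) has_sum 1) UNIV"
    using has_sum_finite_neutralI[of W UNIV "\<lambda>i. uniform_point W r (Root, i)" 1] W by (simp add: uniform_point_simps)
  show "((\<lambda>i. uniform_point W r (Node a, i)) has_sum (if r a = None then 0 else 1 / card W)) UNIV"
  proof (cases "r a")
    case (Some i)
    then have "(\<lambda>k. uniform_point W r (Node a, k)) = (\<lambda>k. if k = i then 1 / card W else 0)"
      by (auto simp: uniform_point_simps)
    then show ?thesis using single_has_sum[of i "1 / card W"] Some by simp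
  qed (simp add: uniform_point_simps)
qed (simp add: uniform_point_simps)

lemma mass_uniform_point:
  "mass Root (uniform_point W r) = 1"
  "mass (Node a) (uniform_point W r) = (if r a = None then 0 else 1 / card W)"
  "mass (Link a j u) (uniform_point W r) = 0"
  unfolding mass_def by (rule infsumI, rule uniform_point_has_sum)+

lemma uniform_point_body: "uniform_point W r \<in> body E"
proof (rule bodyI)
  show "0 \<le> uniform_point W r c" for c
    by (cases c) (auto simp: uniform_point_def split: block.split)
  show "(\<lambda>i. uniform_point W r (b, i)) summable_on UNIV" for b
    by (cases b) (use uniform_point_has_sum has_sum_imp_summable in blast)+
  show "mass b (uniform_point W r) \<le> cap E b (uniform_point W r)" for b
  proof (cases b)
    case (Node v)
    then show ?thesis using r[of v] by (auto simp: mass_uniform_point uniform_point_simps)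
  qed (auto simp: mass_uniform_point uniform_point_simps)
qed

lemma slacks_uniform_point:
  "slacks E (uniform_point W r) = {Node v |v. v \<in> W \<and> (\<exists>u. E v u) \<and> r v = None}
    \<union> {Link v i u |v i u. E v u \<and> r v = Some i \<and> u \<in> W}"
proof (rule set_eqI)
  fix b
  show "b \<in> slacks E (uniform_point W r) \<longleftrightarrow> b \<in> {Node v |v. v \<in> W \<and> (\<exists>u. E v u) \<and> r v = None}
      \<union> {Link v i u |v i u. E v u \<and> r v = Some i \<and> u \<in> W}"
    using card by (cases b) (auto simp: slacks_def slack_def mass_uniform_point uniform_point_simps split: if_splits)
qed

end

text \<open>
  Sinks have no slack of their own, so the slack of \<open>Node a\<close> is all that is needed to open the block
  \<open>Link a i u\<close>, and \<open>u\<close> takes part in it through its weight alone. Uncountably many sources make the class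
  of \<open>Root\<close> different from the classes of \<open>Node\<close> blocks: every point of it is approached by other classes.
\<close>

locale network =
  fixes E :: "'v \<Rightarrow> 'v \<Rightarrow> bool"
  assumes uncountable_sources: "uncountable {v. \<exists>u. E v u}"
    and no_path: "E v u \<Longrightarrow> \<not> E u w"
begin

lemma uncountable_UNIV: "uncountable (UNIV :: 'v set)"
  using uncountable_sources countable_subset subset_UNIV by blast

abbreviation "X \<equiv> body_topology E"
abbreviation "simple \<equiv> simple_points (UNIV :: 'v set) X"

lemma simple_eq: "simple = {q \<in> body E. \<exists>b. slacks E q = {b}}"
proof -
  have "q \<in> body E" if "q \<in> simple" for q
    using that simple_topspace[of "UNIV :: 'v set" X] by auto
  then show ?thesis using simple_points_iff[OF uncountable_UNIV] by blast
qed

lemma cell_simple: "cell E b \<subseteq> simple"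
  unfolding simple_eq cell_def by blast

lemma class_cell: "p \<in> cell E b \<Longrightarrow> joined_class (UNIV :: 'v set) X p = cell E b"
  unfolding cell_def by (rule joined_class_eq[OF uncountable_UNIV]) auto

lemma cell_disjoint: "b \<noteq> c \<Longrightarrow> q \<in> cell E b \<Longrightarrow> q \<notin> cell E c"
  by (auto simp: cell_def)

lemma old_Root:
  assumes e: "extends E p q" and r: "Root \<notin> slacks E p"
  shows "q (Root, v) = p (Root, v)"
  using new_Root[OF e, of v] r extendsD(3)[OF e, of "(Root, v)"]
    body_nonneg[OF extendsD(2)[OF e], of "(Root, v)"] by (metis less_eq_real_def)

lemma old_Node:
  assumes e: "extends E p q" and r: "Root \<notin> slacks E p" "Node v \<notin> slacks E p"
  shows "q (Node v, i) = p (Node v, i)"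
  using new_Node[OF e, of v i] r extendsD(3)[OF e, of "(Node v, i)"]
    body_nonneg[OF extendsD(2)[OF e], of "(Node v, i)"] by (metis less_eq_real_def)

lemma old_slack:
  assumes e: "extends E p q" and r: "Root \<notin> slacks E p" and b: "b \<in> slacks E q"
    and nL: "\<And>v i u. b = Link v i u \<Longrightarrow> Node v \<notin> slacks E p"
  shows "b \<in> slacks E p"
proof (rule slack_old[OF e b])
  show "cap E b q \<le> cap E b p"
  proof (cases b)
    case (Node v)
    show ?thesis by (simp only: Node cap.simps old_Root[OF e r] order_refl)
  next
    case (Link v i u)
    show ?thesis by (simp only: Link cap.simps old_Root[OF e r] old_Node[OF e r nL[OF Link]] order_refl)
  qed simp
qed

lemma Node_slack_source:
  assumes "p \<in> body E" "Node v \<in> slacks E p"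
  shows "\<exists>u. E v u"
proof (rule ccontr)
  assume n: "\<not> (\<exists>u. E v u)"
  have "cap E (Node v) p = 0" by (simp only: cap.simps n if_False)
  then show False
    using assms mass_nonneg[of p E "Node v"] by (simp add: slacks_def slack_def del: cap.simps)
qed

text \<open>
  The entries of a \<open>Link\<close> block bound no other block, so consuming its slack opens nothing.
\<close>

lemma terminal_Link:
  assumes p: "p \<in> cell E (Link a i u)"
  shows "terminal (UNIV :: 'v set) X p"
proof -
  have "p' \<notin> limits (UNIV :: 'v set) X (simple - cell E (Link a i u))" if p': "p' \<in> cell E (Link a i u)" for p'
  proof
    assume "p' \<in> limits (UNIV :: 'v set) X (simple - cell E (Link a i u))"
    then obtain q where q: "q \<in> simple - cell E (Link a i u)" "extends E p' q"
      by (rule limits_pick[OF _ countable_empty]) blast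
    obtain c where c: "slacks E q = {c}" "c \<noteq> Link a i u"
      using q(1) unfolding simple_eq cell_def by blast
    have "c \<in> slacks E p'"
      by (rule old_slack[OF q(2)]) (use c p' in \<open>auto simp: cell_def\<close>)
    then show False using c p' by (auto simp: cell_def)
  qed
  then show ?thesis
    unfolding terminal_def class_cell[OF p] using p cell_simple by blast
qed

text \<open>
  The class contains points at which some out-neighbour of \<open>v\<close> has positive weight.
\<close>

lemma not_terminal_Node:
  assumes p: "p \<in> cell E (Node v)"
  shows "\<not> terminal (UNIV :: 'v set) X p"
proof -
  obtain u where u: "E v u" using Node_slack_source[of p v] p by (auto simp: cell_def)
  define z where "z = uniform_point {v, u} (\<lambda>_. None)"
  have z: "z \<in> body E" unfolding z_def by (rule uniform_point_body) auto
  have s: "slacks E z = {Node v}"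
    unfolding z_def by (subst slacks_uniform_point) (use u no_path[OF u] in auto)
  have "0 < z (Root, u)" unfolding z_def by (simp add: uniform_point_simps card_gt_0_iff)
  then have "z \<in> limits (UNIV :: 'v set) X (\<Union>k\<in>-{undefined}. cell E (Link v k u))"
    by (intro limits_of_edge[OF uncountable_UNIV z]) (use s u in auto)
  moreover have "(\<Union>k\<in>-{undefined}. cell E (Link v k u)) \<subseteq> simple - cell E (Node v)"
    using cell_simple cell_disjoint by blast
  ultimately have "z \<in> limits (UNIV :: 'v set) X (simple - cell E (Node v))"
    using limits_mono by blast
  moreover have "z \<in> cell E (Node v)" using z s by (simp add: cell_def)
  ultimately show ?thesis unfolding terminal_def class_cell[OF p] by blast
qed

lemma cell_Root_limits:
  "cell E Root \<subseteq> limits (UNIV :: 'v set) X (simple - cell E Root)"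
proof
  fix z assume "z \<in> cell E Root"
  then have "z \<in> limits (UNIV :: 'v set) X (\<Union>k. cell E (Node k))"
    by (intro limits_of_Root[OF uncountable_sources]) (auto simp: cell_def)
  moreover have "(\<Union>k. cell E (Node k)) \<subseteq> simple - cell E Root"
    using cell_simple cell_disjoint by blast
  ultimately show "z \<in> limits (UNIV :: 'v set) X (simple - cell E Root)"
    using limits_mono by blast
qed

lemma not_terminal_Root:
  assumes p: "p \<in> cell E Root"
  shows "\<not> terminal (UNIV :: 'v set) X p"
  unfolding terminal_def class_cell[OF p] using p cell_Root_limits by blast

lemma unit_cell: "E v u \<Longrightarrow> uniform_point {v} (\<lambda>_. None) \<in> cell E (Node v)"
  unfolding cell_def by (subst mem_Collect_eq, subst slacks_uniform_point) (auto intro!: uniform_point_body)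

text \<open>
  If all weight is on \<open>v\<close>, then no out-neighbour of \<open>v\<close> has weight and no \<open>Link\<close> block can be opened.
\<close>

lemma unit_not_limit:
  assumes v: "E v u"
  shows "uniform_point {v} (\<lambda>_. None) \<notin> limits (UNIV :: 'v set) X (simple - cell E (Node v))"
proof
  let ?z = "uniform_point {v} (\<lambda>_. None)"
  have z: "?z \<in> body E" "slacks E ?z = {Node v}" using unit_cell[OF v] by (auto simp: cell_def)
  assume "?z \<in> limits (UNIV :: 'v set) X (simple - cell E (Node v))"
  then obtain q where q: "q \<in> simple - cell E (Node v)" "extends E ?z q"
    by (rule limits_pick[OF _ countable_empty]) blast
  obtain c where c: "slacks E q = {c}" "c \<noteq> Node v" "q \<in> body E"
    using q(1) unfolding simple_eq cell_def by blast
  have r: "Root \<notin> slacks E ?z" using z by simp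
  show False
  proof (cases "\<exists>a i w. c = Link a i w")
    case True
    then obtain a i w where c': "c = Link a i w" by blast
    then have "q \<in> cell E (Link a i w)" using c by (simp add: cell_def)
    note pos = cell_Link_pos[OF this]
    have "0 < ?z (Root, w)" using pos(2) old_Root[OF q(2) r] by simp
    then have "w = v" by (simp add: uniform_point_simps split: if_splits)
    then show False using no_path[OF pos(1)] v by blast
  next
    case False
    then have "c \<in> slacks E ?z" by (intro old_slack[OF q(2) r]) (use c in auto)
    then show False using c z by simp
  qed
qed

lemma terminal_iff:
  assumes p: "p \<in> body E"
  shows "terminal (UNIV :: 'v set) X p \<longleftrightarrow> (\<exists>a i u. p \<in> cell E (Link a i u))"
proof
  assume t: "terminal (UNIV :: 'v set) X p"
  then obtain b where "slacks E p = {b}" unfolding terminal_def simple_eq by blast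
  then have b: "p \<in> cell E b" using p by (simp add: cell_def)
  show "\<exists>a i u. p \<in> cell E (Link a i u)"
    using t b not_terminal_Root not_terminal_Node by (cases b) auto
qed (use terminal_Link in blast)

lemma nodal_iff:
  assumes p: "p \<in> body E"
  shows "nodal (UNIV :: 'v set) X p \<longleftrightarrow> (\<exists>v. p \<in> cell E (Node v))"
proof
  assume t: "nodal (UNIV :: 'v set) X p"
  then obtain b where "slacks E p = {b}" unfolding nodal_def simple_eq by blast
  then have b: "p \<in> cell E b" using p by (simp add: cell_def)
  have "b \<noteq> Root" using t b cell_Root_limits class_cell[of p Root] unfolding nodal_def by auto
  moreover have "b \<noteq> Link a i u" for a i u using t b terminal_Link unfolding nodal_def by auto
  ultimately show "\<exists>v. p \<in> cell E (Node v)" using b by (cases b) auto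
next
  assume "\<exists>v. p \<in> cell E (Node v)"
  then obtain v where v: "p \<in> cell E (Node v)" by blast
  then obtain u where u: "E v u" using Node_slack_source[of p v] by (auto simp: cell_def)
  show "nodal (UNIV :: 'v set) X p"
    unfolding nodal_def class_cell[OF v]
    using not_terminal_Node[OF v] v cell_simple unit_cell[OF u] unit_not_limit[OF u] by blast
qed

lemma not_compatible:
  assumes p: "p \<in> cell E (Node v)" and q: "q \<in> cell E (Link a i u)" and E: "E v u"
  shows "\<not> compatible (UNIV :: 'v set) X p q"
proof -
  have "z \<in> limits (UNIV :: 'v set) X (simple - cell E (Node v) - cell E (Link a i u))"
    if z: "z \<in> limits (UNIV :: 'v set) X (cell E (Node v))" "z \<in> limits (UNIV :: 'v set) X (cell E (Link a i u))" for z
  proof -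
    have "z \<in> body E" using limits_topspace[of "UNIV :: 'v set" X] z(1) by auto
    then have "z \<in> limits (UNIV :: 'v set) X (\<Union>k\<in>-{i}. cell E (Link v k u))"
      by (rule limits_of_edge[OF uncountable_UNIV _ limits_cell_Node[OF z(1)] limits_cell_Link[OF z(2)] E])
    moreover have "(\<Union>k\<in>-{i}. cell E (Link v k u)) \<subseteq> simple - cell E (Node v) - cell E (Link a i u)"
    proof
      fix x assume "x \<in> (\<Union>k\<in>-{i}. cell E (Link v k u))"
      then obtain k where "k \<noteq> i" "x \<in> cell E (Link v k u)" by blast
      then show "x \<in> simple - cell E (Node v) - cell E (Link a i u)"
        using cell_simple cell_disjoint[of "Link v k u"] by blast
    qed
    ultimately show ?thesis using limits_mono by blast
  qed
  then show ?thesis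
    unfolding compatible_def class_cell[OF p] class_cell[OF q] by blast
qed

text \<open>
  The witness \<open>z\<close> has weight only on \<open>v\<close>, \<open>a\<close> and \<open>u\<close>, with the slack of \<open>Node a\<close> spent on the entry \<open>i\<close>. Its
  slack blocks are \<open>Node v\<close> and \<open>Link a i u\<close>, and consuming the former opens no block since \<open>v\<close> has no edge
  to \<open>u\<close>.
\<close>

lemma compatibleI:
  assumes p: "p \<in> cell E (Node v)" and q: "q \<in> cell E (Link a i u)" and nE: "\<not> E v u"
  shows "compatible (UNIV :: 'v set) X p q"
proof -
  have au: "E a u" using cell_Link_pos[OF q] by blast
  obtain w where vw: "E v w" using Node_slack_source[of p v] p by (auto simp: cell_def)
  have ne: "v \<noteq> a" "v \<noteq> u" "a \<noteq> u" "\<not> E u x" "\<not> E x v" "\<not> E x a" for x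
    using au nE vw no_path by blast+
  define z where "z = uniform_point {v, a, u} [a \<mapsto> i]"
  have z: "z \<in> body E" unfolding z_def by (rule uniform_point_body) (use au in \<open>auto split: if_splits\<close>)
  have s: "slacks E z = {Node v, Link a i u}"
    unfolding z_def by (subst slacks_uniform_point) (use au vw ne nE in \<open>auto split: if_splits\<close>)
  have r: "Root \<notin> slacks E z" using s by simp
  have zR: "z (Root, x) \<noteq> 0 \<longleftrightarrow> x \<in> {v, a, u}" for x by (simp add: z_def uniform_point_simps card_gt_0_iff)
  have zN: "z (Node x, j) \<noteq> 0 \<longleftrightarrow> x = a \<and> j = i" for x j
    by (auto simp: z_def uniform_point_simps card_gt_0_iff)
  have lim: "z \<in> limits (UNIV :: 'v set) X (cell E c)"
    if "\<And>k. slacks E (fill E {b} k z) = {c}" for b c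
  proof -
    have "range (\<lambda>k. fill E {b} k z) \<subseteq> cell E c"
      using that fill_body[OF z] by (auto simp: cell_def)
    then show ?thesis
      unfolding limits_def using fill_tends[OF uncountable_UNIV z, of "{b}"] by blast
  qed
  have "slacks E (fill E {Link a i u} k z) = {Node v}" for k
    using s unfolding slacks_def slack_fill[OF z]
    by (subst cap_fill_Links) (auto simp: set_eq_iff)
  then have 1: "z \<in> limits (UNIV :: 'v set) X (cell E (Node v))" by (rule lim)
  have "slacks E (fill E {Node v} k z) = {Link a i u}" for k
  proof -
    have "cap E c (fill E {Node v} k z) = cap E c z" for c
    proof (cases c)
      case (Link x j y)
      show ?thesis
      proof (cases "x = v \<and> E x y")
        case True
        then have y: "z (Root, y) = 0" using nE ne zR[of y] by auto
        have "z (Node v, j) = 0" using zN[of v j] ne by auto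
        moreover have "0 \<le> slack E (Node v) z" by (rule slack_nonneg[OF z])
        ultimately show ?thesis using True Link y by (simp add: fill_apply)
      qed (use Link in \<open>auto simp: fill_apply\<close>)
    qed (auto simp: fill_apply)
    then show ?thesis
      using s unfolding slacks_def slack_fill[OF z] by (auto simp: set_eq_iff)
  qed
  then have 2: "z \<in> limits (UNIV :: 'v set) X (cell E (Link a i u))" by (rule lim)
  have "z \<notin> limits (UNIV :: 'v set) X (simple - cell E (Node v) - cell E (Link a i u))"
  proof
    assume "z \<in> limits (UNIV :: 'v set) X (simple - cell E (Node v) - cell E (Link a i u))"
    then obtain y where y: "y \<in> simple - cell E (Node v) - cell E (Link a i u)" "extends E z y"
      by (rule limits_pick[OF _ countable_empty]) blast
    obtain c where c: "slacks E y = {c}" "c \<noteq> Node v" "c \<noteq> Link a i u" "y \<in> body E"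
      using y(1) unfolding simple_eq cell_def by blast
    have "c \<notin> slacks E z" using s c by auto
    then obtain a' j u' where c': "c = Link a' j u'" "Node a' \<in> slacks E z"
      using old_slack[OF y(2) r, of c] c(1) by blast
    then have "a' = v" using s by auto
    have "y \<in> cell E (Link a' j u')" using c c' by (simp add: cell_def)
    note pos = cell_Link_pos[OF this]
    have "z (Root, u') \<noteq> 0" using pos(2) old_Root[OF y(2) r, of u'] by simp
    then have "u' = u" using zR[of u'] pos(1) ne by auto
    then show False using pos(1) nE \<open>a' = v\<close> by blast
  qed
  then show ?thesis
    unfolding compatible_def class_cell[OF p] class_cell[OF q] using 1 2 by blast
qed

lemma compatible_iff:
  assumes "p \<in> cell E (Node v)" "q \<in> cell E (Link a i u)"
  shows "compatible (UNIV :: 'v set) X p q \<longleftrightarrow> \<not> E v u"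
  using not_compatible compatibleI assms by blast

lemma cell_Link_nonempty:
  assumes "E v u"
  shows "\<exists>k q. q \<in> cell E (Link v k u)"
proof -
  let ?z = "uniform_point {v, u} (\<lambda>_. None)"
  have z: "?z \<in> body E" by (rule uniform_point_body) auto
  have "slacks E ?z = {Node v}"
    by (subst slacks_uniform_point) (use assms no_path[OF assms] in auto)
  moreover have "0 < ?z (Root, u)" by (simp add: uniform_point_simps card_gt_0_iff)
  ultimately have "?z \<in> limits (UNIV :: 'v set) X (\<Union>k\<in>-{undefined}. cell E (Link v k u))"
    by (intro limits_of_edge[OF uncountable_UNIV z]) (use assms in auto)
  then show ?thesis by (rule limits_pick[OF _ countable_empty]) blast
qed

end

section \<open>A rigid coding of sets by digraphs\<close>

definition in_neighbourhoods :: "('v \<Rightarrow> 'v \<Rightarrow> bool) \<Rightarrow> 'v set set" where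
  "in_neighbourhoods E = {{v. E v u} |u. \<exists>a. E a u}"

text \<open>
  Sources correspond to classes of nodal points and in-neighbourhoods to terminal points: the set of
  \<open>v\<close> whose class is incompatible with a point of the class of \<open>Link a i u\<close> is the in-neighbourhood of
  \<open>u\<close>. The different \<open>Link\<close> classes with the same \<open>u\<close> do no harm, because they yield the same set.
\<close>

lemma homeomorphic_networks:
  fixes E E' :: "'v \<Rightarrow> 'v \<Rightarrow> bool"
  assumes "network E" "network E'"
    and hom: "homeomorphic_maps (body_topology E) (body_topology E') f g"
  obtains h where "bij_betw h {v. \<exists>u. E v u} {v. \<exists>u. E' v u}" "(`) h ` in_neighbourhoods E = in_neighbourhoods E'"
proof -
  interpret E: network E by fact
  interpret E': network E' by fact
  let ?N = "UNIV :: 'v set"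
  have fb: "f p \<in> body E'" if "p \<in> body E" for p using homeomorphic_facts(5)[OF hom, of p] that by simp
  have gb: "g p \<in> body E" "f (g p) = p" if "p \<in> body E'" for p
    using homeomorphic_facts(4,6)[OF hom, of p] that by simp_all
  have inj: "inj_on f (body E)"
    using homeomorphic_facts(3)[OF hom] by (intro inj_on_inverseI[of _ g]) simp
  have cb: "q \<in> body D" if "q \<in> cell D b" for q b and D :: "'v \<Rightarrow> 'v \<Rightarrow> bool" using that by (simp add: cell_def)
  define unit :: "'v \<Rightarrow> 'v block \<times> 'v \<Rightarrow> real" where "unit v = uniform_point {v} (\<lambda>_. None)" for v
  have unit: "unit v \<in> cell E (Node v)" if "\<exists>u. E v u" for v
    using E.unit_cell that unfolding unit_def by blast
  have "\<exists>w. f (unit v) \<in> cell E' (Node w)" if "\<exists>u. E v u" for v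
  proof -
    have b: "unit v \<in> body E" by (rule cb[OF unit[OF that]])
    have "nodal ?N (body_topology E) (unit v)" using E.nodal_iff[OF b] unit[OF that] by blast
    then have "nodal ?N (body_topology E') (f (unit v))" using nodal_image_iff[OF hom, of "unit v" ?N] b by simp
    then show ?thesis using E'.nodal_iff[OF fb[OF b]] by blast
  qed
  then obtain h where h: "\<And>v. \<exists>u. E v u \<Longrightarrow> f (unit v) \<in> cell E' (Node (h v))" by metis
  have im: "f ` cell E (Node v) = cell E' (Node (h v))" if v: "\<exists>u. E v u" for v
  proof -
    have "f ` joined_class ?N (body_topology E) (unit v) = joined_class ?N (body_topology E') (f (unit v))"
      using image_joined_class[OF hom, of "unit v"] cb[OF unit[OF v]] by simp
    then show ?thesis
      by (simp only: E.class_cell[OF unit[OF v]] E'.class_cell[OF h[OF v]])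
  qed
  have src: "\<exists>u. E' w u" if "p \<in> cell E' (Node w)" for p w
    using E'.Node_slack_source[of p w] that by (auto simp: cell_def)
  have onto: "\<exists>v. (\<exists>u. E v u) \<and> w = h v" if w: "\<exists>u. E' w u" for w
  proof -
    have y: "unit w \<in> cell E' (Node w)" using E'.unit_cell w unfolding unit_def by blast
    note yb = cb[OF y]
    have "nodal ?N (body_topology E') (unit w)" using E'.nodal_iff[OF yb] y by blast
    then have "nodal ?N (body_topology E) (g (unit w))"
      using nodal_image_iff[OF hom, of "g (unit w)" ?N] gb[OF yb] by simp
    then obtain v where v: "g (unit w) \<in> cell E (Node v)" using E.nodal_iff[OF gb(1)[OF yb]] by blast
    then have s: "\<exists>u. E v u" using E.Node_slack_source[of _ v] by (auto simp: cell_def)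
    have "unit w \<in> cell E' (Node (h v))"
      using im[OF s] v gb(2)[OF yb] by (metis image_eqI)
    then have "w = h v" using y by (auto simp: cell_def)
    then show ?thesis using s by blast
  qed
  have bij: "bij_betw h {v. \<exists>u. E v u} {v. \<exists>u. E' v u}"
    unfolding bij_betw_def
  proof
    show "inj_on h {v. \<exists>u. E v u}"
    proof (rule inj_onI)
      fix v w assume v: "v \<in> {v. \<exists>u. E v u}" and w: "w \<in> {v. \<exists>u. E v u}" and e: "h v = h w"
      have "f (unit v) \<in> f ` cell E (Node w)" using im[of w] w e h[of v] v by simp
      then have "unit v \<in> cell E (Node w)"
        using inj_on_image_mem_iff[OF inj, of "unit v" "cell E (Node w)"] cb[OF unit[of v]] v cb by blast
      then show "v = w" using unit[of v] v by (auto simp: cell_def)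
    qed
    show "h ` {v. \<exists>u. E v u} = {v. \<exists>u. E' v u}"
      using onto src h by blast
  qed
  have trace: "h ` {v. E v u} = {v. E' v u'}"
    if q: "q \<in> cell E (Link a i u)" and q': "f q \<in> cell E' (Link a' i' u')" for q a i u a' i' u'
  proof -
    have iff: "E v u \<longleftrightarrow> E' (h v) u'" if v: "\<exists>u. E v u" for v
    proof -
      have "compatible ?N (body_topology E') (f (unit v)) (f q) \<longleftrightarrow> compatible ?N (body_topology E) (unit v) q"
        by (rule compatible_image_iff[OF hom]) (use cb[OF unit[OF v]] cb[OF q] in simp_all)
      then show ?thesis
        using E.compatible_iff[OF unit[OF v] q] E'.compatible_iff[OF h[OF v] q'] by blast
    qed
    then show ?thesis using onto by blast
  qed
  have "(`) h ` in_neighbourhoods E = in_neighbourhoods E'"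
  proof
    show "(`) h ` in_neighbourhoods E \<subseteq> in_neighbourhoods E'"
    proof
      fix B assume "B \<in> (`) h ` in_neighbourhoods E"
      then obtain u a where B: "B = h ` {v. E v u}" "E a u" unfolding in_neighbourhoods_def by blast
      obtain k q where q: "q \<in> cell E (Link a k u)" using E.cell_Link_nonempty[OF B(2)] by blast
      have "terminal ?N (body_topology E) q" using E.terminal_iff[OF cb[OF q]] q by blast
      then have "terminal ?N (body_topology E') (f q)" using terminal_image_iff[OF hom, of q ?N] cb[OF q] by simp
      then obtain a' i' u' where q': "f q \<in> cell E' (Link a' i' u')"
        using E'.terminal_iff[OF fb[OF cb[OF q]]] by blast
      then show "B \<in> in_neighbourhoods E'"
        using trace[OF q q'] B cell_Link_pos(1)[OF q'] unfolding in_neighbourhoods_def by blast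
    qed
    show "in_neighbourhoods E' \<subseteq> (`) h ` in_neighbourhoods E"
    proof
      fix B assume "B \<in> in_neighbourhoods E'"
      then obtain u' a' where B: "B = {v. E' v u'}" "E' a' u'" unfolding in_neighbourhoods_def by blast
      obtain k y where y: "y \<in> cell E' (Link a' k u')" using E'.cell_Link_nonempty[OF B(2)] by blast
      note yb = cb[OF y]
      have "terminal ?N (body_topology E') y" using E'.terminal_iff[OF yb] y by blast
      then have "terminal ?N (body_topology E) (g y)"
        using terminal_image_iff[OF hom, of "g y" ?N] gb[OF yb] by simp
      then obtain a i u where q: "g y \<in> cell E (Link a i u)"
        using E.terminal_iff[OF gb(1)[OF yb]] by blast
      have "h ` {v. E v u} = B"
        using trace[OF q, of a' k u'] y gb(2)[OF yb] B by simp
      then show "B \<in> (`) h ` in_neighbourhoods E"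
        using cell_Link_pos(1)[OF q] unfolding in_neighbourhoods_def by blast
    qed
  qed
  with bij show thesis by (rule that)
qed

text \<open>
  The last component separates sources from sinks. The second one doubles the elements, so that the
  in-neighbourhoods of the sinks \<open>(b, False, True)\<close>, which are initial segments, are never singletons,
  whereas those of the sinks \<open>(b, True, True)\<close> have at most one element.
\<close>

definition coding_edge :: "'k rel \<Rightarrow> 'k set \<Rightarrow> 'k \<times> bool \<times> bool \<Rightarrow> 'k \<times> bool \<times> bool \<Rightarrow> bool" where
  "coding_edge r S v u \<longleftrightarrow> (case v of (a, x, s) \<Rightarrow> case u of (b, y, t) \<Rightarrow>
    \<not> s \<and> t \<and> (if y then x \<and> a = b \<and> a \<in> S else (a, b) \<in> r))"

lemma coding_edge_iff:
  "coding_edge r S (a, x, s) (b, y, t) \<longleftrightarrow> \<not> s \<and> t \<and> (if y then x \<and> a = b \<and> a \<in> S else (a, b) \<in> r)"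
  by (simp add: coding_edge_def)

definition down :: "'k rel \<Rightarrow> 'k \<Rightarrow> ('k \<times> bool \<times> bool) set" where
  "down r b = {(a, x, False) |a x. (a, b) \<in> r}"

context
  fixes r :: "'k rel"
  assumes wo: "well_order_on UNIV r"
begin

lemma well_order_facts:
  "(a, a) \<in> r" "(a, b) \<in> r \<Longrightarrow> (b, c) \<in> r \<Longrightarrow> (a, c) \<in> r" "(a, b) \<in> r \<Longrightarrow> (b, a) \<in> r \<Longrightarrow> a = b"
  "(a, b) \<in> r \<or> (b, a) \<in> r" "wf (r - Id)"
proof -
  have l: "refl r" "trans r" "antisym r" "total r" and w: "wf (r - Id)"
    using wo by (auto simp: well_order_on_def linear_order_on_def partial_order_on_def preorder_on_def)
  show "(a, a) \<in> r" using l(1) by (simp add: refl_on_def)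
  then show "(a, b) \<in> r \<or> (b, a) \<in> r" using l(4) by (cases "a = b") (auto simp: total_on_def)
  show "(a, b) \<in> r \<Longrightarrow> (b, c) \<in> r \<Longrightarrow> (a, c) \<in> r" using l(2) by (rule transD)
  show "(a, b) \<in> r \<Longrightarrow> (b, a) \<in> r \<Longrightarrow> a = b" using l(3) by (rule antisymD)
  show "wf (r - Id)" by (rule w)
qed

lemma coding_sources: "{v. \<exists>u. coding_edge r S v u} = {(a, x, False) |a x. True}"
proof (rule set_eqI)
  fix v :: "'k \<times> bool \<times> bool"
  obtain a x s where v: "v = (a, x, s)" by (metis prod_cases3)
  have "coding_edge r S (a, x, False) (a, False, True)" by (simp add: coding_edge_iff well_order_facts(1))
  then show "v \<in> {v. \<exists>u. coding_edge r S v u} \<longleftrightarrow> v \<in> {(a, x, False) |a x. True}"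
    using v by (auto simp: coding_edge_def)
qed

lemma coding_network:
  assumes "uncountable (UNIV :: 'k set)"
  shows "network (coding_edge r S)"
proof
  show "uncountable {v. \<exists>u. coding_edge r S v u}"
  proof
    assume c: "countable {v. \<exists>u. coding_edge r S v u}"
    have "UNIV \<subseteq> fst ` {v. \<exists>u. coding_edge r S v u}"
      unfolding coding_sources by force
    then show False using c assms countable_subset countable_image by blast
  qed
  show "coding_edge r S v u \<Longrightarrow> \<not> coding_edge r S u w" for v u w
    by (auto simp: coding_edge_def split: prod.splits)
qed

lemma down_in_neighbours: "{v. coding_edge r S v (b, False, True)} = down r b"
  by (auto simp: down_def coding_edge_def)

lemma singleton_in_neighbours: "b \<in> S \<Longrightarrow> {v. coding_edge r S v (b, True, True)} = {(b, True, False)}"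
  by (auto simp: coding_edge_def)

lemma in_neighbourhoods_coding_edge: "in_neighbourhoods (coding_edge r S) = range (down r) \<union> (\<lambda>b. {(b, True, False)}) ` S"
proof
  show "in_neighbourhoods (coding_edge r S) \<subseteq> range (down r) \<union> (\<lambda>b. {(b, True, False)}) ` S"
  proof
    fix A assume "A \<in> in_neighbourhoods (coding_edge r S)"
    then obtain u a where A: "A = {v. coding_edge r S v u}" "coding_edge r S a u" unfolding in_neighbourhoods_def by blast
    obtain b y t where u: "u = (b, y, t)" by (metis prod_cases3)
    have t: t "y \<Longrightarrow> b \<in> S" using A(2) u by (auto simp: coding_edge_def split: prod.splits if_splits)
    show "A \<in> range (down r) \<union> (\<lambda>b. {(b, True, False)}) ` S"
    proof (cases y)
      case True
      then show ?thesis using A(1) u t singleton_in_neighbours[of b S] by auto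
    next
      case False
      then show ?thesis using A(1) u t down_in_neighbours[of S b] by auto
    qed
  qed
  have "down r b \<in> in_neighbourhoods (coding_edge r S)" for b
  proof -
    have "coding_edge r S (b, True, False) (b, False, True)" by (simp add: coding_edge_iff well_order_facts(1))
    then show ?thesis unfolding in_neighbourhoods_def down_in_neighbours[of S b, symmetric] by blast
  qed
  moreover have "{(b, True, False)} \<in> in_neighbourhoods (coding_edge r S)" if "b \<in> S" for b
  proof -
    have "coding_edge r S (b, True, False) (b, True, True)" using that by (simp add: coding_edge_iff)
    then show ?thesis unfolding in_neighbourhoods_def singleton_in_neighbours[OF that, symmetric] by blast
  qed
  ultimately show "range (down r) \<union> (\<lambda>b. {(b, True, False)}) ` S \<subseteq> in_neighbourhoods (coding_edge r S)"
    by blast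
qed

lemma down_mem: "(a, x, False) \<in> down r b \<longleftrightarrow> (a, b) \<in> r"
  by (auto simp: down_def)

lemma down_mono: "down r a \<subseteq> down r b \<longleftrightarrow> (a, b) \<in> r"
proof
  assume "down r a \<subseteq> down r b"
  then show "(a, b) \<in> r" using down_mem[of a True a] down_mem[of a True b] well_order_facts(1)[of a] by blast
next
  assume "(a, b) \<in> r"
  then show "down r a \<subseteq> down r b" by (auto simp: down_def intro: well_order_facts(2))
qed

lemma down_not_singleton: "down r b \<noteq> {v}"
proof
  assume d: "down r b = {v}"
  have "(b, True, False) \<in> down r b" "(b, False, False) \<in> down r b" by (simp_all add: down_mem well_order_facts(1))
  then show False unfolding d by auto
qed

text \<open>
  Among the in-neighbourhoods the initial segments are the sets with more than one element. So \<open>h\<close>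
  permutes them and induces an automorphism of the well-order, which is the identity. Therefore \<open>h\<close>
  preserves the pair of copies of each element, and a singleton within a pair goes to one in the same pair.
\<close>

lemma in_neighbourhoods_determine:
  assumes bij: "bij_betw h {(a, x, False) |a x. True} {(a, x, False) |a x. True}"
    and tr: "(`) h ` in_neighbourhoods (coding_edge r S) = in_neighbourhoods (coding_edge r S')"
  shows "S \<subseteq> S'"
proof -
  let ?A = "{(a, x, False) |a x. True} :: ('k \<times> bool \<times> bool) set"
  have inj: "inj_on h ?A" using bij by (rule bij_betw_imp_inj_on)
  have sub: "down r b \<subseteq> ?A" for b by (auto simp: down_def)
  have trI: "h ` A \<in> in_neighbourhoods (coding_edge r S')" if "A \<in> in_neighbourhoods (coding_edge r S)" for A
    using imageI[OF that, of "(`) h"] by (simp only: tr)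
  have "\<exists>c. h ` down r b = down r c" for b
  proof -
    have "h ` down r b \<in> in_neighbourhoods (coding_edge r S')" by (rule trI) (simp add: in_neighbourhoods_coding_edge)
    moreover have "h ` down r b \<noteq> {w}" for w
    proof
      assume e: "h ` down r b = {w}"
      have "h (b, x, False) \<in> {w}" for x
        unfolding e[symmetric] by (rule imageI) (simp add: down_mem well_order_facts(1))
      from this[of True] this[of False] have "h (b, True, False) = h (b, False, False)" by simp
      then have "(b, True, False) = (b, False, False)" by (rule inj_onD[OF inj]) auto
      then show False by simp
    qed
    ultimately show ?thesis unfolding in_neighbourhoods_coding_edge by blast
  qed
  then obtain m where m: "\<And>b. h ` down r b = down r (m b)" by metis
  have mono: "(m a, m b) \<in> r \<longleftrightarrow> (a, b) \<in> r" for a b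
    using inj_on_image_subset_iff[OF inj sub sub, of a b] by (simp add: m down_mono)
  have surj: "\<exists>c. m c = b" for b
  proof -
    have "down r b \<in> (`) h ` in_neighbourhoods (coding_edge r S)" unfolding tr by (simp add: in_neighbourhoods_coding_edge)
    then obtain A where A: "A \<in> in_neighbourhoods (coding_edge r S)" "down r b = h ` A" by blast
    have "A \<noteq> {v}" for v
    proof
      assume "A = {v}"
      then have "down r b = {h v}" unfolding A(2) by (simp only: image_insert image_empty)
      then show False by (rule notE[OF down_not_singleton])
    qed
    then obtain c where "A = down r c" using A(1) unfolding in_neighbourhoods_coding_edge by blast
    then have "down r b = down r (m c)" using A(2) m by simp
    then have "m c = b" using down_mono[of b "m c"] down_mono[of "m c" b] well_order_facts(3)[of b "m c"] by simp
    then show ?thesis by blast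
  qed
  have m_id: "m b = b" for b
  proof (induction b rule: wf_induct_rule[OF well_order_facts(5)])
    case (1 b)
    obtain c where c: "m c = b" using surj by blast
    have le: "(b, c) \<in> r"
    proof (rule ccontr)
      assume n: "(b, c) \<notin> r"
      have "(c, b) \<in> r" "c \<noteq> b" using n well_order_facts(4)[of b c] well_order_facts(1)[of b] by blast+
      then have "m c = c" by (intro 1) simp
      then show False using c \<open>c \<noteq> b\<close> by simp
    qed
    then have "(m b, b) \<in> r" using mono[of b c] c by simp
    moreover have "m b = b" if "(m b, b) \<in> r - Id"
    proof -
      have "m (m b) = m b" by (rule 1[OF that])
      then have "(b, m b) \<in> r" using mono[of b "m b"] well_order_facts(1)[of "m b"] by simp
      then show ?thesis using that well_order_facts(3)[of "m b" b] by simp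
    qed
    ultimately show ?case by blast
  qed
  show ?thesis
  proof
    fix b assume "b \<in> S"
    then have "h ` {(b, True, False)} \<in> in_neighbourhoods (coding_edge r S')" by (intro trI) (simp add: in_neighbourhoods_coding_edge)
    then have "{h (b, True, False)} \<in> in_neighbourhoods (coding_edge r S')" by simp
    then obtain c where c: "h (b, True, False) = (c, True, False)" "c \<in> S'"
      unfolding in_neighbourhoods_coding_edge using down_not_singleton by blast
    have d: "h ` down r a = down r a" for a using m[of a] m_id[of a] by simp
    have "(c, True, False) \<in> down r b"
      using d[of b] down_mem[of b True b] well_order_facts(1)[of b] c(1) by (metis image_eqI)
    then have cb: "(c, b) \<in> r" by (simp add: down_mem)
    have "(c, True, False) \<in> h ` down r c" using d[of c] down_mem[of c True c] well_order_facts(1)[of c] by simp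
    then have "(b, True, False) \<in> down r c"
      using inj_on_image_mem_iff[OF inj _ sub, of "(b, True, False)" c] c(1) by auto
    then have "(b, c) \<in> r" by (simp add: down_mem)
    then show "b \<in> S'" using well_order_facts(3)[OF cb] c(2) by simp
  qed
qed

end

section \<open>Bodies as weakly compact subsets of the Hilbert space\<close>

lift_definition ell2_unit :: "'k \<Rightarrow> 'k ell2" is "\<lambda>i j. if j = i then 1 else 0"
proof -
  fix i :: 'k
  have "((\<lambda>j. if j = i then 1 else 0) has_sum (1::real)) UNIV" by (rule single_has_sum)
  moreover have "(\<lambda>j. (if j = i then 1 else 0 :: real)\<^sup>2) = (\<lambda>j. if j = i then 1 else 0)" by auto
  ultimately show "(\<lambda>j. (if j = i then 1 else 0 :: real)\<^sup>2) summable_on UNIV"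
    by (metis has_sum_imp_summable)
qed

lemma inner_ell2_unit: "ell2_unit i \<bullet> x = ell2_nth x i"
proof transfer
  fix i :: 'a and f :: "'a \<Rightarrow> real"
  have "(\<lambda>j. (if j = i then 1 else 0) * f j) = (\<lambda>j. if j = i then f i else 0)" by auto
  then show "(\<Sum>\<^sub>\<infinity>j. (if j = i then 1 else 0) * f j) = f i"
    using infsumI[OF single_has_sum[of i "f i"]] by simp
qed

lemma ell2_nth_unit: "ell2_nth (ell2_unit i) j = (if j = i then 1 else 0)"
  by transfer simp

lemma nth_combination:
  assumes "finite F"
  shows "ell2_nth (\<Sum>i\<in>F. a i *\<^sub>R ell2_unit i) j = (if j \<in> F then a j else 0)"
proof -
  have "ell2_nth (\<Sum>i\<in>F. a i *\<^sub>R ell2_unit i) j = ell2_unit j \<bullet> (\<Sum>i\<in>F. a i *\<^sub>R ell2_unit i)"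
    by (simp only: inner_ell2_unit)
  also have "\<dots> = (\<Sum>i\<in>F. a i * (if j = i then 1 else 0))"
    by (simp add: inner_sum_right inner_ell2_unit ell2_nth_unit)
  also have "\<dots> = (\<Sum>i\<in>F. if j = i then a i else 0)"
    by (rule sum.cong) auto
  also have "\<dots> = (if j \<in> F then a j else 0)"
    using assms by simp
  finally show ?thesis .
qed

definition truncate :: "'k set \<Rightarrow> 'k ell2 \<Rightarrow> 'k ell2" where
  "truncate F x = (\<Sum>i\<in>F. ell2_nth x i *\<^sub>R ell2_unit i)"

lemma inner_truncate: "truncate F x \<bullet> y = (\<Sum>i\<in>F. ell2_nth x i * ell2_nth y i)"
  by (simp add: truncate_def inner_sum_left inner_ell2_unit)

lemma nth_truncate: "finite F \<Longrightarrow> ell2_nth (truncate F x) j = (if j \<in> F then ell2_nth x j else 0)"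
  by (simp add: truncate_def nth_combination)

lemma norm_truncate_diff:
  assumes "finite F"
  shows "(norm (x - truncate F x))\<^sup>2 = (norm x)\<^sup>2 - (\<Sum>i\<in>F. (ell2_nth x i)\<^sup>2)"
proof -
  have 1: "truncate F x \<bullet> x = (\<Sum>i\<in>F. (ell2_nth x i)\<^sup>2)"
    by (simp add: inner_truncate power2_eq_square)
  have 2: "truncate F x \<bullet> truncate F x = (\<Sum>i\<in>F. (ell2_nth x i)\<^sup>2)"
    unfolding inner_truncate by (rule sum.cong) (simp_all add: nth_truncate assms power2_eq_square)
  have "(norm (x - truncate F x))\<^sup>2 = x \<bullet> x - 2 * (truncate F x \<bullet> x) + truncate F x \<bullet> truncate F x"
    by (simp add: power2_norm_eq_inner inner_diff_left inner_diff_right inner_commute)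
  then show ?thesis by (simp add: 1 2 power2_norm_eq_inner)
qed

lemma truncate_tendsto:
  "((\<lambda>F. norm (x - truncate F x)) \<longlongrightarrow> 0) (finite_subsets_at_top UNIV)"
proof -
  have "((\<lambda>i. (ell2_nth x i)\<^sup>2) has_sum (norm x)\<^sup>2) UNIV"
    unfolding norm_ell2_square by (rule has_sum_infsum) (rule summable_ell2_nth)
  then have "((\<lambda>F. (norm x)\<^sup>2 - (\<Sum>i\<in>F. (ell2_nth x i)\<^sup>2)) \<longlongrightarrow> (norm x)\<^sup>2 - (norm x)\<^sup>2) (finite_subsets_at_top UNIV)"
    unfolding has_sum_def by (intro tendsto_intros)
  then have "((\<lambda>F. (norm x)\<^sup>2 - (\<Sum>i\<in>F. (ell2_nth x i)\<^sup>2)) \<longlongrightarrow> 0) (finite_subsets_at_top UNIV)"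
    by simp
  then have "((\<lambda>F. (norm (x - truncate F x))\<^sup>2) \<longlongrightarrow> 0) (finite_subsets_at_top UNIV)"
    by (rule Lim_transform_eventually)
      (auto simp: norm_truncate_diff intro!: eventually_finite_subsets_at_top_weakI)
  from tendsto_real_sqrt[OF this] show ?thesis by simp
qed

text \<open>
  The values of \<open>f\<close> on the unit vectors are square summable, as testing \<open>f\<close> on finite combinations with
  these very coefficients shows.
\<close>

lemma ell2_riesz:
  assumes f: "bounded_linear (f :: 'k ell2 \<Rightarrow> real)"
  obtains y where "\<And>x. f x = y \<bullet> x"
proof -
  interpret f: bounded_linear f by (rule f)
  define a where "a i = f (ell2_unit i)" for i
  obtain K where K: "0 \<le> K" "\<And>x. norm (f x) \<le> norm x * K" using f.nonneg_bounded by blast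
  have sq: "(\<Sum>i\<in>F. (a i)\<^sup>2) \<le> K\<^sup>2" if F: "finite F" for F
  proof -
    define x where "x = (\<Sum>i\<in>F. a i *\<^sub>R ell2_unit i)"
    define s where "s = (\<Sum>i\<in>F. (a i)\<^sup>2)"
    have fx: "f x = s" by (simp add: x_def s_def f.sum f.scaleR a_def[symmetric] power2_eq_square)
    have nth: "ell2_nth x j = (if j \<in> F then a j else 0)" for j
      using F by (simp add: x_def nth_combination)
    have "x \<bullet> x = (\<Sum>i\<in>F. a i * ell2_nth x i)"
      by (subst (1) x_def) (simp add: inner_sum_left inner_ell2_unit)
    also have "\<dots> = s" unfolding s_def by (rule sum.cong) (simp_all add: nth power2_eq_square)
    finally have nx: "(norm x)\<^sup>2 = s" by (simp add: power2_norm_eq_inner)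
    have "s \<le> norm x * K" using K(2)[of x] fx by simp
    then have "(norm x) * (norm x) \<le> norm x * K" using nx by (simp add: power2_eq_square)
    then have "norm x \<le> K" using K(1) by (cases "norm x = 0") auto
    then have "(norm x)\<^sup>2 \<le> K\<^sup>2" by (intro power_mono) auto
    then show ?thesis using nx s_def by simp
  qed
  have "(\<lambda>i. (a i)\<^sup>2) summable_on UNIV"
    by (rule nonneg_bounded_partial_sums_imp_summable_on[where C = "K\<^sup>2"])
      (auto intro!: eventually_finite_subsets_at_top_weakI sq)
  then have y: "ell2_nth (Abs_ell2 a) = a" by (simp add: Abs_ell2_inverse)
  define y where "y = Abs_ell2 a"
  have yn: "ell2_nth y i = a i" for i using y by (simp add: y_def)
  have "f x = y \<bullet> x" for x
  proof -
    have t: "f (truncate F x) = y \<bullet> truncate F x" for F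
      by (simp add: inner_commute[of y] inner_truncate yn)
        (simp add: truncate_def f.sum f.scaleR a_def)
    have "((\<lambda>F :: 'k set. f x - y \<bullet> x) \<longlongrightarrow> 0) (finite_subsets_at_top UNIV)"
    proof (rule Lim_null_comparison)
      show "\<forall>\<^sub>F F in finite_subsets_at_top UNIV. norm (f x - y \<bullet> x) \<le> norm (x - truncate F x) * K + norm y * norm (x - truncate F x)"
      proof (rule always_eventually, rule allI)
        fix F
        have "f x - y \<bullet> x = f (x - truncate F x) - y \<bullet> (x - truncate F x)"
          by (simp add: f.diff inner_diff_right t)
        moreover have "norm (f (x - truncate F x) - y \<bullet> (x - truncate F x))
            \<le> norm (f (x - truncate F x)) + norm (y \<bullet> (x - truncate F x))"
          by (rule norm_triangle_ineq4)
        ultimately show "norm (f x - y \<bullet> x) \<le> norm (x - truncate F x) * K + norm y * norm (x - truncate F x)"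
          using K(2)[of "x - truncate F x"] Cauchy_Schwarz_ineq2[of y "x - truncate F x"] by simp
      qed
      have "((\<lambda>F. norm (x - truncate F x) * K + norm y * norm (x - truncate F x)) \<longlongrightarrow> 0 * K + norm y * 0) (finite_subsets_at_top UNIV)"
        by (intro tendsto_intros truncate_tendsto)
      then show "((\<lambda>F. norm (x - truncate F x) * K + norm y * norm (x - truncate F x)) \<longlongrightarrow> 0) (finite_subsets_at_top UNIV)"
        by simp
    qed
    then have "f x - y \<bullet> x = 0"
      using tendsto_unique[OF finite_subsets_at_top_neq_bot tendsto_const] by blast
    then show ?thesis by simp
  qed
  then show thesis by (rule that)
qed

lemma continuous_weak_functional:
  assumes "bounded_linear (f :: 'a::real_normed_vector \<Rightarrow> real)"
  shows "continuous_map weak_topology euclideanreal f"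
  unfolding continuous_map_def
proof (intro conjI allI impI)
  have *: "openin (weak_topology :: 'a topology) (f -` U)" if "open U" for U
    unfolding weak_topology_def by (rule topology_generated_by_Basis) (use assms that in blast)
  then show "openin weak_topology {x \<in> topspace (weak_topology :: 'a topology). f x \<in> U}"
    if "openin euclideanreal U" for U
  proof -
    have "topspace (weak_topology :: 'a topology) = UNIV"
      using openin_subset[OF *[OF open_UNIV]] by auto
    then show ?thesis using *[of U] that by (simp add: vimage_def)
  qed
qed simp

context
  fixes j :: "'k \<Rightarrow> 'v block \<times> 'v" and E :: "'v \<Rightarrow> 'v \<Rightarrow> bool"
  assumes j: "bij j"
begin

definition embed :: "('v block \<times> 'v \<Rightarrow> real) \<Rightarrow> 'k ell2" where
  "embed z = Abs_ell2 (z \<circ> j)"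

lemma nth_embed:
  assumes "z \<in> body E" shows "ell2_nth (embed z) i = z (j i)"
proof -
  have "(\<lambda>i. (z (j i))\<^sup>2) summable_on UNIV"
    using summable_on_reindex_bij_betw[OF j, of "\<lambda>c. (z c)\<^sup>2"] body_square_summable[OF assms] by simp
  then show ?thesis by (simp add: embed_def Abs_ell2_inverse)
qed

lemma norm_embed:
  assumes "z \<in> body E" shows "norm (embed z) \<le> 2"
proof -
  have "(norm (embed z))\<^sup>2 = (\<Sum>\<^sub>\<infinity>i. (z (j i))\<^sup>2)"
    by (simp add: norm_ell2_square nth_embed[OF assms])
  also have "\<dots> = (\<Sum>\<^sub>\<infinity>c. (z c)\<^sup>2)"
    using infsum_reindex_bij_betw[OF j, of "\<lambda>c. (z c)\<^sup>2"] by simp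
  also have "\<dots> \<le> 3"
    by (rule infsum_le_finite_sums) (auto intro: body_square_summable[OF assms] body_square_sum_le[OF assms])
  finally have "(norm (embed z))\<^sup>2 \<le> 2\<^sup>2" by simp
  then show ?thesis by (rule power2_le_imp_le) simp
qed

text \<open>
  On a bounded set a functional is the uniform limit of finite sums of coordinates.
\<close>

lemma continuous_functional_embed:
  assumes "bounded_linear (f :: 'k ell2 \<Rightarrow> real)"
  shows "continuous_on (body E) (\<lambda>z. f (embed z))"
proof -
  obtain y where y: "\<And>x. f x = y \<bullet> x" using ell2_riesz[OF assms] by blast
  have "uniform_limit (body E) (\<lambda>F z. \<Sum>i\<in>F. ell2_nth y i * z (j i)) (\<lambda>z. f (embed z)) (finite_subsets_at_top UNIV)"
  proof (rule uniform_limitI)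
    fix e :: real assume e: "0 < e"
    have "\<forall>\<^sub>F F in finite_subsets_at_top UNIV. norm (y - truncate F y) < e / 2"
      by (rule order_tendstoD(2)[OF truncate_tendsto]) (use e in simp)
    then show "\<forall>\<^sub>F F in finite_subsets_at_top UNIV. \<forall>z\<in>body E. dist (\<Sum>i\<in>F. ell2_nth y i * z (j i)) (f (embed z)) < e"
    proof (rule eventually_mono, intro ballI)
      fix F z assume F: "norm (y - truncate F y) < e / 2" and z: "z \<in> body E"
      have "f (embed z) - (\<Sum>i\<in>F. ell2_nth y i * z (j i)) = (y - truncate F y) \<bullet> embed z"
        by (simp add: y inner_diff_left inner_truncate nth_embed[OF z])
      then have "dist (\<Sum>i\<in>F. ell2_nth y i * z (j i)) (f (embed z)) = \<bar>(y - truncate F y) \<bullet> embed z\<bar>"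
        by (simp add: dist_real_def abs_minus_commute)
      also have "\<dots> \<le> norm (y - truncate F y) * norm (embed z)" by (rule Cauchy_Schwarz_ineq2)
      also have "\<dots> \<le> norm (y - truncate F y) * 2" by (intro mult_left_mono norm_embed[OF z]) simp
      also have "\<dots> < e" using F by simp
      finally show "dist (\<Sum>i\<in>F. ell2_nth y i * z (j i)) (f (embed z)) < e" .
    qed
  qed
  then show ?thesis
    by (rule uniform_limit_theorem[rotated])
      (auto intro!: always_eventually continuous_intros continuous_on_coord)
qed

definition unembed :: "'k ell2 \<Rightarrow> 'v block \<times> 'v \<Rightarrow> real" where
  "unembed x c = ell2_nth x (inv j c)"

lemma unembed_embed: "z \<in> body E \<Longrightarrow> unembed (embed z) = z"
  by (simp add: unembed_def fun_eq_iff nth_embed surj_f_inv_f[OF bij_is_surj[OF j]])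

lemma embed_homeomorphic:
  "homeomorphic_maps (body_topology E) (subtopology weak_topology (embed ` body E)) embed unembed"
  unfolding homeomorphic_maps_def
proof (intro conjI)
  have "continuous_map (body_topology E) weak_topology embed"
    unfolding weak_topology_def
  proof (rule continuous_on_generated_topo)
    fix V assume "V \<in> {f -` U |(f :: 'k ell2 \<Rightarrow> real) U. bounded_linear f \<and> open U}"
    then obtain f U where V: "V = f -` U" "bounded_linear (f :: 'k ell2 \<Rightarrow> real)" "open U" by blast
    have "openin (body_topology E) (body E \<inter> (\<lambda>z. f (embed z)) -` U)"
      by (rule continuous_openin_preimage_gen[OF continuous_functional_embed[OF V(2)] V(3)])
    moreover have "embed -` V \<inter> topspace (body_topology E) = body E \<inter> (\<lambda>z. f (embed z)) -` U"
      unfolding V(1) by auto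
    ultimately show "openin (body_topology E) (embed -` V \<inter> topspace (body_topology E))" by simp
  next
    have "UNIV \<in> {f -` U |(f :: 'k ell2 \<Rightarrow> real) U. bounded_linear f \<and> open U}"
      by (rule CollectI, rule exI[of _ "\<lambda>_. 0"], rule exI[of _ UNIV]) (simp add: bounded_linear_zero)
    then show "embed ` topspace (body_topology E) \<subseteq> \<Union> {f -` U |(f :: 'k ell2 \<Rightarrow> real) U. bounded_linear f \<and> open U}"
      by blast
  qed
  then show "continuous_map (body_topology E) (subtopology weak_topology (embed ` body E)) embed"
    by (simp add: continuous_map_in_subtopology)
  have "continuous_map weak_topology euclidean unembed"
    unfolding euclidean_product_topology[symmetric] continuous_map_componentwise_UNIV
  proof
    fix c
    have "bounded_linear (\<lambda>x :: 'k ell2. ell2_unit (inv j c) \<bullet> x)" by (rule bounded_linear_inner_right)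
    then show "continuous_map weak_topology euclideanreal (\<lambda>x. unembed x c)"
      using continuous_weak_functional by (simp add: inner_ell2_unit unembed_def)
  qed
  then show "continuous_map (subtopology weak_topology (embed ` body E)) (body_topology E) unembed"
    by (auto simp: continuous_map_in_subtopology unembed_embed intro: continuous_map_from_subtopology)
  show "\<forall>x\<in>topspace (body_topology E). unembed (embed x) = x" by (simp add: unembed_embed)
  show "\<forall>y\<in>topspace (subtopology weak_topology (embed ` body E)). embed (unembed y) = y"
    by (auto simp: unembed_embed)
qed

lemma convex_embed: "convex (embed ` body E)"
proof (rule convexI)
  fix x y and u v :: real
  assume "x \<in> embed ` body E" "y \<in> embed ` body E" and uv: "0 \<le> u" "0 \<le> v" "u + v = 1"
  then obtain p q where pq: "p \<in> body E" "q \<in> body E" "x = embed p" "y = embed q" by blast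
  have v: "0 \<le> v" "v \<le> 1" "u = 1 - v" using uv by auto
  have s: "segment_point p q v \<in> body E" by (rule segment_body[OF pq(1,2) v(1,2)])
  have "ell2_nth (u *\<^sub>R x + v *\<^sub>R y) = ell2_nth (embed (segment_point p q v))"
    by (rule ext) (simp only: plus_ell2.rep_eq scaleR_ell2.rep_eq nth_embed[OF s] pq(3,4) nth_embed[OF pq(1)]
        nth_embed[OF pq(2)] v(3), simp only: segment_point_def)
  then have "u *\<^sub>R x + v *\<^sub>R y = embed (segment_point p q v)" by (simp add: ell2_nth_inject)
  then show "u *\<^sub>R x + v *\<^sub>R y \<in> embed ` body E" using s by blast
qed

end

lemma compact_body: "compact (body E)"
proof -
  have "closed (body E)"
  proof -
    have "body E = (\<Inter>c. {z. 0 \<le> z c}) \<inter> (\<Inter>b. \<Inter>F\<in>Collect finite. {z. (\<Sum>i\<in>F. z (b, i)) \<le> cap E b z})"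
      by (auto simp: body_def)
    moreover have "closed {z :: 'a block \<times> 'a \<Rightarrow> real. 0 \<le> z c}" for c
      by (intro closed_Collect_le continuous_on_const continuous_on_coord)
    moreover have "closed {z. (\<Sum>i\<in>F. z (b, i)) \<le> cap E b z}" for b and F :: "'a set"
      by (intro closed_Collect_le continuous_on_sum continuous_on_coord continuous_on_cap)
    ultimately show ?thesis by (auto intro!: closed_Int closed_INT)
  qed
  moreover have "compact (Pi\<^sub>E UNIV (\<lambda>_ :: 'a block \<times> 'a. {0..1::real}))"
    using compactin_PiE[of "\<lambda>_. euclideanreal" "UNIV :: ('a block \<times> 'a) set" "\<lambda>_. {0..1}"]
    by (simp add: euclidean_product_topology)
  moreover have "body E \<subseteq> Pi\<^sub>E UNIV (\<lambda>_ :: 'a block \<times> 'a. {0..1::real})"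
    by (auto simp: PiE_iff intro: body_nonneg body_le_1)
  ultimately show ?thesis using closed_Int_compact by (metis inf.absorb1)
qed

lemma base_of_homeomorphic:
  assumes hom: "homeomorphic_maps X Y f g" and B: "base_of X \<B>"
  shows "base_of Y ((`) f ` \<B>)"
  unfolding base_of_def
proof (intro conjI ballI allI impI)
  have f: "homeomorphic_map X Y f" using hom homeomorphic_map_maps by blast
  show "openin Y V" if "V \<in> (`) f ` \<B>" for V
    using that B homeomorphic_map_openness_eq[OF f] unfolding base_of_def
    by (metis (no_types, lifting) f homeomorphic_map_openness imageE openin_subset)
  fix U y assume U: "openin Y U \<and> y \<in> U"
  let ?U = "{x \<in> topspace X. f x \<in> U}"
  have yY: "y \<in> topspace Y" using U openin_subset by blast
  have "openin X ?U" using U hom by (auto simp: homeomorphic_maps_def continuous_map_def)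
  moreover have "g y \<in> ?U" using yY U hom by (auto simp: homeomorphic_maps_def continuous_map_def)
  ultimately obtain V where V: "V \<in> \<B>" "g y \<in> V" "V \<subseteq> ?U" using B unfolding base_of_def by blast
  show "\<exists>V\<in>(`) f ` \<B>. y \<in> V \<and> V \<subseteq> U"
  proof (rule bexI[of _ "f ` V"])
    have "f (g y) = y" using yY hom by (simp add: homeomorphic_maps_def)
    then show "y \<in> f ` V \<and> f ` V \<subseteq> U" using V(2,3) by force
  qed (use V(1) in blast)
qed

lemma has_weight_homeomorphic:
  assumes hom: "homeomorphic_maps X Y f g" and w: "has_weight X r"
  shows "has_weight Y r"
  unfolding has_weight_def
proof (intro conjI allI impI)
  have lower: "r \<le>o |\<B>|" if "base_of Y \<B>" for \<B>
  proof -
    have "base_of X ((`) g ` \<B>)"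
      by (rule base_of_homeomorphic[OF homeomorphic_maps_sym[THEN iffD1, OF hom] that])
    then have "r \<le>o |(`) g ` \<B>|" using w by (simp add: has_weight_def)
    then show ?thesis using card_of_image ordLeq_transitive by blast
  qed
  then show "r \<le>o |\<B>|" if "base_of Y \<B>" for \<B> using that .
  obtain \<B> where B: "base_of X \<B>" "|\<B>| =o r" using w unfolding has_weight_def by blast
  have b: "base_of Y ((`) f ` \<B>)" by (rule base_of_homeomorphic[OF hom B(1)])
  have "|(`) f ` \<B>| \<le>o |\<B>|" by (rule card_of_image)
  then have "|(`) f ` \<B>| \<le>o r" using B(2) ordLeq_ordIso_trans by blast
  then have "|(`) f ` \<B>| =o r" using lower[OF b] by (simp add: ordIso_iff_ordLeq)
  then show "\<exists>\<B>. base_of Y \<B> \<and> |\<B>| =o r" using b by blast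
qed

section \<open>Weight and cardinality\<close>

lemma card_of_countable_le:
  assumes "infinite C" "countable A"
  shows "|A| \<le>o |C|"
proof -
  obtain f :: "_ \<Rightarrow> nat" where "inj_on f A" using assms(2) by (rule countableE)
  then have "|A| \<le>o |UNIV :: nat set|" by (intro card_of_ordLeq[THEN iffD1]) blast
  then show ?thesis using assms(1) ordLeq_transitive by (auto simp: infinite_iff_card_of_nat)
qed

lemma card_of_Times_le:
  "infinite C \<Longrightarrow> |A| \<le>o |C| \<Longrightarrow> |B| \<le>o |C| \<Longrightarrow> |A \<times> B| \<le>o |C|"
  by (rule card_of_Sigma_ordLeq_infinite) auto

lemma card_of_list_le:
  assumes C: "infinite C" and le: "|UNIV :: 'a set| \<le>o |C|"
  shows "|UNIV :: 'a list set| \<le>o |C|"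
proof -
  have len: "|{xs :: 'a list. length xs = n}| \<le>o |C|" for n
  proof (induction n)
    case 0
    have "{xs :: 'a list. length xs = 0} = {[]}" by auto
    moreover have "|{[] :: 'a list}| \<le>o |C|" by (rule card_of_countable_le[OF C]) simp
    ultimately show ?case by simp
  next
    case (Suc n)
    have "{xs :: 'a list. length xs = Suc n} = (\<lambda>(x, xs). x # xs) ` (UNIV \<times> {xs. length xs = n})"
      by (force simp: length_Suc_conv)
    moreover have "|(UNIV :: 'a set) \<times> {xs :: 'a list. length xs = n}| \<le>o |C|"
      by (rule card_of_Times_le[OF C le Suc])
    ultimately show ?case using card_of_image ordLeq_transitive by metis
  qed
  have "|\<Union>n. {xs :: 'a list. length xs = n}| \<le>o |C|"
    by (rule card_of_UNION_ordLeq_infinite[OF C]) (use len C in \<open>auto simp: infinite_iff_card_of_nat\<close>)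
  moreover have "(\<Union>n. {xs :: 'a list. length xs = n}) = UNIV" by auto
  ultimately show ?thesis by simp
qed

lemma card_of_coords_le:
  assumes C: "infinite C" and le: "|UNIV :: 'v set| \<le>o |C|"
  shows "|UNIV :: ('v block \<times> 'v) set| \<le>o |C|"
proof -
  define enc :: "'v block \<times> 'v \<Rightarrow> 'v list" where
    "enc = (\<lambda>(b, k). k # (case b of Root \<Rightarrow> [] | Node v \<Rightarrow> [v] | Link v i u \<Rightarrow> [v, i, u]))"
  have "inj enc"
    by (rule injI) (auto simp: enc_def split: block.splits)
  then have "|UNIV :: ('v block \<times> 'v) set| \<le>o |UNIV :: 'v list set|"
    by (intro card_of_ordLeq[THEN iffD1]) blast
  then show ?thesis using card_of_list_le[OF C le] ordLeq_transitive by blast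
qed

text \<open>
  The vertex points, with all weight on one vertex, form a discrete subspace of size \<open>|C|\<close>; conversely,
  boxes with finitely many rational constraints form a base.
\<close>

lemma body_has_weight:
  fixes E :: "'v \<Rightarrow> 'v \<Rightarrow> bool" and C :: "'c set"
  assumes inf: "infinite C" and le: "|UNIV :: 'v set| \<le>o |C|" and ge: "|C| \<le>o |UNIV :: 'v set|"
  shows "has_weight (body_topology E) |C|"
  unfolding has_weight_def
proof (intro conjI allI impI)
  have lower: "|C| \<le>o |\<B>|" if B: "base_of (body_topology E) \<B>" for \<B>
  proof -
    define unit :: "'v \<Rightarrow> 'v block \<times> 'v \<Rightarrow> real" where "unit v = uniform_point {v} (\<lambda>_. None)" for v
    define W where "W v = {q \<in> body E. 1 / 2 < q (Root, v)}" for v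
    have W: "openin (body_topology E) (W v)" for v
      unfolding W_def by (rule openin_body_Collect_less) (rule continuous_on_coord)
    have u: "unit v \<in> W w \<longleftrightarrow> v = w" for v w
      using uniform_point_body[of "{v}" "\<lambda>_. None" E] by (auto simp: unit_def W_def uniform_point_simps)
    have "\<exists>V\<in>\<B>. unit v \<in> V \<and> V \<subseteq> W v" for v
      using B W u[of v v] unfolding base_of_def by blast
    then obtain V where V: "\<And>v. V v \<in> \<B>" "\<And>v. unit v \<in> V v" "\<And>v. V v \<subseteq> W v" by metis
    have "inj V"
    proof (rule injI)
      fix v w assume "V v = V w"
      then have "unit v \<in> W w" using V(2)[of v] V(3)[of w] by auto
      then show "v = w" using u by blast
    qed
    then have "|UNIV :: 'v set| \<le>o |\<B>|"
      using V(1) by (intro card_of_ordLeq[THEN iffD1]) blast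
    then show ?thesis using ge ordLeq_transitive by blast
  qed
  then show "|C| \<le>o |\<B>|" if "base_of (body_topology E) \<B>" for \<B> using that .
  define box :: "(('v block \<times> 'v) \<times> rat \<times> rat) list \<Rightarrow> ('v block \<times> 'v \<Rightarrow> real) set" where
    "box l = body E \<inter> {q. \<forall>(c, s, t)\<in>set l. of_rat s < q c \<and> q c < of_rat t}" for l
  have base: "base_of (body_topology E) (range box)"
    unfolding base_of_def
  proof (intro conjI ballI allI impI)
    fix B assume "B \<in> range box"
    then obtain l where B: "B = box l" by blast
    have "{q. \<forall>(c, s, t)\<in>set l. of_rat s < q c \<and> q c < of_rat t} =
      (\<Inter>(c, s, t)\<in>set l. {q :: 'v block \<times> 'v \<Rightarrow> real. of_rat s < q c} \<inter> {q. q c < of_rat t})" by auto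
    moreover have "open \<dots>"
      by (intro open_INT) (auto intro!: open_Int open_Collect_less continuous_on_const continuous_on_coord)
    ultimately show "openin (body_topology E) B"
      unfolding B box_def by (simp add: openin_open_Int)
  next
    fix U x assume U: "openin (body_topology E) U \<and> x \<in> U"
    then obtain G e where G: "finite G" "0 < (e :: real)"
      "\<And>q. q \<in> body E \<Longrightarrow> (\<And>c. c \<in> G \<Longrightarrow> \<bar>q c - x c\<bar> < e) \<Longrightarrow> q \<in> U"
      using openin_body_nbhd by metis
    have "\<exists>s t. x c - e < of_rat s \<and> of_rat s < x c \<and> x c < of_rat t \<and> of_rat t < x c + e" for c
      using of_rat_dense[of "x c - e" "x c"] of_rat_dense[of "x c" "x c + e"] G(2) by auto
    then obtain s t where st: "\<And>c. x c - e < of_rat (s c)" "\<And>c. of_rat (s c) < x c"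
      "\<And>c. x c < of_rat (t c)" "\<And>c. of_rat (t c) < x c + e" by metis
    obtain l where l: "set l = G" using finite_list[OF G(1)] by blast
    let ?l = "map (\<lambda>c. (c, s c, t c)) l"
    have "x \<in> box ?l" using U openin_subset[of "body_topology E" U] st by (auto simp: box_def)
    moreover have "box ?l \<subseteq> U"
    proof
      fix q assume q: "q \<in> box ?l"
      show "q \<in> U"
      proof (rule G(3))
        show "q \<in> body E" using q by (simp add: box_def)
        fix c assume "c \<in> G"
        then have "of_rat (s c) < q c" "q c < of_rat (t c)" using q l by (auto simp: box_def)
        then show "\<bar>q c - x c\<bar> < e" using st[of c] by (simp add: abs_less_iff)
      qed
    qed
    ultimately show "\<exists>V\<in>range box. x \<in> V \<and> V \<subseteq> U" by blast
  qed
  have "|UNIV :: rat set| \<le>o |C|"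
    by (rule card_of_countable_le[OF inf]) simp
  then have "|UNIV :: (rat \<times> rat) set| \<le>o |C|"
    using card_of_Times_le[OF inf, of "UNIV :: rat set" "UNIV :: rat set"] by simp
  then have "|UNIV :: (('v block \<times> 'v) \<times> rat \<times> rat) set| \<le>o |C|"
    using card_of_Times_le[OF inf card_of_coords_le[OF inf le], of "UNIV :: (rat \<times> rat) set"] by simp
  from card_of_list_le[OF inf this]
  have "|range box| \<le>o |C|" using card_of_image ordLeq_transitive by blast
  then have "|range box| =o |C|" using lower[OF base] by (simp add: ordIso_iff_ordLeq)
  then show "\<exists>\<B>. base_of (body_topology E) \<B> \<and> |\<B>| =o |C|" using base by blast
qed

lemma Pow_ctwo_cexp: "|Pow (UNIV :: 'k set)| =o ctwo ^c |UNIV :: 'k set|"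
proof -
  have "ctwo ^c |UNIV :: 'k set| = |Func (UNIV :: 'k set) (UNIV :: bool set)|"
    by (simp add: cexp_def ctwo_def Field_card_of)
  then show ?thesis by (simp only: card_of_Pow_Func)
qed

theorem mainTheorem1:
  assumes "uncountable (UNIV :: 'k set)"
  shows "\<exists>\<F> :: 'k ell2 set set.
    |\<F>| =o ctwo ^c |UNIV :: 'k set| \<and>
    (\<forall>C\<in>\<F>. compactin weak_topology C \<and> convex C \<and>
      has_weight (subtopology weak_topology C) |UNIV :: 'k set| ) \<and>
    pairwise (\<lambda>C D. \<not> subtopology weak_topology C homeomorphic_space
      subtopology weak_topology D) \<F>"
proof -
  let ?K = "UNIV :: 'k set"
  have inf: "infinite ?K" using assms by (rule uncountable_infinite)
  obtain r :: "'k rel" where r: "well_order_on UNIV r" using well_order_on by blast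
  have le: "|UNIV :: ('k \<times> bool \<times> bool) set| \<le>o |?K|"
  proof -
    have b: "|UNIV :: (bool \<times> bool) set| \<le>o |?K|"
      by (rule card_of_countable_le[OF inf]) simp
    show ?thesis
      using card_of_Times_le[OF inf card_of_refl[THEN ordIso_imp_ordLeq] b] by simp
  qed
  have ge: "|?K| \<le>o |UNIV :: ('k \<times> bool \<times> bool) set|"
    by (rule card_of_ordLeq[THEN iffD1], rule exI[of _ "\<lambda>k. (k, True, True)"]) (auto simp: inj_on_def)
  have "|UNIV :: ('k \<times> bool \<times> bool) set| \<le>o |UNIV :: (('k \<times> bool \<times> bool) block \<times> 'k \<times> bool \<times> bool) set|"
    by (rule card_of_ordLeq[THEN iffD1], rule exI[of _ "\<lambda>v. (Root, v)"]) (auto simp: inj_on_def)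
  then have "|?K| =o |UNIV :: (('k \<times> bool \<times> bool) block \<times> 'k \<times> bool \<times> bool) set|"
    using card_of_coords_le[OF inf le] ge ordLeq_transitive by (auto simp: ordIso_iff_ordLeq)
  then obtain j :: "'k \<Rightarrow> ('k \<times> bool \<times> bool) block \<times> 'k \<times> bool \<times> bool" where j: "bij j"
    using card_of_ordIso by blast
  define C :: "'k set \<Rightarrow> 'k ell2 set" where "C S = embed j ` body (coding_edge r S)" for S
  have hom: "homeomorphic_maps (body_topology (coding_edge r S)) (subtopology weak_topology (C S)) (embed j) (unembed j)" for S
    unfolding C_def by (rule embed_homeomorphic[OF j])
  have sub: "S \<subseteq> S'" if "subtopology weak_topology (C S) homeomorphic_space subtopology weak_topology (C S')" for S S'
  proof -
    have "body_topology (coding_edge r S) homeomorphic_space body_topology (coding_edge r S')"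
      using hom[of S] that hom[of S'] homeomorphic_space_trans homeomorphic_space_sym
      unfolding homeomorphic_space_def by (meson homeomorphic_maps_sym homeomorphic_space_def homeomorphic_space_trans)
    then obtain f g where fg: "homeomorphic_maps (body_topology (coding_edge r S)) (body_topology (coding_edge r S')) f g"
      unfolding homeomorphic_space_def by blast
    obtain h where "bij_betw h {v. \<exists>u. coding_edge r S v u} {v. \<exists>u. coding_edge r S' v u}"
      "(`) h ` in_neighbourhoods (coding_edge r S) = in_neighbourhoods (coding_edge r S')"
      by (rule homeomorphic_networks[OF coding_network[OF r assms] coding_network[OF r assms] fg])
    then show ?thesis
      unfolding coding_sources[OF r] by (rule in_neighbourhoods_determine[OF r])
  qed
  have eq: "S = S'" if "subtopology weak_topology (C S) homeomorphic_space subtopology weak_topology (C S')" for S S'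
    using sub[OF that] sub[of S' S] that homeomorphic_space_sym by blast
  have "inj C"
  proof (rule injI)
    fix S S' assume "C S = C S'"
    then show "S = S'" by (intro eq) (simp add: homeomorphic_space_refl)
  qed
  then have "|range C| =o |Pow ?K|"
    by (intro ordIso_symmetric[OF card_of_ordIsoI[of C]]) (simp add: bij_betw_def)
  then have card: "|range C| =o ctwo ^c |?K|"
    using Pow_ctwo_cexp ordIso_transitive by blast
  have compact: "compactin weak_topology (C S)" for S
  proof -
    have "compactin (body_topology (coding_edge r S)) (body (coding_edge r S))"
      using compact_body by (simp add: compactin_subtopology)
    moreover have "continuous_map (body_topology (coding_edge r S)) weak_topology (embed j)"
      using hom[of S] by (simp add: homeomorphic_maps_def continuous_map_in_subtopology)
    ultimately show ?thesis unfolding C_def by (rule image_compactin)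
  qed
  have weight: "has_weight (subtopology weak_topology (C S)) |?K|" for S
    by (rule has_weight_homeomorphic[OF hom body_has_weight[OF inf le ge]])
  have "pairwise (\<lambda>C D. \<not> subtopology weak_topology C homeomorphic_space subtopology weak_topology D) (range C)"
    unfolding pairwise_def using eq by blast
  moreover have "convex (C S)" for S unfolding C_def by (rule convex_embed[OF j])
  ultimately show ?thesis
    using card compact weight by (intro exI[of _ "range C"]) blast
qed

end
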